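(* Let $A$ be the monogenic extension of $K$ associated with $\alpha$ and $f$. If $\alpha$ is the identity map, then for all $m\ge0$ $$\mathrm{HH}^K_0(A)=\frac A{[A,A]},\qquad \mathrm{HH}^K_{2m+1}(A)=\frac A{[A,A]+f'A},\qquad \mathrm{HH}^K_{2m+2}(A)=\frac{([A,A]:f')}{[A,A]},$$ where $([A,A]:f')=\{a\in A:f'a\in[A,A]\}$.
   Context: Setting: $k$ is a commutative ring with $1$, $K$ is an associative unital $k$-algebra (not necessarily commutative), $\alpha$ is a $k$-algebra endomorphism of $K$, and $B=K[x,\alpha]$ is the Ore extension: the algebra generated by $K$ and $x$ subject to $x\lambda=\alpha(\lambda)x$ for $\lambda\in K$. Let $f=\sum_{i=0}^n\lambda_ix^{n-i}$ with $\lambda_0=1$, $n\ge 2$, $\lambda_i\in K$, $\alpha(\lambda_i)=\lambda_i$ and $\lambda_i\lambda=\alpha^i(\lambda)\lambda_i$ for all $\lambda\in K$ and $1\le i\le n$. The monogenic extension of $K$ associated with $\alpha$ and $f$ is $A=B/\langle f\rangle$. $f'=\sum_{i=1}^n i\lambda_{n-i}x^{i-1}$ is the derivative of $f$, and $[A,A]$ is the $k$-submodule of $A$ generated by the commutators $ab-ba$. $\mathrm{HH}^K_*(A)$ is the Hochschild homology of $A$ relative to $K$ with coefficients in $A$: the homology of the complex $(A\otimes_K\overline A^{\otimes_K^*}\otimes,b)$, where $\overline A=A/K$, $b$ is the canonical Hochschild boundary, and for a $K$-bimodule $N$, $N\otimes$ denotes the quotient of $N$ by the $k$-submodule generated by all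 $m\lambda-\lambda m$ ($m\in N,\lambda\in K$). Equalities are isomorphisms of $k$-modules. *)

theory Defs
  imports "HOL-Algebra.Module" "HOL-Algebra.QuotRing" "HOL-Algebra.UnivPoly"
begin

section \<open>Modules over a commutative ring\<close>

text \<open>
  The records of type \<^typ>\<open>('k, 'm) module\<close> extend rings. Where only a module is meant, the
  components \<open>mult\<close> and \<open>one\<close> carry no information (the locale \<^locale>\<open>module\<close> ignores them) and
  are left \<open>undefined\<close>.
\<close>

definition module_hom ::
  "('k, 'c) ring_scheme \<Rightarrow> ('k, 'm, 'd) module_scheme \<Rightarrow> ('k, 'n, 'e) module_scheme \<Rightarrow> ('m \<Rightarrow> 'n) set"
  where "module_hom k M N =
    {h \<in> carrier M \<rightarrow> carrier N.
      (\<forall>x\<in>carrier M. \<forall>y\<in>carrier M. h (x \<oplus>\<^bsub>M\<^esub> y) = h x \<oplus>\<^bsub>N\<^esub> h y) \<and>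
      (\<forall>c\<in>carrier k. \<forall>x\<in>carrier M. h (c \<odot>\<^bsub>M\<^esub> x) = c \<odot>\<^bsub>N\<^esub> h x)}"

definition module_isomorphic ::
  "('k, 'c) ring_scheme \<Rightarrow> ('k, 'm, 'd) module_scheme \<Rightarrow> ('k, 'n, 'e) module_scheme \<Rightarrow> bool"
  where "module_isomorphic k M N \<longleftrightarrow>
    (\<exists>h. h \<in> module_hom k M N \<and> bij_betw h (carrier M) (carrier N))"

definition module_span ::
  "('k, 'c) ring_scheme \<Rightarrow> ('k, 'm, 'd) module_scheme \<Rightarrow> 'm set \<Rightarrow> 'm set"
  where "module_span k M S = \<Inter>{H. submodule H k M \<and> S \<subseteq> H}"

definition quot_module :: "('k, 'm, 'd) module_scheme \<Rightarrow> 'm set \<Rightarrow> ('k, 'm set) module"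
  where "quot_module M N =
    \<lparr>carrier = a_rcosets\<^bsub>M\<^esub> N, mult = undefined, one = undefined,
     zero = N, add = set_add M,
     smult = (\<lambda>c X. \<Union>m\<in>X. N +>\<^bsub>M\<^esub> (c \<odot>\<^bsub>M\<^esub> m))\<rparr>"

text \<open>Finitely supported functions \<open>X \<rightarrow> k\<close>, extended by \<open>0\<close> outside \<open>X\<close>.\<close>

definition free_module :: "('k, 'c) ring_scheme \<Rightarrow> 'x set \<Rightarrow> ('k, 'x \<Rightarrow> 'k) module"
  where "free_module k X =
    \<lparr>carrier = {u. (\<forall>x. u x \<in> carrier k) \<and> (\<forall>x. x \<notin> X \<longrightarrow> u x = \<zero>\<^bsub>k\<^esub>) \<and> finite {x. u x \<noteq> \<zero>\<^bsub>k\<^esub>}},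
     mult = undefined, one = undefined,
     zero = (\<lambda>x. \<zero>\<^bsub>k\<^esub>), add = (\<lambda>u v x. u x \<oplus>\<^bsub>k\<^esub> v x),
     smult = (\<lambda>c u x. c \<otimes>\<^bsub>k\<^esub> u x)\<rparr>"

definition free_gen :: "('k, 'c) ring_scheme \<Rightarrow> 'x \<Rightarrow> 'x \<Rightarrow> 'k"
  where "free_gen k x = (\<lambda>y. if y = x then \<one>\<^bsub>k\<^esub> else \<zero>\<^bsub>k\<^esub>)"


section \<open>Associative unital algebras\<close>

text \<open>In contrast to the locale \<^locale>\<open>algebra\<close>, multiplication need not be commutative.\<close>

locale assoc_algebra = module R M + M?: ring M
  for R :: "('k, 'c) ring_scheme" (structure) and M :: "('k, 'a, 'd) module_scheme" (structure) +
  assumes smult_mult_left: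
      "\<lbrakk>c \<in> carrier R; x \<in> carrier M; y \<in> carrier M\<rbrakk> \<Longrightarrow>
        (c \<odot>\<^bsub>M\<^esub> x) \<otimes>\<^bsub>M\<^esub> y = c \<odot>\<^bsub>M\<^esub> (x \<otimes>\<^bsub>M\<^esub> y)"
    and smult_mult_right:
      "\<lbrakk>c \<in> carrier R; x \<in> carrier M; y \<in> carrier M\<rbrakk> \<Longrightarrow>
        x \<otimes>\<^bsub>M\<^esub> (c \<odot>\<^bsub>M\<^esub> y) = c \<odot>\<^bsub>M\<^esub> (x \<otimes>\<^bsub>M\<^esub> y)"

definition algebra_hom ::
  "('k, 'c) ring_scheme \<Rightarrow> ('k, 'a, 'd) module_scheme \<Rightarrow> ('k, 'b, 'e) module_scheme \<Rightarrow> ('a \<Rightarrow> 'b) set"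
  where "algebra_hom k A B = ring_hom A B \<inter> module_hom k A B"

definition commutator_submodule ::
  "('k, 'c) ring_scheme \<Rightarrow> ('k, 'a, 'd) module_scheme \<Rightarrow> 'a set"
  where "commutator_submodule k A =
    module_span k A {a \<otimes>\<^bsub>A\<^esub> b \<ominus>\<^bsub>A\<^esub> b \<otimes>\<^bsub>A\<^esub> a |a b. a \<in> carrier A \<and> b \<in> carrier A}"

definition quot_algebra :: "('k, 'a, 'd) module_scheme \<Rightarrow> 'a set \<Rightarrow> ('k, 'a set) module"
  where "quot_algebra A I =
    \<lparr>carrier = a_rcosets\<^bsub>A\<^esub> I, mult = rcoset_mult A I, one = I +>\<^bsub>A\<^esub> \<one>\<^bsub>A\<^esub>,
     zero = I, add = set_add A,
     smult = (\<lambda>c X. \<Union>a\<in>X. I +>\<^bsub>A\<^esub> (c \<odot>\<^bsub>A\<^esub> a))\<rparr>"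


section \<open>Hochschild homology of an algebra relative to a subalgebra\<close>

record ('k, 'l, 'm) bimodule = "('k, 'm) module" +
  lact :: "'l \<Rightarrow> 'm \<Rightarrow> 'm"
  ract :: "'m \<Rightarrow> 'l \<Rightarrow> 'm"

text \<open>
  An algebra homomorphism \<open>\<iota> : K \<rightarrow> A\<close> makes \<open>A\<close> a \<open>K\<close>-bimodule, of which \<open>A / \<iota>(K)\<close> is a quotient
  bimodule.
\<close>

definition regular_bimodule ::
  "('k, 'b, 'e) module_scheme \<Rightarrow> ('l \<Rightarrow> 'b) \<Rightarrow> ('k, 'l, 'b) bimodule"
  where "regular_bimodule A \<iota> =
    \<lparr>carrier = carrier A, mult = mult A, one = one A, zero = zero A, add = add A, smult = smult A,
     lact = (\<lambda>l a. \<iota> l \<otimes>\<^bsub>A\<^esub> a), ract = (\<lambda>a l. a \<otimes>\<^bsub>A\<^esub> \<iota> l)\<rparr>"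

definition quot_bimodule ::
  "('k, 'l, 'm) bimodule \<Rightarrow> 'm set \<Rightarrow> ('k, 'l, 'm set) bimodule"
  where "quot_bimodule M N =
    module.extend (quot_module M N)
      \<lparr>lact = (\<lambda>l X. \<Union>m\<in>X. N +>\<^bsub>M\<^esub> lact M l m),
       ract = (\<lambda>X l. \<Union>m\<in>X. N +>\<^bsub>M\<^esub> ract M m l)\<rparr>"

text \<open>
  For \<open>K\<close>-bimodules \<open>M\<close> and \<open>N\<close>, the \<open>k\<close>-module \<open>M \<otimes>\<^sub>K N \<otimes>\<^sub>K \<dots> \<otimes>\<^sub>K N\<close> with \<open>r\<close> factors \<open>N\<close> is the
  quotient of the free \<open>k\<close>-module on the tuples \<open>(m, [n\<^sub>1, \<dots>, n\<^sub>r])\<close> by the submodule generated by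
  \<open>tensor_relations\<close>. Applying the functor \<open>(\<hyphen>)\<otimes>\<close> to it means to divide in addition by the
  submodule generated by the differences \<open>t\<lambda> - \<lambda>t\<close>; it suffices to take the tuples for \<open>t\<close>, since
  these generate the tensor product and the actions are additive. These differences are the
  \<open>cyclic_relations\<close>.
\<close>

definition tensor_gens ::
  "('k, 'l, 'm) bimodule \<Rightarrow> ('k, 'l, 'n) bimodule \<Rightarrow> nat \<Rightarrow> ('m \<times> 'n list) set"
  where "tensor_gens M N r = {(m, ns). m \<in> carrier M \<and> ns \<in> lists (carrier N) \<and> length ns = r}"

abbreviation tensor_free ::
  "('k, 'c) ring_scheme \<Rightarrow> ('k, 'l, 'm) bimodule \<Rightarrow> ('k, 'l, 'n) bimodule \<Rightarrow> nat
    \<Rightarrow> ('k, 'm \<times> 'n list \<Rightarrow> 'k) module"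
  where "tensor_free k M N r \<equiv> free_module k (tensor_gens M N r)"

inductive_set tensor_relations ::
  "('k, 'c) ring_scheme \<Rightarrow> ('l, 'd) ring_scheme \<Rightarrow> ('k, 'l, 'm) bimodule \<Rightarrow> ('k, 'l, 'n) bimodule
    \<Rightarrow> nat \<Rightarrow> ('m \<times> 'n list \<Rightarrow> 'k) set"
  for k :: "('k, 'c) ring_scheme" and K :: "('l, 'd) ring_scheme"
    and M :: "('k, 'l, 'm) bimodule" and N :: "('k, 'l, 'n) bimodule" and r :: nat
  where
    add_head:
      "\<lbrakk>(m, ns) \<in> tensor_gens M N r; (m', ns) \<in> tensor_gens M N r\<rbrakk> \<Longrightarrow>
        free_gen k (m \<oplus>\<^bsub>M\<^esub> m', ns)
          \<ominus>\<^bsub>tensor_free k M N r\<^esub> (free_gen k (m, ns) \<oplus>\<^bsub>tensor_free k M N r\<^esub> free_gen k (m', ns))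
        \<in> tensor_relations k K M N r"
  | smult_head:
      "\<lbrakk>c \<in> carrier k; (m, ns) \<in> tensor_gens M N r\<rbrakk> \<Longrightarrow>
        free_gen k (c \<odot>\<^bsub>M\<^esub> m, ns)
          \<ominus>\<^bsub>tensor_free k M N r\<^esub> c \<odot>\<^bsub>tensor_free k M N r\<^esub> free_gen k (m, ns)
        \<in> tensor_relations k K M N r"
  | add_tail:
      "\<lbrakk>(m, us @ n # vs) \<in> tensor_gens M N r; (m, us @ n' # vs) \<in> tensor_gens M N r\<rbrakk> \<Longrightarrow>
        free_gen k (m, us @ (n \<oplus>\<^bsub>N\<^esub> n') # vs)
          \<ominus>\<^bsub>tensor_free k M N r\<^esub>
            (free_gen k (m, us @ n # vs) \<oplus>\<^bsub>tensor_free k M N r\<^esub> free_gen k (m, us @ n' # vs))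
        \<in> tensor_relations k K M N r"
  | smult_tail:
      "\<lbrakk>c \<in> carrier k; (m, us @ n # vs) \<in> tensor_gens M N r\<rbrakk> \<Longrightarrow>
        free_gen k (m, us @ (c \<odot>\<^bsub>N\<^esub> n) # vs)
          \<ominus>\<^bsub>tensor_free k M N r\<^esub> c \<odot>\<^bsub>tensor_free k M N r\<^esub> free_gen k (m, us @ n # vs)
        \<in> tensor_relations k K M N r"
  | balanced_head:
      "\<lbrakk>l \<in> carrier K; (m, n # vs) \<in> tensor_gens M N r\<rbrakk> \<Longrightarrow>
        free_gen k (ract M m l, n # vs)
          \<ominus>\<^bsub>tensor_free k M N r\<^esub> free_gen k (m, lact N l n # vs)
        \<in> tensor_relations k K M N r"
  | balanced_tail:
      "\<lbrakk>l \<in> carrier K; (m, us @ n # n' # vs) \<in> tensor_gens M N r\<rbrakk> \<Longrightarrow>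
        free_gen k (m, us @ ract N n l # n' # vs)
          \<ominus>\<^bsub>tensor_free k M N r\<^esub> free_gen k (m, us @ n # lact N l n' # vs)
        \<in> tensor_relations k K M N r"

fun tensor_lact ::
  "('k, 'l, 'm) bimodule \<Rightarrow> 'l \<Rightarrow> 'm \<times> 'n list \<Rightarrow> 'm \<times> 'n list"
  where "tensor_lact M l (m, ns) = (lact M l m, ns)"

fun tensor_ract ::
  "('k, 'l, 'm) bimodule \<Rightarrow> ('k, 'l, 'n) bimodule \<Rightarrow> 'm \<times> 'n list \<Rightarrow> 'l \<Rightarrow> 'm \<times> 'n list"
  where "tensor_ract M N (m, ns) l =
    (if ns = [] then (ract M m l, []) else (m, butlast ns @ [ract N (last ns) l]))"

definition cyclic_relations ::
  "('k, 'c) ring_scheme \<Rightarrow> ('l, 'd) ring_scheme \<Rightarrow> ('k, 'l, 'm) bimodule \<Rightarrow> ('k, 'l, 'n) bimodule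
    \<Rightarrow> nat \<Rightarrow> ('m \<times> 'n list \<Rightarrow> 'k) set"
  where "cyclic_relations k K M N r =
    {free_gen k (tensor_ract M N t l) \<ominus>\<^bsub>tensor_free k M N r\<^esub> free_gen k (tensor_lact M l t) |t l.
      t \<in> tensor_gens M N r \<and> l \<in> carrier K}"

definition cyclic_tensor_relations ::
  "('k, 'c) ring_scheme \<Rightarrow> ('l, 'd) ring_scheme \<Rightarrow> ('k, 'l, 'm) bimodule \<Rightarrow> ('k, 'l, 'n) bimodule
    \<Rightarrow> nat \<Rightarrow> ('m \<times> 'n list \<Rightarrow> 'k) set"
  where "cyclic_tensor_relations k K M N r =
    module_span k (tensor_free k M N r)
      (tensor_relations k K M N r \<union> cyclic_relations k K M N r)"

definition cyclic_tensor ::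
  "('k, 'c) ring_scheme \<Rightarrow> ('l, 'd) ring_scheme \<Rightarrow> ('k, 'l, 'm) bimodule \<Rightarrow> ('k, 'l, 'n) bimodule
    \<Rightarrow> nat \<Rightarrow> ('k, ('m \<times> 'n list \<Rightarrow> 'k) set) module"
  where "cyclic_tensor k K M N r =
    quot_module (tensor_free k M N r) (cyclic_tensor_relations k K M N r)"

definition reduced_bimodule ::
  "('l, 'd) ring_scheme \<Rightarrow> ('k, 'b, 'e) module_scheme \<Rightarrow> ('l \<Rightarrow> 'b) \<Rightarrow> ('k, 'l, 'b set) bimodule"
  where "reduced_bimodule K A \<iota> = quot_bimodule (regular_bimodule A \<iota>) (\<iota> ` carrier K)"

definition hoch_chains ::
  "('k, 'c) ring_scheme \<Rightarrow> ('l, 'd) ring_scheme \<Rightarrow> ('k, 'b, 'e) module_scheme \<Rightarrow> ('l \<Rightarrow> 'b) \<Rightarrow> nat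
    \<Rightarrow> ('k, ('b \<times> 'b set list \<Rightarrow> 'k) set) module"
  where "hoch_chains k K A \<iota> r =
    cyclic_tensor k K (regular_bimodule A \<iota>) (reduced_bimodule K A \<iota>) r"

text \<open>
  The class of \<open>a \<otimes> \<overline>a\<^sub>1 \<otimes> \<dots> \<otimes> \<overline>a\<^sub>r\<close>, where \<open>\<overline>a\<^sub>i\<close> is the class of \<open>a\<^sub>i\<close> modulo \<open>K\<close>.
\<close>

definition hoch_pure ::
  "('k, 'c) ring_scheme \<Rightarrow> ('l, 'd) ring_scheme \<Rightarrow> ('k, 'b, 'e) module_scheme \<Rightarrow> ('l \<Rightarrow> 'b)
    \<Rightarrow> 'b \<times> 'b list \<Rightarrow> ('b \<times> 'b set list \<Rightarrow> 'k) set"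
  where "hoch_pure k K A \<iota> = (\<lambda>(a, as).
    cyclic_tensor_relations k K (regular_bimodule A \<iota>) (reduced_bimodule K A \<iota>) (length as)
      +>\<^bsub>tensor_free k (regular_bimodule A \<iota>) (reduced_bimodule K A \<iota>) (length as)\<^esub>
        free_gen k (a, map (\<lambda>x. (\<iota> ` carrier K) +>\<^bsub>A\<^esub> x) as))"

fun hoch_face :: "('b, 'e) monoid_scheme \<Rightarrow> nat \<Rightarrow> 'b \<times> 'b list \<Rightarrow> 'b \<times> 'b list"
  where "hoch_face A i (a, as) =
    (if i = 0 then (a \<otimes>\<^bsub>A\<^esub> hd as, tl as)
     else if i = length as then (last as \<otimes>\<^bsub>A\<^esub> a, butlast as)
     else (a, take (i - 1) as @ (as ! (i - 1) \<otimes>\<^bsub>A\<^esub> as ! i) # drop (i + 1) as))"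

text \<open>
  The boundary in degree \<open>r > 0\<close>. There is only one linear map with these values because the pure
  tensors generate. A single summand on the right-hand side is not well defined on the tensor
  product over \<open>K\<close> of copies of \<open>A / K\<close>; the alternating sum is.
\<close>

definition hoch_boundary ::
  "('k, 'c) ring_scheme \<Rightarrow> ('l, 'd) ring_scheme \<Rightarrow> ('k, 'b, 'e) module_scheme \<Rightarrow> ('l \<Rightarrow> 'b) \<Rightarrow> nat
    \<Rightarrow> ('b \<times> 'b set list \<Rightarrow> 'k) set \<Rightarrow> ('b \<times> 'b set list \<Rightarrow> 'k) set"
  where "hoch_boundary k K A \<iota> r =
    (THE b. b \<in> module_hom k (hoch_chains k K A \<iota> r) (hoch_chains k K A \<iota> (r - 1)) \<and>
      b \<in> extensional (carrier (hoch_chains k K A \<iota> r)) \<and>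
      (\<forall>a\<in>carrier A. \<forall>as\<in>lists (carrier A). length as = r \<longrightarrow>
        b (hoch_pure k K A \<iota> (a, as)) =
          (\<Oplus>\<^bsub>hoch_chains k K A \<iota> (r - 1)\<^esub>i\<in>{..r}.
            ((\<ominus>\<^bsub>k\<^esub> \<one>\<^bsub>k\<^esub>) [^]\<^bsub>k\<^esub> i) \<odot>\<^bsub>hoch_chains k K A \<iota> (r - 1)\<^esub>
              hoch_pure k K A \<iota> (hoch_face A i (a, as)))))"

definition hoch_cycles ::
  "('k, 'c) ring_scheme \<Rightarrow> ('l, 'd) ring_scheme \<Rightarrow> ('k, 'b, 'e) module_scheme \<Rightarrow> ('l \<Rightarrow> 'b) \<Rightarrow> nat
    \<Rightarrow> ('b \<times> 'b set list \<Rightarrow> 'k) set set"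
  where "hoch_cycles k K A \<iota> r =
    (if r = 0 then carrier (hoch_chains k K A \<iota> 0)
     else {z \<in> carrier (hoch_chains k K A \<iota> r).
       hoch_boundary k K A \<iota> r z = \<zero>\<^bsub>hoch_chains k K A \<iota> (r - 1)\<^esub>})"

definition hoch_homology ::
  "('k, 'c) ring_scheme \<Rightarrow> ('l, 'd) ring_scheme \<Rightarrow> ('k, 'b, 'e) module_scheme \<Rightarrow> ('l \<Rightarrow> 'b) \<Rightarrow> nat
    \<Rightarrow> ('k, ('b \<times> 'b set list \<Rightarrow> 'k) set set) module"
  where "hoch_homology k K A \<iota> r =
    quot_module ((hoch_chains k K A \<iota> r)\<lparr>carrier := hoch_cycles k K A \<iota> r\<rparr>)
      (hoch_boundary k K A \<iota> (r + 1) ` carrier (hoch_chains k K A \<iota> (r + 1)))"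


section \<open>Ore extensions and monogenic extensions\<close>

text \<open>
  \<open>K[x, \<alpha>]\<close> is the free left \<open>K\<close>-module on the powers of \<open>x\<close>: the function \<open>p\<close> stands for
  \<open>\<Sum>i. p i x\<^sup>i\<close>, and \<open>x\<^sup>i \<mu> = \<alpha>\<^sup>i(\<mu>) x\<^sup>i\<close> dictates the multiplication.
\<close>

definition ore_ext :: "('k, 'a, 'd) module_scheme \<Rightarrow> ('a \<Rightarrow> 'a) \<Rightarrow> ('k, nat \<Rightarrow> 'a) module"
  where "ore_ext K \<alpha> =
    \<lparr>carrier = up K,
     mult = (\<lambda>p q m. \<Oplus>\<^bsub>K\<^esub>i\<in>{..m}. p i \<otimes>\<^bsub>K\<^esub> (\<alpha> ^^ i) (q (m - i))),
     one = (\<lambda>i. if i = 0 then \<one>\<^bsub>K\<^esub> else \<zero>\<^bsub>K\<^esub>),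
     zero = (\<lambda>i. \<zero>\<^bsub>K\<^esub>),
     add = (\<lambda>p q i. p i \<oplus>\<^bsub>K\<^esub> q i),
     smult = (\<lambda>c p i. c \<odot>\<^bsub>K\<^esub> p i)\<rparr>"

definition ore_const :: "('k, 'a, 'd) module_scheme \<Rightarrow> 'a \<Rightarrow> nat \<Rightarrow> 'a"
  where "ore_const K l = (\<lambda>i. if i = 0 then l else \<zero>\<^bsub>K\<^esub>)"

definition ore_var :: "('k, 'a, 'd) module_scheme \<Rightarrow> nat \<Rightarrow> 'a"
  where "ore_var K = (\<lambda>i. if i = 1 then \<one>\<^bsub>K\<^esub> else \<zero>\<^bsub>K\<^esub>)"

definition mono_poly ::
  "('k, 'a, 'd) module_scheme \<Rightarrow> ('a \<Rightarrow> 'a) \<Rightarrow> nat \<Rightarrow> (nat \<Rightarrow> 'a) \<Rightarrow> nat \<Rightarrow> 'a"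
  where "mono_poly K \<alpha> n lam =
    (\<Oplus>\<^bsub>ore_ext K \<alpha>\<^esub>i\<in>{0..n}.
      ore_const K (lam i) \<otimes>\<^bsub>ore_ext K \<alpha>\<^esub> (ore_var K [^]\<^bsub>ore_ext K \<alpha>\<^esub> (n - i)))"

definition mono_poly_deriv ::
  "('k, 'a, 'd) module_scheme \<Rightarrow> ('a \<Rightarrow> 'a) \<Rightarrow> nat \<Rightarrow> (nat \<Rightarrow> 'a) \<Rightarrow> nat \<Rightarrow> 'a"
  where "mono_poly_deriv K \<alpha> n lam =
    (\<Oplus>\<^bsub>ore_ext K \<alpha>\<^esub>i\<in>{1..n}.
      [i] \<cdot>\<^bsub>ore_ext K \<alpha>\<^esub>
        (ore_const K (lam (n - i)) \<otimes>\<^bsub>ore_ext K \<alpha>\<^esub> (ore_var K [^]\<^bsub>ore_ext K \<alpha>\<^esub> (i - 1))))"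

definition mono_ideal ::
  "('k, 'a, 'd) module_scheme \<Rightarrow> ('a \<Rightarrow> 'a) \<Rightarrow> nat \<Rightarrow> (nat \<Rightarrow> 'a) \<Rightarrow> (nat \<Rightarrow> 'a) set"
  where "mono_ideal K \<alpha> n lam = Idl\<^bsub>ore_ext K \<alpha>\<^esub> {mono_poly K \<alpha> n lam}"

definition monogenic_ext ::
  "('k, 'a, 'd) module_scheme \<Rightarrow> ('a \<Rightarrow> 'a) \<Rightarrow> nat \<Rightarrow> (nat \<Rightarrow> 'a) \<Rightarrow> ('k, (nat \<Rightarrow> 'a) set) module"
  where "monogenic_ext K \<alpha> n lam = quot_algebra (ore_ext K \<alpha>) (mono_ideal K \<alpha> n lam)"

definition mono_class ::
  "('k, 'a, 'd) module_scheme \<Rightarrow> ('a \<Rightarrow> 'a) \<Rightarrow> nat \<Rightarrow> (nat \<Rightarrow> 'a) \<Rightarrow> (nat \<Rightarrow> 'a) \<Rightarrow> (nat \<Rightarrow> 'a) set"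
  where "mono_class K \<alpha> n lam p = mono_ideal K \<alpha> n lam +>\<^bsub>ore_ext K \<alpha>\<^esub> p"

definition mono_incl ::
  "('k, 'a, 'd) module_scheme \<Rightarrow> ('a \<Rightarrow> 'a) \<Rightarrow> nat \<Rightarrow> (nat \<Rightarrow> 'a) \<Rightarrow> 'a \<Rightarrow> (nat \<Rightarrow> 'a) set"
  where "mono_incl K \<alpha> n lam l = mono_class K \<alpha> n lam (ore_const K l)"

locale monogenic_data = assoc_algebra k K
  for k :: "('k, 'c) ring_scheme" and K :: "('k, 'a, 'd) module_scheme" +
  fixes \<alpha> :: "'a \<Rightarrow> 'a" and n :: nat and lam :: "nat \<Rightarrow> 'a"
  assumes endo: "\<alpha> \<in> algebra_hom k K K"
    and degree: "n \<ge> 2"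
    and lam_closed: "i \<le> n \<Longrightarrow> lam i \<in> carrier K"
    and lam_zero: "lam 0 = \<one>\<^bsub>K\<^esub>"
    and endo_lam: "\<lbrakk>1 \<le> i; i \<le> n\<rbrakk> \<Longrightarrow> \<alpha> (lam i) = lam i"
    and lam_twist: "\<lbrakk>1 \<le> i; i \<le> n; l \<in> carrier K\<rbrakk> \<Longrightarrow> lam i \<otimes>\<^bsub>K\<^esub> l = (\<alpha> ^^ i) l \<otimes>\<^bsub>K\<^esub> lam i"

text \<open>\<open>HH\<^sup>K\<^sub>r(A)\<close> for the monogenic extension \<open>A\<close>.\<close>

definition mono_HH ::
  "('k, 'c) ring_scheme \<Rightarrow> ('k, 'a, 'd) module_scheme \<Rightarrow> ('a \<Rightarrow> 'a) \<Rightarrow> nat \<Rightarrow> (nat \<Rightarrow> 'a) \<Rightarrow> nat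
    \<Rightarrow> ('k, ((nat \<Rightarrow> 'a) set \<times> (nat \<Rightarrow> 'a) set set list \<Rightarrow> 'k) set set) module"
  where "mono_HH k K \<alpha> n lam r =
    hoch_homology k K (monogenic_ext K \<alpha> n lam) (mono_incl K \<alpha> n lam) r"

end

theory Submission
  imports Defs "HOL-Library.Poly_Mapping" "HOL-Library.Multiset"
    "HOL-Computational_Algebra.Polynomial"
begin

text \<open>
  If \<open>\<alpha>\<close> is the identity, then \<open>x\<close> is central in \<open>A\<close> and the coefficients of \<open>f\<close> lie in the centre of
  \<open>K\<close>. Hence \<open>A\<close> is an algebra over the commutative ring \<open>R = \<int>[c\<^sub>1, \<dots>, c\<^sub>n\<^sub>-\<^sub>1, y]\<close>, where \<open>y\<close> acts as
  \<open>x\<close> and \<open>c\<^sub>j\<close> as the coefficient of \<open>x\<^sup>j\<close> in \<open>f\<close>. Over \<open>R\<close> there is the universal monic polynomial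
  with coefficients \<open>c\<^sub>j\<close> whose constant term is chosen such that \<open>y\<close> is a root. Write \<open>f\<close> for it, too; then
  \<open>R\<close> is a module over \<open>S = R[X]/(f)\<close> on which \<open>X\<close> acts as \<open>y\<close>.

  The powers of \<open>x\<close> below \<open>n\<close> are a basis of \<open>A\<close> over \<open>K\<close> that commutes with \<open>K\<close>. Elements of \<open>K\<close> in a
  chain can therefore be moved into the first factor, around the circle if necessary, and every chain of
  degree \<open>r\<close> is a sum of chains \<open>a \<otimes> x\<^sup>t\<^sup>1 \<otimes> \<dots> \<otimes> x\<^sup>t\<^sup>r\<close> with \<open>1 \<le> t\<^sub>i < n\<close> (\<open>chain_normal_form\<close>). The
  coefficients \<open>a\<close> matter, and are determined, only modulo \<open>[A, A]\<close>. To see that they are determined, extend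
  a normalized cochain \<open>F\<close> of \<open>S\<close> with values in \<open>R\<close> to a \<open>K\<close>-multilinear map on \<open>A\<close>. It gives a linear map
  \<open>\<theta>\<close> from the chains to \<open>A/[A, A]\<close> with \<open>a \<otimes> a\<^sub>1 \<otimes> \<dots> \<otimes> a\<^sub>r \<mapsto> a F(a\<^sub>1, \<dots>, a\<^sub>r)\<close>, and all these maps together
  are injective (\<open>\<theta>_jointly_injective\<close>). They carry the boundary to the coboundary of \<open>F\<close>
  (\<open>\<theta>_boundary\<close>). In this way the complex of chains becomes accessible through formulas about cochains of
  \<open>S\<close>, which live over a commutative ring.

  The \<open>S\<close>-module \<open>R\<close> has a resolution by free modules of rank one in which multiplication by \<open>X - y\<close> and by
  \<open>f / (X - y)\<close> alternate. At \<open>y\<close> these two polynomials have the values \<open>0\<close> and \<open>f'(y)\<close>. The comparison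
  with the bar resolution is explicit: a cochain \<open>F\<close> is evaluated at the tuple whose entries are alternately
  \<open>X\<close> and \<open>f / (X - y)\<close>, which is \<open>W\<close>; conversely there is a cochain \<open>psi\<close> built from the quotients of
  \<open>X\<^sup>i\<^sup>+\<^sup>j\<close> by \<open>f\<close> and the derivatives of the \<open>X\<^sup>i\<close>. Then \<open>W\<close> takes the value \<open>1\<close> at \<open>psi\<close>, and the theorem
  \<open>homotopy\<close> expresses the difference between \<open>F\<close> and \<open>W(F) psi\<close> by coboundaries. Transposed to chains
  this says that the Hochschild complex is homotopy equivalent to
  the complex with \<open>A/[A, A]\<close> in all degrees whose maps are zero out of odd degrees and multiplication by \<open>f'\<close>
  out of positive even ones. The homology of this complex is the one claimed.
\<close>

section \<open>Normalized cochains of a monogenic commutative algebra\<close>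

abbreviation xpow :: "nat \<Rightarrow> 'r::comm_ring_1 poly"
  where "xpow i \<equiv> monom 1 i"

text \<open>
  Let \<open>S = R[X]/(f)\<close>, which is free over \<open>R\<close> on the powers of \<open>X\<close> below \<open>n\<close>. A cochain of degree \<open>r\<close> of \<open>S\<close>
  with values in \<open>R\<close> is an \<open>R\<close>-multilinear form in \<open>r\<close> arguments, so it is determined by its values on
  tuples of these powers. A function on lists of exponents stands for one cochain in each degree.
\<close>

locale monic_root =
  fixes f :: "'r::comm_ring_1 poly" and y :: 'r and n :: nat
  assumes degree_f: "degree f = n" and monic_f: "coeff f n = 1"
    and root: "poly f y = 0" and n_ge_2: "n \<ge> 2"
begin

text \<open>
  As \<open>f\<close> is monic, division with remainder works over the ring \<open>R\<close>, and the result is unique.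
\<close>

definition is_rem :: "'r poly \<Rightarrow> 'r poly \<times> 'r poly \<Rightarrow> bool"
  where "is_rem P qr \<longleftrightarrow> P = fst qr * f + snd qr \<and> (\<forall>i\<ge>n. coeff (snd qr) i = 0)"

lemma f_nonzero: "f \<noteq> 0"
  using degree_f n_ge_2 by auto

lemma is_rem_exists: "\<exists>qr. is_rem P qr"
proof -
  obtain q r where qr: "pseudo_divmod P f = (q, r)"
    by fastforce
  have "P = q * f + r"
    using pseudo_divmod(1)[OF f_nonzero qr] monic_f degree_f by (simp add: mult.commute)
  moreover have "\<forall>i\<ge>n. coeff r i = 0"
    using pseudo_divmod(2)[OF f_nonzero qr] degree_f by (auto intro: coeff_eq_0)
  ultimately show ?thesis
    unfolding is_rem_def by (intro exI[of _ "(q, r)"]) simp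
qed

lemma mult_f_low:
  assumes "\<forall>i\<ge>n. coeff (q * f) i = 0"
  shows "q = 0"
proof -
  have "coeff (q * f) (degree q + n) = lead_coeff q"
    using coeff_mult_degree_sum[of q f] degree_f monic_f by simp
  with assms have "lead_coeff q = 0" by simp
  then show ?thesis by simp
qed

lemma is_rem_unique:
  assumes "is_rem P qr" "is_rem P qr'"
  shows "qr = qr'"
proof -
  have eq: "(fst qr - fst qr') * f = snd qr' - snd qr"
    using assms unfolding is_rem_def by (simp add: algebra_simps)
  then have "fst qr - fst qr' = 0"
    using assms unfolding is_rem_def by (intro mult_f_low) simp
  then show ?thesis
    using eq by (simp add: prod_eq_iff)
qed

definition quo :: "'r poly \<Rightarrow> 'r poly"
  where "quo P = fst (THE qr. is_rem P qr)"

definition rem :: "'r poly \<Rightarrow> 'r poly"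
  where "rem P = snd (THE qr. is_rem P qr)"

lemma quo_rem_is_rem: "is_rem P (quo P, rem P)"
proof -
  obtain qr where "is_rem P qr" using is_rem_exists by blast
  then have "is_rem P (THE qr. is_rem P qr)"
    by (rule theI) (use is_rem_unique \<open>is_rem P qr\<close> in blast)
  then show ?thesis by (simp add: quo_def rem_def)
qed

lemma quo_rem: "P = quo P * f + rem P"
  using quo_rem_is_rem by (simp add: is_rem_def)

lemma rem_high: "i \<ge> n \<Longrightarrow> coeff (rem P) i = 0"
  using quo_rem_is_rem by (simp add: is_rem_def)

lemma quo_rem_eqI:
  assumes "P = q * f + r" "\<And>i. i \<ge> n \<Longrightarrow> coeff r i = 0"
  shows "quo P = q" "rem P = r"
  using is_rem_unique[OF quo_rem_is_rem[of P], of "(q, r)"] assms by (auto simp: is_rem_def)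

lemma quo_add: "quo (P + Q) = quo P + quo Q" and rem_add: "rem (P + Q) = rem P + rem Q"
  using quo_rem_eqI[of "P + Q" "quo P + quo Q" "rem P + rem Q"] quo_rem[of P] quo_rem[of Q]
  by (auto simp: rem_high distrib_right) (metis add.assoc add.left_commute)+

lemma quo_smult: "quo (smult c P) = smult c (quo P)" and rem_smult: "rem (smult c P) = smult c (rem P)"
proof -
  have "smult c P = smult c (quo P) * f + smult c (rem P)"
    by (subst quo_rem[of P]) (simp add: smult_add_right)
  from quo_rem_eqI[OF this] show "quo (smult c P) = smult c (quo P)" "rem (smult c P) = smult c (rem P)"
    by (simp_all add: rem_high)
qed

lemma rem_0 [simp]: "rem 0 = 0" and quo_0 [simp]: "quo 0 = 0"
  using quo_rem_eqI[of 0 0 0] by auto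

lemma rem_sum: "rem (sum G A) = (\<Sum>a\<in>A. rem (G a))"
  by (induction A rule: infinite_finite_induct) (auto simp: rem_add)

lemma rem_low:
  assumes "\<And>i. i \<ge> n \<Longrightarrow> coeff P i = 0"
  shows "rem P = P" "quo P = 0"
  using quo_rem_eqI[of P 0 P] assms by auto

lemma rem_xpow [simp]: "i < n \<Longrightarrow> rem (xpow i) = xpow i" "i < n \<Longrightarrow> quo (xpow i) = 0"
  by (rule rem_low, simp)+

lemma rem_add_mult_f: "rem (P + Q * f) = rem P"
proof (rule quo_rem_eqI(2))
  show "P + Q * f = (quo P + Q) * f + rem P"
    by (subst quo_rem[of P]) (simp add: algebra_simps)
qed (rule rem_high)

lemma poly_rem [simp]: "poly (rem P) y = poly P y"
proof -
  have "poly P y = poly (quo P * f + rem P) y" using quo_rem[of P] by simp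
  then show ?thesis by (simp add: root)
qed

lemma rem_expand: "rem P = (\<Sum>l<n. smult (coeff (rem P) l) (xpow l))"
proof (rule poly_eqI)
  fix i
  show "coeff (rem P) i = coeff (\<Sum>l<n. smult (coeff (rem P) l) (xpow l)) i"
    by (cases "i < n") (auto simp: coeff_sum rem_high if_distrib sum.delta cong: if_cong)
qed

lemma rem_mult_rem: "rem (P * rem Q) = rem (P * Q)"
proof -
  have "P * Q = P * rem Q + (P * quo Q) * f"
    by (subst quo_rem[of Q]) (simp add: algebra_simps)
  then show ?thesis by (simp add: rem_add_mult_f)
qed

text \<open>
  The first argument of a cochain, put equal to the class of an arbitrary polynomial.
\<close>

definition ins :: "(nat list \<Rightarrow> 'r) \<Rightarrow> 'r poly \<Rightarrow> nat list \<Rightarrow> 'r"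
  where "ins F P t = (\<Sum>l<n. coeff (rem P) l * F (l # t))"

lemma ins_rem: "ins F (P * rem Q) t = ins F (P * Q) t"
  by (simp add: ins_def rem_mult_rem)

lemma ins_add: "ins F (P + Q) t = ins F P t + ins F Q t"
  by (simp add: ins_def rem_add sum.distrib algebra_simps)

lemma ins_smult: "ins F (smult c P) t = c * ins F P t"
  by (simp add: ins_def rem_smult sum_distrib_left algebra_simps)

lemma ins_0 [simp]: "ins F 0 t = 0"
  by (simp add: ins_def)

lemma ins_minus: "ins F (- P) t = - ins F P t"
  using ins_add[of F P "-P" t] by (simp add: eq_neg_iff_add_eq_0 add.commute)

lemma ins_diff: "ins F (P - Q) t = ins F P t - ins F Q t"
  using ins_add[of F P "-Q" t] by (simp add: ins_minus)

lemma ins_sum: "ins F (sum G A) t = (\<Sum>a\<in>A. ins F (G a) t)"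
  by (induction A rule: infinite_finite_induct) (auto simp: ins_add)

lemma ins_add_mult_f: "ins F (P + Q * f) t = ins F P t"
  by (simp add: ins_def rem_add_mult_f)

lemma ins_xpow [simp]: "i < n \<Longrightarrow> ins F (xpow i) t = F (i # t)"
proof -
  assume "i < n"
  then have "ins F (xpow i) t = (\<Sum>l<n. if l = i then F (i # t) else 0)"
    unfolding ins_def by (intro sum.cong) auto
  with \<open>i < n\<close> show ?thesis by simp
qed

lemma ins_xpow_fun [simp]: "i < n \<Longrightarrow> ins F (xpow i) = (\<lambda>t. F (i # t))"
  by (rule ext) (rule ins_xpow)

lemma ins_1 [simp]: "ins F 1 = (\<lambda>t. F (0 # t))"
  using ins_xpow_fun[of 0 F] n_ge_2 by simp

lemma ins_expand: "ins F (P * Q) t = (\<Sum>l<n. coeff (rem P) l * ins F (xpow l * Q) t)"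
proof -
  have "ins F (P * Q) t = ins F (Q * rem P) t" by (simp add: ins_rem mult.commute)
  also have "\<dots> = ins F (\<Sum>l<n. smult (coeff (rem P) l) (xpow l * Q)) t"
    by (subst rem_expand) (simp add: sum_distrib_left mult.commute)
  finally show ?thesis by (simp add: ins_sum ins_smult)
qed

text \<open>
  The faces in the Hochschild coboundary of \<open>F\<close> at \<open>(P, t\<^sub>1, \<dots>, t\<^sub>r)\<close> other than the first one:
  \<open>F(P t\<^sub>1, t\<^sub>2, \<dots>) - F(P, t\<^sub>1 t\<^sub>2, \<dots>) + \<dots> \<plusminus> F(P, t\<^sub>1, \<dots>, t\<^sub>r\<^sub>-\<^sub>1) y\<^sup>t\<^sup>r\<close>, where \<open>t\<^sub>i\<close> also stands for the power
  of \<open>X\<close>. After the first of them, the rest are faces of the same kind for the cochain with first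
  argument \<open>P\<close>. The sum over \<open>l\<close> is that cochain in coordinates, which makes linearity in \<open>P\<close> evident before
  linearity in \<open>F\<close> is known; \<open>beta_Cons\<close> is the intended equation.
\<close>

fun beta :: "(nat list \<Rightarrow> 'r) \<Rightarrow> 'r poly \<Rightarrow> nat list \<Rightarrow> 'r"
  where "beta F P [] = poly P y * F []"
  | "beta F P (j # t) = ins F (P * xpow j) t
      - (\<Sum>l<n. coeff (rem P) l * beta (\<lambda>s. F (l # s)) (xpow j) t)"

lemma beta_add: "beta F (P + Q) t = beta F P t + beta F Q t"
  by (cases t) (auto simp: distrib_right ins_add rem_add sum.distrib)

lemma beta_smult: "beta F (smult c P) t = c * beta F P t"
  by (cases t) (auto simp: ins_smult rem_smult sum_distrib_left algebra_simps)

lemma beta_0 [simp]: "beta F 0 t = 0"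
  using beta_smult[of F 0 0 t] by simp

lemma beta_sum: "beta F (sum G A) t = (\<Sum>a\<in>A. beta F (G a) t)"
  by (induction A rule: infinite_finite_induct) (auto simp: beta_add)

lemma beta_rem: "beta F (rem P) t = beta F P t"
proof (cases t)
  case (Cons j s)
  have "rem (rem P) = rem P" by (intro rem_low rem_high)
  moreover have "ins F (rem P * xpow j) s = ins F (P * xpow j) s"
    by (metis ins_rem mult.commute)
  ultimately show ?thesis using Cons by simp
qed simp

lemma beta_expand: "beta F P t = (\<Sum>l<n. coeff (rem P) l * beta F (xpow l) t)"
proof -
  have "beta F P t = beta F (\<Sum>l<n. smult (coeff (rem P) l) (xpow l)) t"
    by (metis beta_rem rem_expand)
  then show ?thesis by (simp only: beta_sum beta_smult)
qed

lemma beta_add_fun: "beta (\<lambda>t. F t + G t) P t = beta F P t + beta G P t"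
proof (induction t arbitrary: F G P)
  case (Cons j t)
  show ?case
    using Cons[of "\<lambda>s. F (_ # s)" "\<lambda>s. G (_ # s)"]
    by (simp add: ins_def sum.distrib algebra_simps)
qed (simp add: algebra_simps)

lemma beta_scale_fun: "beta (\<lambda>t. c * F t) P t = c * beta F P t"
proof (induction t arbitrary: F P)
  case (Cons j t)
  show ?case
    using Cons[of "\<lambda>s. F (_ # s)"]
    by (simp add: ins_def sum_distrib_left algebra_simps)
qed (simp add: algebra_simps)

lemma beta_zero_fun [simp]: "beta (\<lambda>t. 0) P t = 0"
  using beta_scale_fun[of 0 "\<lambda>t. 0" P t] by simp

lemma beta_sum_fun: "beta (\<lambda>t. \<Sum>a\<in>A. G a t) P t = (\<Sum>a\<in>A. beta (G a) P t)"
  by (induction A rule: infinite_finite_induct) (auto simp: beta_add_fun)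

lemma beta_minus_fun: "beta (\<lambda>t. - F t) P t = - beta F P t"
  using beta_scale_fun[of "-1" F P t] by simp

lemma beta_diff_fun: "beta (\<lambda>t. F t - G t) P t = beta F P t - beta G P t"
  using beta_add_fun[of F "\<lambda>t. - G t" P t] by (simp add: beta_minus_fun)

lemma beta_ins: "beta (ins F P) Q t = (\<Sum>l<n. coeff (rem P) l * beta (\<lambda>s. F (l # s)) Q t)"
  unfolding ins_def[abs_def] by (simp add: beta_sum_fun beta_scale_fun)

lemma beta_Cons: "beta F P (j # t) = ins F (P * xpow j) t - beta (ins F P) (xpow j) t"
  by (simp add: beta_ins)

lemma beta_xpow_Cons:
  "i < n \<Longrightarrow> beta F (xpow i) (j # t) = ins F (xpow (i + j)) t - beta (\<lambda>s. F (i # s)) (xpow j) t"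
  by (subst beta_Cons) (simp add: mult_monom)

declare beta.simps(2) [simp del]

lemma ins_beta: "ins (beta F P) Q t = ins F (P * Q) t - beta (ins F P) Q t"
proof -
  have "ins (beta F P) Q t
      = (\<Sum>l<n. coeff (rem Q) l * (ins F (P * xpow l) t - beta (ins F P) (xpow l) t))"
    by (simp add: ins_def[of "beta F P"] beta_Cons)
  also have "\<dots> = ins F (Q * P) t - beta (ins F P) Q t"
    by (subst ins_expand, subst (2) beta_expand)
      (simp add: right_diff_distrib sum_subtractf mult.commute)
  finally show ?thesis by (simp add: mult.commute)
qed

text \<open>
  The polynomials act on the cochains through \<open>beta\<close>. That the coboundary squares to zero is a
  consequence.
\<close>

lemma beta_beta: "beta (beta F P) Q t = beta F (P * Q) t"
proof (induction t arbitrary: F P Q)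
  case (Cons j t)
  have "beta (ins (beta F P) Q) (xpow j) t
      = beta (ins F (P * Q)) (xpow j) t - beta (ins F P) (Q * xpow j) t"
    using Cons[of "ins F P" Q "xpow j"] by (simp add: ins_beta[abs_def] beta_diff_fun)
  then show ?case
    by (simp add: beta_Cons ins_beta mult.assoc)
qed simp

text \<open>
  The Hochschild coboundary. In degree zero it vanishes, since \<open>X\<close> acts on \<open>R\<close> as \<open>y\<close> from both
  sides.
\<close>

fun cob :: "(nat list \<Rightarrow> 'r) \<Rightarrow> nat list \<Rightarrow> 'r"
  where "cob F [] = 0"
  | "cob F (i # t) = y ^ i * F t - beta F (xpow i) t"

lemma ins_cob: "ins (cob F) P t = poly P y * F t - beta F P t"
proof -
  have "poly P y = poly (rem P) y" by simp
  also have "\<dots> = (\<Sum>l<n. coeff (rem P) l * y ^ l)"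
    by (subst rem_expand) (simp add: poly_sum poly_monom)
  finally show ?thesis
    by (subst beta_expand)
      (simp add: ins_def sum_subtractf sum_distrib_right right_diff_distrib mult.assoc)
qed

lemma beta_cob: "beta (cob F) P t = poly P y * cob F t"
proof (cases t)
  case (Cons j s)
  have "beta (ins (cob F) P) (xpow j) s = poly P y * beta F (xpow j) s - beta F (P * xpow j) s"
    by (simp add: ins_cob[abs_def] beta_diff_fun beta_scale_fun beta_beta)
  then show ?thesis
    using Cons by (simp add: beta_Cons ins_cob poly_monom algebra_simps)
qed simp

lemma cob_cob: "cob (cob F) t = 0"
  by (cases t) (simp_all add: beta_cob poly_monom)

definition idx :: "nat list set"
  where "idx = lists {..<n}"

lemma idx_simps [simp]: "[] \<in> idx" "i # t \<in> idx \<longleftrightarrow> i < n \<and> t \<in> idx"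
  by (auto simp: idx_def)

lemma ins_cong:
  assumes "\<And>l. l < n \<Longrightarrow> F (l # t) = G (l # t)"
  shows "ins F P t = ins G P t"
  using assms by (simp add: ins_def)

lemma beta_cong:
  assumes "\<And>s. s \<in> idx \<Longrightarrow> length s = length t \<Longrightarrow> F s = G s" "t \<in> idx"
  shows "beta F P t = beta G P t"
  using assms
proof (induction t arbitrary: F G P)
  case (Cons j t)
  have "beta (ins F P) (xpow j) t = beta (ins G P) (xpow j) t"
    using Cons.prems by (intro Cons.IH) (auto intro: ins_cong)
  moreover have "ins F (P * xpow j) t = ins G (P * xpow j) t"
    using Cons.prems by (intro ins_cong) auto
  ultimately show ?case by (simp add: beta_Cons)
qed simp

definition normalized :: "(nat list \<Rightarrow> 'r) \<Rightarrow> bool"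
  where "normalized F \<longleftrightarrow> (\<forall>t\<in>idx. 0 \<in> set t \<longrightarrow> F t = 0)"

lemma normalizedD: "normalized F \<Longrightarrow> t \<in> idx \<Longrightarrow> 0 \<in> set t \<Longrightarrow> F t = 0"
  by (simp add: normalized_def)

lemma normalized_Cons: "normalized F \<Longrightarrow> i < n \<Longrightarrow> normalized (\<lambda>s. F (i # s))"
  by (simp add: normalized_def)

lemma normalized_ins: "normalized F \<Longrightarrow> normalized (ins F P)"
  by (simp add: normalized_def ins_def)

lemma ins_const: "normalized F \<Longrightarrow> t \<in> idx \<Longrightarrow> ins F [:c:] t = 0"
proof -
  assume "normalized F" "t \<in> idx"
  then have "F (0 # t) = 0" using n_ge_2 by (intro normalizedD) auto
  moreover have "[:c:] = smult c 1" by simp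
  ultimately show ?thesis by (simp only: ins_smult) simp
qed

lemma beta_one:
  assumes "normalized F" "t \<in> idx"
  shows "beta F 1 t = F t"
proof (cases t)
  case (Cons j s)
  have "beta (\<lambda>s. F (0 # s)) (xpow j) s = beta (\<lambda>s. 0) (xpow j) s"
    using assms Cons n_ge_2 by (intro beta_cong) (auto intro: normalizedD)
  then show ?thesis
    using assms Cons n_ge_2 by (simp add: beta_Cons)
qed simp

text \<open>
  When one of the arguments is \<open>1\<close>, the two faces that multiply it with its neighbours cancel.
\<close>

lemma beta_degenerate:
  assumes "normalized F" "t \<in> idx" "0 \<in> set t"
  shows "beta F P t = 0"
  using assms
proof (induction t arbitrary: F P)
  case (Cons j t)
  show ?case
  proof (cases "j = 0")
    case True
    have "ins F P t = beta (ins F P) 1 t"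
      using Cons.prems by (simp add: beta_one normalized_ins)
    then show ?thesis
      using True by (simp add: beta_Cons)
  next
    case False
    have "ins F (P * xpow j) t = 0"
      unfolding ins_def
      by (intro sum.neutral ballI) (use Cons.prems False in \<open>auto simp: normalizedD\<close>)
    then show ?thesis
      using Cons.prems False Cons.IH[OF normalized_ins] by (simp add: beta_Cons)
  qed
qed simp

lemma normalized_cob:
  assumes "normalized F"
  shows "normalized (cob F)"
  unfolding normalized_def
proof (intro ballI impI)
  fix t assume "t \<in> idx" "0 \<in> set t"
  with assms show "cob F t = 0"
    by (cases t) (auto simp: beta_degenerate normalizedD beta_one)
qed

text \<open>
  The difference quotient \<open>(P - P(y)) / (X - y)\<close>.
\<close>

definition sd :: "'r poly \<Rightarrow> 'r poly"
  where "sd P = synthetic_div P y"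

lemma sd: "P = [:- y, 1:] * sd P + [:poly P y:]"
  unfolding sd_def by (rule synthetic_div_correct'[symmetric])

lemma sd_eqI:
  assumes "P = [:- y, 1:] * Q + [:c:]"
  shows "sd P = Q"
proof -
  have "P + smult y Q = pCons c Q" using assms by simp
  from synthetic_div_unique[OF this] show ?thesis by (simp add: sd_def)
qed

lemma sd_mult: "sd (P * Q) = P * sd Q + smult (poly Q y) (sd P)"
proof (rule sd_eqI)
  have "P * Q = P * ([:- y, 1:] * sd Q) + [:poly Q y:] * P"
    by (subst sd[of Q]) (simp only: algebra_simps)
  also have "[:poly Q y:] * P = [:poly Q y:] * ([:- y, 1:] * sd P) + [:poly Q y:] * [:poly P y:]"
    by (subst sd[of P]) (simp only: algebra_simps)
  finally have "P * Q = P * ([:- y, 1:] * sd Q)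
      + ([:poly Q y:] * ([:- y, 1:] * sd P) + [:poly Q y:] * [:poly P y:])" .
  also have "\<dots> = [:- y, 1:] * (P * sd Q + [:poly Q y:] * sd P) + [:poly Q y:] * [:poly P y:]"
    by (simp only: algebra_simps)
  finally show "P * Q = [:- y, 1:] * (P * sd Q + smult (poly Q y) (sd P)) + [:poly Q y * poly P y:]"
    by simp
qed

lemma sd_add: "sd (P + Q) = sd P + sd Q"
proof (rule sd_eqI)
  have "P + Q = ([:- y, 1:] * sd P + [:poly P y:]) + ([:- y, 1:] * sd Q + [:poly Q y:])"
    using sd[of P] sd[of Q] by simp
  then show "P + Q = [:- y, 1:] * (sd P + sd Q) + [:poly P y + poly Q y:]"
    by (simp add: algebra_simps)
qed

lemma sd_const [simp]: "sd [:c:] = 0"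
  by (rule sd_eqI) simp

lemma sd_0 [simp]: "sd 0 = 0"
  using sd_const[of 0] by simp

lemma sd_smult: "sd (smult c P) = smult c (sd P)"
  using sd_mult[of "[:c:]" P] by simp

lemma sd_sum: "sd (sum G A) = (\<Sum>a\<in>A. sd (G a))"
  by (induction A rule: infinite_finite_induct) (auto simp: sd_add)

text \<open>
  The derivative of \<open>P\<close> at \<open>y\<close>. As a value of the difference quotient it inherits the product rule in the form
  in which the comparison of complexes needs it.
\<close>

definition deriv :: "'r poly \<Rightarrow> 'r"
  where "deriv P = poly (sd P) y"

lemma deriv_add: "deriv (P + Q) = deriv P + deriv Q"
  and deriv_smult: "deriv (smult c P) = c * deriv P"
  and deriv_mult: "deriv (P * Q) = poly P y * deriv Q + poly Q y * deriv P"
  by (simp_all add: deriv_def sd_add sd_smult sd_mult)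

lemma deriv_sum: "deriv (sum G A) = (\<Sum>a\<in>A. deriv (G a))"
  by (simp add: deriv_def sd_sum poly_sum)

lemma sd_1 [simp]: "sd 1 = 0"
  using sd_const[of 1] by (simp only: one_pCons)

lemma deriv_1 [simp]: "deriv 1 = 0"
  by (simp add: deriv_def)

lemma sd_X: "sd (xpow 1) = 1"
  by (rule sd_eqI) (simp add: monom_altdef)

lemma deriv_xpow: "deriv (xpow i) = of_nat i * y ^ (i - 1)"
proof (induction i)
  case 0
  then show ?case by simp
next
  case (Suc i)
  have "deriv (xpow (Suc i)) = deriv (xpow 1 * xpow i)" by (simp add: mult_monom)
  also have "\<dots> = y * deriv (xpow i) + y ^ i"
    unfolding deriv_mult by (simp add: deriv_def[of "xpow (Suc 0)"] sd_X[simplified] poly_monom)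
  also have "\<dots> = of_nat (Suc i) * y ^ i"
    unfolding Suc by (cases i) (simp_all add: algebra_simps)
  finally show ?case by simp
qed

definition cofactor :: "'r poly"
  where "cofactor = sd f"

lemma cofactor: "[:- y, 1:] * cofactor = f"
  using sd[of f] by (simp add: cofactor_def root)

lemma cofactor_root: "poly cofactor y = deriv f"
  by (simp add: cofactor_def deriv_def)

text \<open>
  In \<open>S\<close> the product of the cofactor with \<open>X - y\<close> is zero, so that a polynomial multiplies the cofactor by
  its value at \<open>y\<close>.
\<close>

lemma ins_mult_cofactor: "ins F (P * cofactor) t = poly P y * ins F cofactor t"
proof -
  have "P * cofactor = ([:- y, 1:] * sd P + [:poly P y:]) * cofactor"
    using sd[of P] by simp
  also have "\<dots> = smult (poly P y) cofactor + sd P * ([:- y, 1:] * cofactor)"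
    by (simp add: algebra_simps)
  also have "\<dots> = smult (poly P y) cofactor + sd P * f"
    by (simp only: cofactor)
  finally show ?thesis by (simp only: ins_add_mult_f ins_smult)
qed

section \<open>Comparison with the two-periodic complex\<close>

definition stepel :: "nat \<Rightarrow> 'r poly"
  where "stepel r = (if even r then xpow 1 else cofactor)"

text \<open>
  The differential from degree \<open>r\<close> to degree \<open>r - 1\<close> in the periodic resolution of \<open>R\<close> over \<open>S\<close>.
\<close>

definition diffel :: "nat \<Rightarrow> 'r poly"
  where "diffel r = (if odd r then [:- y, 1:] else cofactor)"

text \<open>
  The value of \<open>F\<close> at the tuple of length \<open>r\<close> whose entries are alternately \<open>X\<close> and the cofactor, the last
  one being \<open>X\<close>. This tuple is the image in the bar resolution of a generator of the periodic
  resolution. One would expect \<open>X - y\<close> in place of \<open>X\<close>, but normalized cochains do not see the difference.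
\<close>

primrec W :: "nat \<Rightarrow> (nat list \<Rightarrow> 'r) \<Rightarrow> 'r"
  where "W 0 F = F []"
  | "W (Suc r) F = W r (ins F (stepel r))"

lemma ins_add_fun: "ins (\<lambda>t. F t + G t) P t = ins F P t + ins G P t"
  by (simp add: ins_def sum.distrib algebra_simps)

lemma ins_scale_fun: "ins (\<lambda>t. c * F t) P t = c * ins F P t"
  by (simp add: ins_def sum_distrib_left algebra_simps)

lemma W_add: "W r (\<lambda>t. F t + G t) = W r F + W r G"
  by (induction r arbitrary: F G) (simp_all add: ins_add_fun[abs_def])

lemma W_scale: "W r (\<lambda>t. c * F t) = c * W r F"
  by (induction r arbitrary: F) (simp_all add: ins_scale_fun[abs_def])

lemma W_zero [simp]: "W r (\<lambda>t. 0) = 0"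
  using W_scale[of r 0 "\<lambda>t. 0"] by simp

lemma W_diff: "W r (\<lambda>t. F t - G t) = W r F - W r G"
  using W_add[of r F "\<lambda>t. - 1 * G t"] by (simp only: W_scale) simp

lemma W_sum: "W r (\<lambda>t. \<Sum>a\<in>A. c a * G a t) = (\<Sum>a\<in>A. c a * W r (G a))"
  by (induction A rule: infinite_finite_induct) (simp_all add: W_add W_scale)

lemma W_cong:
  assumes "\<And>s. s \<in> idx \<Longrightarrow> length s = r \<Longrightarrow> F s = G s"
  shows "W r F = W r G"
  using assms
proof (induction r arbitrary: F G)
  case (Suc r)
  show ?case
    using Suc.prems by (auto intro!: Suc.IH ins_cong)
qed simp

lemma ins_step_diff:
  "ins F (stepel (Suc r) * diffel (Suc r)) t = (if even r then 0 else y * ins F (stepel r) t)"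
proof (cases "even r")
  case True
  have "ins F (cofactor * [:- y, 1:]) t = ins F (0 + 1 * f) t"
    using cofactor by (simp add: mult.commute)
  then show ?thesis
    using True by (simp only: ins_add_mult_f) (simp add: stepel_def diffel_def)
next
  case False
  then show ?thesis
    by (simp add: stepel_def diffel_def ins_mult_cofactor poly_monom)
qed

text \<open>
  Neighbours in the tuple of \<open>W\<close> have the product \<open>y\<close> times the cofactor in \<open>S\<close>. Hence the
  faces behind the first one cancel, except for a multiple of \<open>y\<close> that may remain and turns the factor \<open>X\<close>
  of the first one into \<open>X - y\<close>.
\<close>

lemma W_beta: "W (Suc r) (beta F P) = W r (ins F (P * diffel (Suc r)))"
proof (induction r arbitrary: F P)
  case 0
  have "ins F (P * [:- y, 1:]) [] = ins F (P * xpow 1 - smult y P) []"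
    by (simp add: monom_altdef)
  then show ?case
    by (simp add: stepel_def diffel_def ins_beta ins_diff ins_smult poly_monom)
next
  case (Suc r)
  have "W (Suc (Suc r)) (beta F P)
      = W (Suc r) (ins F (P * stepel (Suc r))) - W (Suc r) (beta (ins F P) (stepel (Suc r)))"
    by (simp only: W.simps(2)[of "Suc r"] ins_beta[abs_def] W_diff)
  also have "W (Suc r) (beta (ins F P) (stepel (Suc r)))
      = W r (ins (ins F P) (stepel (Suc r) * diffel (Suc r)))"
    by (rule Suc.IH)
  also have "\<dots> = (if even r then 0 else y * W (Suc r) (ins F P))"
    by (simp add: ins_step_diff[abs_def] W_scale)
  also have "W (Suc r) (ins F (P * stepel (Suc r))) - \<dots> = W (Suc r) (ins F (P * diffel (Suc (Suc r))))"
  proof (cases "even r")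
    case False
    have "W (Suc r) (ins F (P * xpow 1)) - y * W (Suc r) (ins F P)
        = W (Suc r) (\<lambda>t. ins F (P * xpow 1) t - y * ins F P t)"
      by (simp only: W_diff W_scale)
    also have "\<dots> = W (Suc r) (ins F (P * [:- y, 1:]))"
      by (simp add: ins_diff[symmetric] ins_smult[symmetric] monom_altdef)
    finally show ?thesis using False by (simp add: stepel_def diffel_def)
  qed (simp add: stepel_def diffel_def)
  finally show ?case .
qed

text \<open>
  The coboundary becomes multiplication by the value at \<open>y\<close> of \<open>X - y\<close> or of the cofactor, in turn.
\<close>

lemma W_cob: "W (Suc r) (cob F) = (if even r then 0 else deriv f * W r F)"
proof -
  have eq: "W (Suc r) (cob F) = poly (stepel r) y * W r F - W r (beta F (stepel r))"
    by (simp add: ins_cob[abs_def] W_diff W_scale)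
  show ?thesis
  proof (cases r)
    case 0
    then show ?thesis using eq by (simp add: stepel_def poly_monom)
  next
    case (Suc s)
    have "W r (beta F (stepel r)) = (if even s then 0 else y * W r F)"
      unfolding Suc W_beta by (simp add: ins_step_diff[abs_def] W_scale)
    then show ?thesis
      using eq Suc by (auto simp: stepel_def poly_monom cofactor_root)
  qed
qed

text \<open>
  In degree two the quotients of \<open>X\<^sup>i\<^sup>+\<^sup>j\<close> by \<open>f\<close> are the cocycle that describes \<open>R[X]/(f\<^sup>2)\<close> as an extension
  of \<open>S\<close>; in even degrees the cochain is a power of it with respect to the cup product.
\<close>

fun psi_even :: "nat list \<Rightarrow> 'r"
  where "psi_even [] = 1"
  | "psi_even [i] = 0"
  | "psi_even (i # j # t) = poly (quo (xpow (i + j))) y * psi_even t"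

text \<open>
  In odd degrees the first argument is differentiated. The result is the comparison in the direction opposite
  to \<open>W\<close>.
\<close>

definition psi :: "nat list \<Rightarrow> 'r"
  where "psi t = (if even (length t) then psi_even t
    else deriv (xpow (hd t)) * psi_even (tl t))"

lemma quo_mult: "quo (P * Q) = P * quo Q + quo (P * rem Q)"
proof (rule quo_rem_eqI(1))
  have "P * Q = P * (quo Q * f + rem Q)" using quo_rem[of Q] by simp
  also have "\<dots> = P * quo Q * f + P * rem Q" by (simp add: algebra_simps)
  also have "\<dots> = P * quo Q * f + (quo (P * rem Q) * f + rem (P * rem Q))"
    using quo_rem[of "P * rem Q"] by simp
  finally show "P * Q = (P * quo Q + quo (P * rem Q)) * f + rem (P * rem Q)"
    by (simp add: algebra_simps)
qed (rule rem_high)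

lemma quo_sum: "quo (sum G A) = (\<Sum>a\<in>A. quo (G a))"
  by (induction A rule: infinite_finite_induct) (auto simp: quo_add)

lemma quo_rem_mult: "quo (rem P * Q) = (\<Sum>l<n. smult (coeff (rem P) l) (quo (xpow l * Q)))"
  by (subst rem_expand) (simp add: sum_distrib_right quo_sum quo_smult)

lemma ins_psi_even:
  "ins psi_even P (j # t) = poly (quo (rem P * xpow j)) y * psi_even t"
  by (simp add: ins_def quo_rem_mult poly_sum sum_distrib_right mult_monom mult.assoc)

lemma ins_ins_psi_even:
  "ins (ins psi_even P) Q t = poly (quo (rem P * rem Q)) y * psi_even t"
proof -
  have "quo (rem P * rem Q) = (\<Sum>l<n. smult (coeff (rem Q) l) (quo (rem P * xpow l)))"
    using quo_rem_mult[of Q "rem P"] by (simp add: mult.commute)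
  then show ?thesis
    by (simp add: ins_def[of "ins psi_even P"] ins_psi_even poly_sum sum_distrib_right mult.assoc)
qed

text \<open>
  The induction removes two arguments at a time. What makes it work is the associative law in \<open>R[X]\<close>, read
  off on the quotients by \<open>f\<close> by means of \<open>quo_mult\<close>.
\<close>

lemma beta_psi_even:
  "even (length t) \<Longrightarrow> t \<in> idx \<Longrightarrow> beta psi_even P t = poly P y * psi_even t"
proof (induction t arbitrary: P rule: psi_even.induct)
  case (3 i j t)
  let ?q = "\<lambda>P Q. poly (quo (P * Q)) y"
  have i: "i < n" and j: "j < n" and t: "t \<in> idx" using 3 by auto
  have "beta (ins (ins psi_even P) (xpow i)) (xpow j) t = ?q (rem P) (xpow i) * (y ^ j * psi_even t)"
    using 3 i by (simp add: ins_ins_psi_even[abs_def] beta_scale_fun poly_monom)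
  then have 1: "beta psi_even P (i # j # t) =
      (?q (rem (P * xpow i)) (xpow j) - ?q (rem P) (rem (xpow (i + j))) + ?q (rem P) (xpow i) * y ^ j)
        * psi_even t"
    by (simp add: beta_Cons ins_psi_even ins_ins_psi_even mult_monom algebra_simps)
  have "rem (rem P * xpow i) = rem (P * xpow i)"
    using rem_mult_rem[of "xpow i" P] by (simp add: mult.commute)
  then have "quo (xpow j * (rem P * xpow i)) = xpow j * quo (rem P * xpow i) + quo (rem (P * xpow i) * xpow j)"
    using quo_mult[of "xpow j" "rem P * xpow i"] by (simp add: mult.commute)
  moreover have "quo (rem P * xpow (i + j)) = rem P * quo (xpow (i + j)) + quo (rem P * rem (xpow (i + j)))"
    by (rule quo_mult)
  moreover have "xpow j * (rem P * xpow i) = rem P * (xpow i * xpow j)"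
    by (simp only: mult.assoc mult.commute mult.left_commute)
  then have "xpow j * (rem P * xpow i) = rem P * xpow (i + j)"
    by (simp add: mult_monom)
  ultimately have "rem P * quo (xpow (i + j)) + quo (rem P * rem (xpow (i + j)))
      = xpow j * quo (rem P * xpow i) + quo (rem (P * xpow i) * xpow j)"
    by simp
  then have "poly (rem P * quo (xpow (i + j)) + quo (rem P * rem (xpow (i + j)))) y
      = poly (xpow j * quo (rem P * xpow i) + quo (rem (P * xpow i) * xpow j)) y"
    by simp
  then have "?q (rem (P * xpow i)) (xpow j) - ?q (rem P) (rem (xpow (i + j))) + ?q (rem P) (xpow i) * y ^ j
      = poly P y * poly (quo (xpow (i + j))) y"
    by (simp add: poly_monom algebra_simps)
  with 1 show ?case by (simp add: mult.assoc)
qed auto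

lemma cob_psi_odd_degree:
  assumes "odd (length t)" "t \<in> idx"
  shows "cob psi t = 0"
proof -
  obtain i s where t: "t = i # s" using assms by (cases t) auto
  have "beta psi (xpow i) s = beta psi_even (xpow i) s"
    using assms t by (intro beta_cong) (auto simp: psi_def)
  also have "\<dots> = y ^ i * psi_even s"
    using assms t by (simp add: beta_psi_even poly_monom)
  finally show ?thesis using assms t by (simp add: psi_def)
qed

text \<open>
  The product rule accounts for three of the faces, except that the product \<open>X\<^sup>i\<^sup>+\<^sup>j\<close> is reduced modulo \<open>f\<close>
  before it is differentiated. This costs the quotient of \<open>X\<^sup>i\<^sup>+\<^sup>j\<close> times the derivative of \<open>f\<close>.
\<close>

lemma cob_psi_even_degree:
  assumes "even (length t)" "t \<noteq> []" "t \<in> idx"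
  shows "cob psi t = deriv f * psi t"
proof -
  obtain i j s where t: "t = i # j # s"
    using assms by (cases t rule: psi_even.cases) auto
  have ij: "i < n" "j < n" and s: "s \<in> idx" and even_s: "even (length s)" using assms t by auto
  have psi_Cons: "psi (l # u) = deriv (xpow l) * psi_even u" if "even (length u)" for l u
    using that by (simp add: psi_def)
  have "deriv (rem (xpow (i + j))) = (\<Sum>l<n. coeff (rem (xpow (i + j))) l * deriv (xpow l))"
    by (subst rem_expand) (simp add: deriv_sum deriv_smult)
  then have ins: "ins psi (xpow (i + j)) s = deriv (rem (xpow (i + j))) * psi_even s"
    using even_s by (simp add: ins_def psi_Cons sum_distrib_right mult.assoc)
  have "beta (\<lambda>u. psi (i # u)) (xpow j) s = beta (\<lambda>u. deriv (xpow i) * psi_even u) (xpow j) s"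
    using s even_s by (intro beta_cong) (auto simp: psi_Cons)
  also have "\<dots> = deriv (xpow i) * (y ^ j * psi_even s)"
    using s even_s by (simp add: beta_scale_fun beta_psi_even poly_monom)
  finally have "cob psi t = (y ^ i * deriv (xpow j) + deriv (xpow i) * y ^ j - deriv (rem (xpow (i + j)))) * psi_even s"
    using ij even_s ins by (simp add: t beta_xpow_Cons psi_Cons algebra_simps)
  also have "y ^ i * deriv (xpow j) + deriv (xpow i) * y ^ j = deriv (xpow (i + j))"
    using deriv_mult[of "xpow i" "xpow j"] by (simp add: mult_monom poly_monom algebra_simps)
  also have "deriv (xpow (i + j)) = deriv (quo (xpow (i + j)) * f + rem (xpow (i + j)))"
    using quo_rem[of "xpow (i + j)"] by simp
  also have "\<dots> - deriv (rem (xpow (i + j))) = poly (quo (xpow (i + j))) y * deriv f"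
    by (simp add: deriv_add deriv_mult root)
  finally show ?thesis
    using even_s by (simp add: psi_def[of "i # j # s"] t mult.commute mult.left_commute)
qed

lemma normalized_psi: "normalized psi"
proof -
  have even: "psi_even t = 0" if "t \<in> idx" "even (length t)" "0 \<in> set t" for t
    using that by (induction t rule: psi_even.induct) auto
  show ?thesis
    unfolding normalized_def
  proof (intro ballI impI)
    fix t assume t: "t \<in> idx" "0 \<in> set t"
    show "psi t = 0"
    proof (cases "even (length t)")
      case False
      with t show ?thesis by (cases t) (auto simp: psi_def even)
    qed (use t even in \<open>simp add: psi_def\<close>)
  qed
qed

lemma coeff_cofactor_high: "i \<ge> n \<Longrightarrow> coeff cofactor i = 0"
  using n_ge_2 by (intro coeff_eq_0) (simp add: cofactor_def sd_def degree_synthetic_div degree_f)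

lemma quo_cofactor: "quo (rem cofactor * xpow 1) = 1"
proof -
  have rem: "rem cofactor = cofactor" by (rule rem_low) (rule coeff_cofactor_high)
  have "cofactor * xpow 1 = 1 * f + smult y cofactor"
    using cofactor[symmetric] by (simp add: monom_altdef algebra_simps)
  from quo_rem_eqI(1)[OF this] show ?thesis
    by (simp add: rem coeff_cofactor_high)
qed

text \<open>
  The quotient of the cofactor times \<open>X\<close> by \<open>f\<close> is \<open>1\<close>, and the derivative of \<open>X\<close> is \<open>1\<close> as well.
\<close>

lemma W_psi: "W r psi = 1"
proof -
  have even: "W (2 * m) psi_even = 1" for m
  proof (induction m)
    case (Suc m)
    have "ins (ins psi_even cofactor) (xpow 1) = psi_even"
      using n_ge_2 quo_cofactor by (intro ext) (simp add: ins_psi_even)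
    then show ?case
      using Suc by (simp add: stepel_def)
  qed simp
  show ?thesis
  proof (cases "even r")
    case True
    then obtain m where r: "r = 2 * m" by blast
    have "W r psi = W r psi_even" by (rule W_cong) (simp add: psi_def r)
    then show ?thesis using even r by simp
  next
    case False
    then obtain m where r: "r = Suc (2 * m)" by (metis oddE Suc_eq_plus1)
    have "W r psi = W (2 * m) psi_even"
      unfolding r W.simps(2)
      by (rule W_cong) (use n_ge_2 in \<open>simp add: stepel_def psi_def deriv_xpow\<close>)
    then show ?thesis using even by simp
  qed
qed

text \<open>
  The homotopy. Its value at a tuple of exponents is a sum over the positions after which an even number
  of exponents is left: the exponents after the position go into \<open>psi_even\<close>, those before it stay, and the power
  at the position is replaced by its difference quotient, followed by the tuple of \<open>W\<close>.
\<close>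

fun hmt :: "(nat list \<Rightarrow> 'r) \<Rightarrow> nat list \<Rightarrow> 'r"
  where "hmt F [] = 0"
  | "hmt F (i # t) = - hmt (\<lambda>s. F (i # s)) t
      - (if even (length t) then psi_even t * W (Suc (length t)) (ins F (sd (xpow i))) else 0)"

lemma hmt_add: "hmt (\<lambda>t. F t + G t) t = hmt F t + hmt G t"
proof (induction t arbitrary: F G)
  case (Cons i t)
  show ?case
    using Cons[of "\<lambda>s. F (i # s)" "\<lambda>s. G (i # s)"]
    by (simp add: ins_add_fun[abs_def] W_add algebra_simps del: W.simps)
qed simp

lemma hmt_scale: "hmt (\<lambda>t. c * F t) t = c * hmt F t"
proof (induction t arbitrary: F)
  case (Cons i t)
  show ?case
    using Cons[of "\<lambda>s. F (i # s)"]
    by (simp add: ins_scale_fun[abs_def] W_scale algebra_simps del: W.simps)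
qed simp

lemma hmt_diff: "hmt (\<lambda>t. F t - G t) t = hmt F t - hmt G t"
  using hmt_add[of F "\<lambda>t. - 1 * G t"] by (simp only: hmt_scale) simp

lemma hmt_zero [simp]: "hmt (\<lambda>t. 0) t = 0"
  using hmt_scale[of 0 "\<lambda>t. 0"] by simp

lemma hmt_sum: "hmt (\<lambda>t. \<Sum>a\<in>A. G a t) t = (\<Sum>a\<in>A. hmt (G a) t)"
  by (induction A rule: infinite_finite_induct) (auto simp: hmt_add)

lemma hmt_ins: "hmt (ins F P) t = (\<Sum>l<n. coeff (rem P) l * hmt (\<lambda>s. F (l # s)) t)"
  unfolding ins_def[abs_def] by (simp add: hmt_sum hmt_scale)

lemma hmt_cong:
  assumes "\<And>s. s \<in> idx \<Longrightarrow> length s = Suc (length t) \<Longrightarrow> F s = G s" "t \<in> idx"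
  shows "hmt F t = hmt G t"
  using assms
proof (induction t arbitrary: F G)
  case (Cons i t)
  have "hmt (\<lambda>s. F (i # s)) t = hmt (\<lambda>s. G (i # s)) t"
    using Cons.prems by (intro Cons.IH) auto
  moreover have "W (Suc (length t)) (ins F P) = W (Suc (length t)) (ins G P)" for P
    using Cons.prems by (intro W_cong ins_cong) auto
  ultimately show ?case by (simp del: W.simps)
qed simp

lemma normalized_hmt:
  assumes "normalized F"
  shows "normalized (hmt F)"
proof -
  have "hmt F t = 0" if "normalized F" "t \<in> idx" "0 \<in> set t" for F t
    using that
  proof (induction t arbitrary: F)
    case (Cons i t)
    have "hmt (\<lambda>s. F (i # s)) t = 0"
    proof (cases "i = 0")
      case True
      have "hmt (\<lambda>s. F (0 # s)) t = hmt (\<lambda>s. 0) t"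
        using Cons.prems n_ge_2 by (intro hmt_cong) (auto intro: normalizedD)
      then show ?thesis using True by simp
    qed (use Cons normalized_Cons in auto)
    moreover have "psi_even t = 0" if "even (length t)" "0 \<in> set t"
      using normalizedD[OF normalized_psi, of t] that Cons.prems by (simp add: psi_def)
    moreover have "W (Suc (length t)) (ins F 0) = 0"
      by (simp add: ins_def[abs_def])
    ultimately show ?case
      using Cons.prems by (auto simp del: W.simps)
  qed simp
  then show ?thesis using assms by (simp add: normalized_def)
qed

text \<open>
  By the definition of the difference quotient the two arguments differ by a constant.
\<close>

lemma W_ins_X_minus_y:
  assumes "normalized F"
  shows "W r (ins F (sd P * [:- y, 1:])) = W r (ins F P)"
proof (rule W_cong)
  fix t assume t: "t \<in> idx"
  have "ins F P t = ins F (sd P * [:- y, 1:] + [:poly P y:]) t"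
    using sd[of P] by (simp only: mult.commute)
  then show "ins F (sd P * [:- y, 1:]) t = ins F P t"
    by (simp only: ins_add ins_const[OF assms t]) simp
qed

lemma hmt_Cons_odd: "odd (length t) \<Longrightarrow> ins (hmt F) P t = - hmt (ins F P) t"
  by (simp add: ins_def[of "hmt F"] hmt_ins sum_negf)

lemma hmt_Cons_even:
  assumes "even (length t)"
  shows "ins (hmt F) P t
    = - hmt (ins F P) t - psi_even t * W (Suc (length t)) (ins F (sd (rem P)))"
proof -
  let ?W = "W (Suc (length t))"
  have "ins F (sd (rem P)) = (\<lambda>s. \<Sum>l<n. coeff (rem P) l * ins F (sd (xpow l)) s)"
    by (subst rem_expand) (simp add: sd_sum sd_smult ins_sum[abs_def] ins_smult)
  then have "?W (ins F (sd (rem P))) = (\<Sum>l<n. coeff (rem P) l * ?W (ins F (sd (xpow l))))"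
    by (simp only: W_sum)
  then show ?thesis
    using assms
    by (simp add: ins_def[of "hmt F"] hmt_ins sum_negf[symmetric] sum_distrib_left sum_subtractf
        algebra_simps del: W.simps)
qed

text \<open>
  The homotopy formula for the faces other than the first. Removing one exponent changes the parity of the
  length, so the two cases have to be proved together, each relying on the other for the shorter tuple.
\<close>

lemma homotopy_beta:
  assumes "t \<in> idx" "normalized F"
  shows "even (length t) \<Longrightarrow>
      hmt (beta F P) t - beta (hmt F) P t = ins F P t - psi_even t * W (length t) (ins F P)"
    and "odd (length t) \<Longrightarrow> i < n \<Longrightarrow>
      hmt (beta F (xpow i)) t - beta (hmt F) (xpow i) t = F (i # t) - psi_even (i # t) * W (Suc (length t)) F"
  using assms
proof (induction t arbitrary: F P i)
  case Nil
  {
    case 1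
    then show ?case by simp
  next
    case 2
    then show ?case by simp
  }
next
  case (Cons j t)
  {
    case 1
    then have F: "normalized F" and odd: "odd (length t)" and t: "t \<in> idx" and j: "j < n" by auto
    let ?G = "ins F P"
    have "hmt (beta F P) (j # t) = - hmt (ins F (P * xpow j)) t + hmt (beta ?G (xpow j)) t"
      using odd by (simp add: beta_Cons[abs_def] hmt_diff)
    moreover have "beta (ins (hmt F) P) (xpow j) t = beta (\<lambda>s. - hmt ?G s) (xpow j) t"
      using t odd by (intro beta_cong) (simp_all add: hmt_Cons_odd)
    then have "beta (hmt F) P (j # t) = - hmt (ins F (P * xpow j)) t + beta (hmt ?G) (xpow j) t"
      using odd by (simp add: beta_Cons hmt_Cons_odd beta_minus_fun)
    ultimately show ?case
      using Cons.IH(2)[OF odd j t normalized_ins[OF F], of P] by simp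
  next
    case 2
    then have F: "normalized F" and even: "even (length t)" and i: "i < n"
      and t: "t \<in> idx" and j: "j < n" by auto
    let ?r = "Suc (length t)" and ?Fi = "\<lambda>s. F (i # s)" and ?W = "W (Suc (length t))"
    have Fi: "normalized ?Fi" using F i by (rule normalized_Cons)
    have beta_fun: "(\<lambda>s. beta F (xpow i) (j # s)) = (\<lambda>s. ins F (xpow (i + j)) s - beta ?Fi (xpow j) s)"
      using i by (simp add: beta_xpow_Cons)
    have "?W (beta ?Fi (sd (xpow j))) = W (length t) (ins ?Fi (sd (xpow j) * [:- y, 1:]))"
      unfolding W_beta using even by (simp add: diffel_def)
    also have "\<dots> = W (length t) (ins ?Fi (xpow j))"
      by (rule W_ins_X_minus_y[OF Fi])
    finally have W1: "?W (beta ?Fi (sd (xpow j))) = W (length t) (ins ?Fi (xpow j))" .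
    have "ins (beta F (xpow i)) (sd (xpow j))
        = (\<lambda>s. ins F (xpow i * sd (xpow j)) s - beta ?Fi (sd (xpow j)) s)"
      using i by (simp add: ins_beta[abs_def])
    then have W2: "?W (ins (beta F (xpow i)) (sd (xpow j)))
        = ?W (ins F (xpow i * sd (xpow j))) - W (length t) (ins ?Fi (xpow j))"
      by (simp only: W_diff W1)
    have A: "hmt (beta F (xpow i)) (j # t) = - hmt (ins F (xpow (i + j))) t + hmt (beta ?Fi (xpow j)) t
        - psi_even t * (?W (ins F (xpow i * sd (xpow j))) - W (length t) (ins ?Fi (xpow j)))"
      unfolding hmt.simps(2) beta_fun hmt_diff W2 using even by simp
    have "beta (\<lambda>s. hmt F (i # s)) (xpow j) t
        = beta (\<lambda>s. - hmt ?Fi s - ?W (ins F (sd (xpow i))) * psi_even s) (xpow j) t"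
      using t even by (intro beta_cong) (simp_all add: mult.commute del: W.simps)
    also have "\<dots> = - beta (hmt ?Fi) (xpow j) t - ?W (ins F (sd (xpow i))) * (y ^ j * psi_even t)"
      using t even
      by (simp add: beta_diff_fun beta_minus_fun beta_scale_fun beta_psi_even poly_monom del: W.simps)
    finally have B: "beta (hmt F) (xpow i) (j # t) = - hmt (ins F (xpow (i + j))) t
        - psi_even t * ?W (ins F (sd (rem (xpow (i + j))))) + beta (hmt ?Fi) (xpow j) t
        + ?W (ins F (sd (xpow i))) * (y ^ j * psi_even t)"
      using i even by (simp add: beta_xpow_Cons hmt_Cons_even del: W.simps)
    let ?q = "quo (xpow (i + j))"
    \<comment> \<open>The difference quotient of \<open>X\<^sup>i\<^sup>+\<^sup>j\<close>, computed by the product rule and by division by \<open>f\<close>.\<close>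
    have "xpow i * sd (xpow j) + smult (y ^ j) (sd (xpow i)) = sd (xpow (i + j))"
      using sd_mult[of "xpow i" "xpow j"] by (simp add: mult_monom poly_monom)
    also have "\<dots> = sd (?q * f + rem (xpow (i + j)))"
      using quo_rem[of "xpow (i + j)"] by simp
    also have "\<dots> = ?q * cofactor + sd (rem (xpow (i + j)))"
      by (simp add: sd_add sd_mult root cofactor_def)
    finally have "ins F (xpow i * sd (xpow j) + smult (y ^ j) (sd (xpow i)))
        = ins F (?q * cofactor + sd (rem (xpow (i + j))))" by simp
    then have "(\<lambda>s. ins F (xpow i * sd (xpow j)) s + y ^ j * ins F (sd (xpow i)) s)
        = (\<lambda>s. poly ?q y * ins F cofactor s + ins F (sd (rem (xpow (i + j)))) s)"
      by (simp add: fun_eq_iff ins_add ins_smult ins_mult_cofactor)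
    then have "?W (\<lambda>s. ins F (xpow i * sd (xpow j)) s + y ^ j * ins F (sd (xpow i)) s)
        = ?W (\<lambda>s. poly ?q y * ins F cofactor s + ins F (sd (rem (xpow (i + j)))) s)"
      by (rule arg_cong)
    moreover have "W (Suc ?r) F = ?W (ins F cofactor)"
      using even by (simp add: stepel_def)
    ultimately have C: "?W (ins F (xpow i * sd (xpow j))) + y ^ j * ?W (ins F (sd (xpow i)))
        = poly ?q y * W (Suc ?r) F + ?W (ins F (sd (rem (xpow (i + j)))))"
      by (simp only: W_add W_scale)
    have D: "hmt (beta ?Fi (xpow j)) t
        = beta (hmt ?Fi) (xpow j) t + F (i # j # t) - psi_even t * W (length t) (ins ?Fi (xpow j))"
      using Cons.IH(1)[OF even t Fi, of "xpow j"] j by (simp add: algebra_simps)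
    have "hmt (beta F (xpow i)) (j # t) - beta (hmt F) (xpow i) (j # t)
        = F (i # j # t) - psi_even t * ((?W (ins F (xpow i * sd (xpow j))) + y ^ j * ?W (ins F (sd (xpow i))))
            - ?W (ins F (sd (rem (xpow (i + j))))))"
      unfolding A B D by (simp add: algebra_simps del: W.simps)
    also have "\<dots> = F (i # j # t) - psi_even (i # j # t) * W (Suc ?r) F"
      unfolding C by (simp add: algebra_simps del: W.simps)
    finally show ?case by simp
  }
qed

text \<open>
  Here the first face contributes as well; the value of the difference quotient at \<open>y\<close> is the derivative,
  which is why \<open>psi\<close> appears in place of \<open>psi_even\<close>.
\<close>

theorem homotopy:
  assumes t: "t \<in> idx" and F: "normalized F"
  shows "F t - W (length t) F * psi t = hmt (cob F) t + cob (hmt F) t"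
proof (cases t)
  case Nil
  then show ?thesis by (simp add: psi_def)
next
  case (Cons i s)
  have i: "i < n" and s: "s \<in> idx" using t Cons by auto
  have eq: "hmt (cob F) t + cob (hmt F) t = hmt (beta F (xpow i)) s - beta (hmt F) (xpow i) s
      - (if even (length s) then psi_even s * W (Suc (length s)) (ins (cob F) (sd (xpow i))) else 0)"
    using Cons by (simp add: hmt_diff hmt_scale del: W.simps)
  show ?thesis
  proof (cases "even (length s)")
    case False
    then show ?thesis
      unfolding eq homotopy_beta(2)[OF s F False i]
      using Cons by (simp add: psi_def mult.commute del: W.simps)
  next
    case True
    let ?W = "W (Suc (length s))"
    have "?W (beta F (sd (xpow i))) = W (length s) (ins F (sd (xpow i) * [:- y, 1:]))"
      unfolding W_beta using True by (simp add: diffel_def)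
    also have "\<dots> = W (length s) (ins F (xpow i))"
      by (rule W_ins_X_minus_y[OF F])
    finally have W: "?W (ins (cob F) (sd (xpow i))) = deriv (xpow i) * ?W F - W (length s) (ins F (xpow i))"
      by (simp only: ins_cob[abs_def] W_diff W_scale deriv_def)
    have psi: "psi t = deriv (xpow i) * psi_even s"
      using Cons True by (simp add: psi_def)
    have len: "length t = Suc (length s)" and F_t: "F t = ins F (xpow i) s"
      using Cons i by simp_all
    have alg: "x - w * (d * p) = x - p * v - p * (d * w - v)" for x w d p v :: 'r
      by (simp add: algebra_simps)
    show ?thesis
      unfolding eq homotopy_beta(1)[OF s F True, of "xpow i"] psi len F_t W if_P[OF True]
      by (rule alg)
  qed
qed

end

section \<open>Integer polynomials evaluated at central elements\<close>

lemma (in abelian_monoid) finsum_swap: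
  assumes "finite S" "finite T" "\<And>i j. i \<in> S \<Longrightarrow> j \<in> T \<Longrightarrow> g i j \<in> carrier G"
  shows "(\<Oplus>i\<in>S. \<Oplus>j\<in>T. g i j) = (\<Oplus>j\<in>T. \<Oplus>i\<in>S. g i j)"
  using assms(1,3)
proof (induction S rule: finite_induct)
  case (insert i S)
  then have "(\<Oplus>i\<in>insert i S. \<Oplus>j\<in>T. g i j) = (\<Oplus>j\<in>T. g i j) \<oplus> (\<Oplus>j\<in>T. \<Oplus>i\<in>S. g i j)"
    by (subst finsum_insert) (auto intro!: finsum_closed)
  also have "\<dots> = (\<Oplus>j\<in>T. g i j \<oplus> (\<Oplus>i\<in>S. g i j))"
    using insert by (intro finsum_addf[symmetric]) (auto intro!: finsum_closed)
  also have "\<dots> = (\<Oplus>j\<in>T. \<Oplus>i\<in>insert i S. g i j)"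
    using insert by (intro finsum_cong') (auto intro!: finsum_closed)
  finally show ?case .
qed (simp add: assms finsum_zero)

lemma additive_finsum:
  assumes "abelian_monoid M" "abelian_monoid N"
    and "\<And>a. a \<in> carrier M \<Longrightarrow> h a \<in> carrier N"
    and "h \<zero>\<^bsub>M\<^esub> = \<zero>\<^bsub>N\<^esub>"
    and "\<And>a b. a \<in> carrier M \<Longrightarrow> b \<in> carrier M \<Longrightarrow> h (a \<oplus>\<^bsub>M\<^esub> b) = h a \<oplus>\<^bsub>N\<^esub> h b"
    and "\<And>i. i \<in> S \<Longrightarrow> g i \<in> carrier M"
  shows "h (\<Oplus>\<^bsub>M\<^esub>i\<in>S. g i) = (\<Oplus>\<^bsub>N\<^esub>i\<in>S. h (g i))"
proof -
  interpret M: abelian_monoid M by fact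
  interpret N: abelian_monoid N by fact
  show ?thesis
    using assms(6)
  proof (induction S rule: infinite_finite_induct)
    case (insert i S)
    have "(\<Oplus>\<^bsub>M\<^esub>j\<in>S. g j) \<in> carrier M" using insert.prems by (auto intro!: M.finsum_closed)
    then show ?case
      using insert assms(3) by (simp add: Pi_iff assms(5))
  qed (simp_all add: assms(4))
qed

lemma (in abelian_group) additive_zero:
  assumes "h \<zero> \<in> carrier N" "abelian_group N" "h (\<zero> \<oplus> \<zero>) = h \<zero> \<oplus>\<^bsub>N\<^esub> h \<zero>"
  shows "h \<zero> = \<zero>\<^bsub>N\<^esub>"
proof -
  interpret N: abelian_group N by fact
  show ?thesis using assms(1,3) by (simp add: N.add.r_cancel_one')
qed

text \<open>
  Polynomials with integer coefficients in infinitely many variables, as finitely supported functions on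
  monomials.
\<close>

definition var :: "nat \<Rightarrow> nat multiset \<Rightarrow>\<^sub>0 int"
  where "var i = frag_of {#i#}"

text \<open>
  Integer polynomials can be evaluated at central elements of an arbitrary ring, since these commute
  with each other. The values are central again.
\<close>

locale central_family = ring A for A (structure) +
  fixes z :: "nat \<Rightarrow> 'a"
  assumes z_closed [simp]: "z i \<in> carrier A"
    and z_central: "a \<in> carrier A \<Longrightarrow> z i \<otimes> a = a \<otimes> z i"
begin

definition mon :: "nat multiset \<Rightarrow> 'a"
  where "mon M = foldr (\<lambda>i u. z i \<otimes> u) (sorted_list_of_multiset M) \<one>"

lemma foldr_closed [simp]: "foldr (\<lambda>i u. z i \<otimes> u) is \<one> \<in> carrier A"
  by (induction "is") simp_all

lemma mon_closed [simp]: "mon M \<in> carrier A"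
  by (simp add: mon_def)

lemma mon_empty [simp]: "mon {#} = \<one>"
  by (simp add: mon_def)

lemma mon_add_mset: "mon (add_mset i M) = z i \<otimes> mon M"
proof -
  have "foldr (\<lambda>i u. z i \<otimes> u) (insort i is) \<one> = z i \<otimes> foldr (\<lambda>i u. z i \<otimes> u) is \<one>" for "is"
  proof (induction "is")
    case (Cons j js)
    have "z j \<otimes> (z i \<otimes> u) = z i \<otimes> (z j \<otimes> u)" if "u \<in> carrier A" for u
      using that z_central[of "z i" j] by (simp add: m_assoc[symmetric])
    with Cons show ?case by simp
  qed simp
  then show ?thesis by (simp add: mon_def)
qed

lemma mon_add: "mon (M + N) = mon M \<otimes> mon N"
  by (induction M) (simp_all add: mon_add_mset m_assoc)

lemma mon_central: "a \<in> carrier A \<Longrightarrow> mon M \<otimes> a = a \<otimes> mon M"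
proof (induction M)
  case (add i M)
  have "z i \<otimes> (mon M \<otimes> a) = z i \<otimes> (a \<otimes> mon M)"
    using add by simp
  also have "\<dots> = (z i \<otimes> a) \<otimes> mon M"
    using add.prems by (simp add: m_assoc)
  also have "\<dots> = a \<otimes> (z i \<otimes> mon M)"
    using add.prems by (simp add: z_central m_assoc)
  finally show ?case using add.prems by (simp add: mon_add_mset m_assoc)
qed simp

definition eval :: "(nat multiset \<Rightarrow>\<^sub>0 int) \<Rightarrow> 'a"
  where "eval p = (\<Oplus>M\<in>Poly_Mapping.keys p. [Poly_Mapping.lookup p M] \<cdot> mon M)"

lemma add_pow_closed [simp]: "a \<in> carrier A \<Longrightarrow> [(c :: int)] \<cdot> a \<in> carrier A"
  by (rule add.int_pow_closed)

lemma eval_superset: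
  assumes "finite S" "Poly_Mapping.keys p \<subseteq> S"
  shows "eval p = (\<Oplus>M\<in>S. [Poly_Mapping.lookup p M] \<cdot> mon M)"
  unfolding eval_def
proof (rule add.finprod_mono_neutral_cong_left[OF assms])
  fix M assume "M \<in> S - Poly_Mapping.keys p"
  then show "[Poly_Mapping.lookup p M] \<cdot> mon M = \<zero>"
    by (simp add: in_keys_iff add_pow_def)
qed auto

lemma eval_closed [simp]: "eval p \<in> carrier A"
  by (auto simp: eval_def intro!: finsum_closed)

lemma eval_0 [simp]: "eval 0 = \<zero>"
  by (simp add: eval_def)

lemma eval_add: "eval (p + q) = eval p \<oplus> eval q"
proof -
  let ?S = "Poly_Mapping.keys p \<union> Poly_Mapping.keys q"
  have "eval (p + q) = (\<Oplus>M\<in>?S. [Poly_Mapping.lookup (p + q) M] \<cdot> mon M)"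
    by (intro eval_superset Poly_Mapping.keys_add) auto
  also have "\<dots> = (\<Oplus>M\<in>?S. [Poly_Mapping.lookup p M] \<cdot> mon M \<oplus> [Poly_Mapping.lookup q M] \<cdot> mon M)"
    by (intro finsum_cong') (auto simp: lookup_add add.int_pow_mult)
  also have "\<dots> = eval p \<oplus> eval q"
    by (subst finsum_addf) (auto simp: eval_superset[of ?S])
  finally show ?thesis .
qed

lemma eval_uminus: "eval (- p) = \<ominus> eval p"
proof -
  have "eval (- p) \<oplus> eval p = \<zero>" using eval_add[of "- p" p] by simp
  then show ?thesis by (simp add: minus_equality)
qed

lemma eval_diff: "eval (p - q) = eval p \<ominus> eval q"
  using eval_add[of p "- q"] by (simp add: eval_uminus minus_eq)

lemma eval_sum: "eval (sum g S) = (\<Oplus>i\<in>S. eval (g i))"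
  by (induction S rule: infinite_finite_induct) (auto simp: eval_add)

lemma eval_frag_of: "eval (frag_of M) = mon M"
  by (simp add: eval_def)

lemma eval_mult: "eval (p * q) = eval p \<otimes> eval q"
proof (rule frag_induction[where P = "\<lambda>p. eval (p * q) = eval p \<otimes> eval q", OF subset_UNIV])
  fix M :: "nat multiset"
  show "eval (frag_of M * q) = eval (frag_of M) \<otimes> eval q"
  proof (rule frag_induction[where P = "\<lambda>q. eval (frag_of M * q) = eval (frag_of M) \<otimes> eval q", OF subset_UNIV])
    fix N :: "nat multiset"
    show "eval (frag_of M * frag_of N) = eval (frag_of M) \<otimes> eval (frag_of N)"
      by (simp add: mult_single eval_frag_of[simplified] mon_add)
  next
    fix a b
    assume "eval (frag_of M * a) = eval (frag_of M) \<otimes> eval a"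
      "eval (frag_of M * b) = eval (frag_of M) \<otimes> eval b"
    then show "eval (frag_of M * (a - b)) = eval (frag_of M) \<otimes> eval (a - b)"
      by (simp add: right_diff_distrib eval_diff r_minus r_distr minus_eq)
  qed simp
next
  fix a b
  assume "eval (a * q) = eval a \<otimes> eval q" "eval (b * q) = eval b \<otimes> eval q"
  then show "eval ((a - b) * q) = eval (a - b) \<otimes> eval q"
    by (simp add: left_diff_distrib eval_diff l_minus l_distr minus_eq)
qed simp

lemma eval_1 [simp]: "eval 1 = \<one>"
  using eval_frag_of[of 0] by simp

lemma eval_power: "eval (p ^ i) = eval p [^] i"
  by (induction i) (simp_all only: power_Suc2 power_0 eval_mult eval_1 nat_pow_0 nat_pow_Suc)

lemma eval_of_nat: "eval (of_nat i) = [i] \<cdot> \<one>"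
  by (induction i) (simp_all add: eval_add a_comm)

lemma eval_central: "a \<in> carrier A \<Longrightarrow> eval p \<otimes> a = a \<otimes> eval p"
proof -
  assume a: "a \<in> carrier A"
  have "eval p \<otimes> a = (\<Oplus>M\<in>Poly_Mapping.keys p. [Poly_Mapping.lookup p M] \<cdot> mon M \<otimes> a)"
    unfolding eval_def using a by (intro finsum_ldistr) auto
  also have "\<dots> = (\<Oplus>M\<in>Poly_Mapping.keys p. a \<otimes> [Poly_Mapping.lookup p M] \<cdot> mon M)"
    using a by (intro finsum_cong') (auto simp: add_pow_ldistr_int add_pow_rdistr_int mon_central)
  also have "\<dots> = a \<otimes> eval p"
    unfolding eval_def using a by (intro finsum_rdistr[symmetric]) auto
  finally show ?thesis .
qed

lemma eval_var [simp]: "eval (var i) = z i"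
  unfolding var_def eval_frag_of by (simp add: mon_add_mset)

end

section \<open>Monogenic algebras with a central generator\<close>

text \<open>
  The variable with index \<open>0\<close> is the root \<open>y\<close>, the others are coefficients. The constant coefficient
  is not a variable but the value that makes \<open>y\<close> a root.
\<close>

definition univ_coeff :: "nat \<Rightarrow> nat \<Rightarrow> nat multiset \<Rightarrow>\<^sub>0 int"
  where "univ_coeff n j =
    (if j = 0 then - (var 0 ^ n + (\<Sum>i\<in>{1..<n}. var i * var 0 ^ i)) else var j)"

definition univ_poly :: "nat \<Rightarrow> (nat multiset \<Rightarrow>\<^sub>0 int) poly"
  where "univ_poly n = monom 1 n + (\<Sum>j<n. monom (univ_coeff n j) j)"

lemma coeff_univ_poly:
  "coeff (univ_poly n) j = (if j = n then 1 else if j < n then univ_coeff n j else 0)"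
  by (auto simp: univ_poly_def coeff_sum sum.delta)

lemma monic_root_univ_poly: "n \<ge> 2 \<Longrightarrow> monic_root (univ_poly n) (var 0) n"
proof
  assume n: "n \<ge> 2"
  show "degree (univ_poly n) = n"
    by (intro antisym degree_le le_degree) (auto simp: coeff_univ_poly)
  have "{..<n} = insert 0 {1..<n}" using n by auto
  then have "(\<Sum>j<n. univ_coeff n j * var 0 ^ j)
      = univ_coeff n 0 + (\<Sum>j\<in>{1..<n}. univ_coeff n j * var 0 ^ j)"
    by simp
  also have "(\<Sum>j\<in>{1..<n}. univ_coeff n j * var 0 ^ j) = (\<Sum>j\<in>{1..<n}. var j * var 0 ^ j)"
    by (intro sum.cong) (auto simp: univ_coeff_def)
  finally show "poly (univ_poly n) (var 0) = 0"
    by (simp add: univ_poly_def poly_sum poly_monom univ_coeff_def)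
qed (simp_all add: coeff_univ_poly)

text \<open>
  What is used of the monogenic extension: the powers of a central element \<open>x\<close> below \<open>n\<close> are a basis
  on the left and on the right over \<open>K\<close>, with coordinates \<open>coef\<close>, and \<open>x\<close> satisfies a monic equation whose
  coefficients are central in \<open>K\<close>.
\<close>

locale central_monogenic =
  K: assoc_algebra k K + A: assoc_algebra k A
  for k :: "('k, 'c) ring_scheme" and K :: "('k, 'l, 'd) module_scheme"
    and A :: "('k, 'b, 'e) module_scheme" (structure) +
  fixes \<iota> :: "'l \<Rightarrow> 'b" and x :: 'b and n :: nat and lam :: "nat \<Rightarrow> 'l" and coef :: "nat \<Rightarrow> 'b \<Rightarrow> 'l"
  assumes \<iota>: "\<iota> \<in> algebra_hom k K A"
    and n_ge_2: "n \<ge> 2"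
    and x_closed [simp]: "x \<in> carrier A"
    and x_central: "a \<in> carrier A \<Longrightarrow> x \<otimes> a = a \<otimes> x"
    and lam_closed [simp]: "i \<le> n \<Longrightarrow> lam i \<in> carrier K"
    and lam_0 [simp]: "lam 0 = \<one>\<^bsub>K\<^esub>"
    and lam_central: "i \<le> n \<Longrightarrow> u \<in> carrier K \<Longrightarrow> lam i \<otimes>\<^bsub>K\<^esub> u = u \<otimes>\<^bsub>K\<^esub> lam i"
    and equation: "(\<Oplus>j\<in>{..n}. \<iota> (lam (n - j)) \<otimes> x [^] j) = \<zero>"
    and coef_closed [simp]: "l < n \<Longrightarrow> a \<in> carrier A \<Longrightarrow> coef l a \<in> carrier K"
    and coef_add: "l < n \<Longrightarrow> a \<in> carrier A \<Longrightarrow> b \<in> carrier A \<Longrightarrow> coef l (a \<oplus> b) = coef l a \<oplus>\<^bsub>K\<^esub> coef l b"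
    and coef_left: "l < n \<Longrightarrow> u \<in> carrier K \<Longrightarrow> a \<in> carrier A \<Longrightarrow> coef l (\<iota> u \<otimes> a) = u \<otimes>\<^bsub>K\<^esub> coef l a"
    and coef_right: "l < n \<Longrightarrow> u \<in> carrier K \<Longrightarrow> a \<in> carrier A \<Longrightarrow> coef l (a \<otimes> \<iota> u) = coef l a \<otimes>\<^bsub>K\<^esub> u"
    and coef_pow: "l < n \<Longrightarrow> i < n \<Longrightarrow> coef l (x [^] i) = (if i = l then \<one>\<^bsub>K\<^esub> else \<zero>\<^bsub>K\<^esub>)"
    and expansion: "a \<in> carrier A \<Longrightarrow> a = (\<Oplus>l\<in>{..<n}. \<iota> (coef l a) \<otimes> x [^] l)"
begin

lemma \<iota>_closed [simp]: "u \<in> carrier K \<Longrightarrow> \<iota> u \<in> carrier A"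
  and \<iota>_add: "u \<in> carrier K \<Longrightarrow> v \<in> carrier K \<Longrightarrow> \<iota> (u \<oplus>\<^bsub>K\<^esub> v) = \<iota> u \<oplus> \<iota> v"
  and \<iota>_mult: "u \<in> carrier K \<Longrightarrow> v \<in> carrier K \<Longrightarrow> \<iota> (u \<otimes>\<^bsub>K\<^esub> v) = \<iota> u \<otimes> \<iota> v"
  and \<iota>_one [simp]: "\<iota> \<one>\<^bsub>K\<^esub> = \<one>"
  and \<iota>_smult: "c \<in> carrier k \<Longrightarrow> u \<in> carrier K \<Longrightarrow> \<iota> (c \<odot>\<^bsub>K\<^esub> u) = c \<odot> \<iota> u"
  using \<iota> by (auto simp: algebra_hom_def ring_hom_def Defs.module_hom_def)

lemma \<iota>_zero [simp]: "\<iota> \<zero>\<^bsub>K\<^esub> = \<zero>"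
  using K.additive_zero[of \<iota> A] \<iota>_add[of "\<zero>\<^bsub>K\<^esub>" "\<zero>\<^bsub>K\<^esub>"] A.abelian_group_axioms by simp

lemma \<iota>_finsum: "(\<And>i. i \<in> S \<Longrightarrow> g i \<in> carrier K) \<Longrightarrow> \<iota> (\<Oplus>\<^bsub>K\<^esub>i\<in>S. g i) = (\<Oplus>i\<in>S. \<iota> (g i))"
  by (rule additive_finsum[OF K.abelian_monoid_axioms A.abelian_monoid_axioms]) (simp_all add: \<iota>_add)

lemma coef_zero [simp]: "l < n \<Longrightarrow> coef l \<zero> = \<zero>\<^bsub>K\<^esub>"
  using A.additive_zero[of "coef l" K] coef_add[of l \<zero> \<zero>] K.abelian_group_axioms by simp

lemma coef_finsum:
  "l < n \<Longrightarrow> (\<And>i. i \<in> S \<Longrightarrow> g i \<in> carrier A) \<Longrightarrow> coef l (\<Oplus>i\<in>S. g i) = (\<Oplus>\<^bsub>K\<^esub>i\<in>S. coef l (g i))"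
  by (rule additive_finsum[OF A.abelian_monoid_axioms K.abelian_monoid_axioms]) (simp_all add: coef_add)

lemma \<iota>_coef_finsum:
  "l < n \<Longrightarrow> (\<And>i. i \<in> S \<Longrightarrow> g i \<in> carrier A)
    \<Longrightarrow> \<iota> (coef l (\<Oplus>i\<in>S. g i)) = (\<Oplus>i\<in>S. \<iota> (coef l (g i)))"
  by (subst coef_finsum) (auto intro!: \<iota>_finsum)

lemma smult_eq_mult: "c \<in> carrier k \<Longrightarrow> a \<in> carrier A \<Longrightarrow> c \<odot> a = \<iota> (c \<odot>\<^bsub>K\<^esub> \<one>\<^bsub>K\<^esub>) \<otimes> a"
  by (simp add: \<iota>_smult A.smult_mult_left)

lemma \<iota>_lam_central: "i \<le> n \<Longrightarrow> a \<in> carrier A \<Longrightarrow> \<iota> (lam i) \<otimes> a = a \<otimes> \<iota> (lam i)"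
proof -
  assume i: "i \<le> n" and a: "a \<in> carrier A"
  have closed: "\<iota> (coef l a) \<otimes> x [^] l \<in> carrier A" if "l < n" for l
    using a that by simp
  have "\<iota> (lam i) \<otimes> (\<iota> (coef l a) \<otimes> x [^] l) = \<iota> (coef l a) \<otimes> x [^] l \<otimes> \<iota> (lam i)" if "l < n" for l
  proof -
    have "x [^] l \<otimes> \<iota> (lam i) = \<iota> (lam i) \<otimes> x [^] l"
      using i x_central[of "\<iota> (lam i)"] by (simp add: A.group_commutes_pow)
    then show ?thesis
      using i a that lam_central[of i "coef l a"]
      by (simp add: A.m_assoc \<iota>_mult[symmetric] A.m_assoc[symmetric, of "\<iota> (lam i)"])
        (simp add: \<iota>_mult A.m_assoc)
  qed
  then have "\<iota> (lam i) \<otimes> (\<Oplus>l\<in>{..<n}. \<iota> (coef l a) \<otimes> x [^] l)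
      = (\<Oplus>l\<in>{..<n}. \<iota> (coef l a) \<otimes> x [^] l) \<otimes> \<iota> (lam i)"
    using i closed
    by (subst A.finsum_rdistr, simp, simp, simp, subst A.finsum_ldistr, simp, simp, simp)
      (intro A.finsum_cong', auto)
  then show ?thesis using expansion[OF a] by simp
qed

sublocale ev: central_family A "\<lambda>i. if i = 0 then x else \<iota> (lam (n - i))"
  by unfold_locales (auto simp: x_central \<iota>_lam_central)

abbreviation \<eta> :: "(nat multiset \<Rightarrow>\<^sub>0 int) \<Rightarrow> 'b"
  where "\<eta> \<equiv> ev.eval"

sublocale U: monic_root "univ_poly n" "var 0" n
  by (rule monic_root_univ_poly[OF n_ge_2])

lemma \<eta>_y: "\<eta> (var 0 ^ i) = x [^] i"
  by (simp add: ev.eval_power)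

text \<open>
  For the constant coefficient this is the equation of \<open>x\<close>.
\<close>

lemma \<eta>_coeff: "j \<le> n \<Longrightarrow> \<eta> (coeff (univ_poly n) j) = \<iota> (lam (n - j))"
proof -
  assume j: "j \<le> n"
  consider "j = n" | "0 < j" "j < n" | "j = 0" using j by linarith
  then show ?thesis
  proof cases
    case 3
    let ?g = "\<lambda>j. \<iota> (lam (n - j)) \<otimes> x [^] j"
    have closed: "?g \<in> S \<rightarrow> carrier A" if "S \<subseteq> {..n}" for S using that by auto
    have "{..n} = insert 0 (insert n {1..<n})" using n_ge_2 by auto
    then have "\<zero> = (\<Oplus>j\<in>insert 0 (insert n {1..<n}). ?g j)"
      using equation by simp
    also have "\<dots> = \<iota> (lam n) \<oplus> (x [^] n \<oplus> (\<Oplus>j\<in>{1..<n}. ?g j))"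
      using n_ge_2 closed by (subst A.finsum_insert, simp, simp, auto)+
    finally have "\<iota> (lam n) \<oplus> (x [^] n \<oplus> (\<Oplus>j\<in>{1..<n}. ?g j)) = \<zero>" by simp
    moreover have sum: "(\<Oplus>j\<in>{1..<n}. ?g j) \<in> carrier A"
      using closed by (intro A.finsum_closed) auto
    ultimately have "\<iota> (lam n) = \<ominus> (x [^] n \<oplus> (\<Oplus>j\<in>{1..<n}. ?g j))"
      using A.minus_equality[of "\<iota> (lam n)" "x [^] n \<oplus> (\<Oplus>j\<in>{1..<n}. ?g j)"] by simp
    moreover have "\<eta> (\<Sum>i\<in>{1..<n}. var i * var 0 ^ i) = (\<Oplus>j\<in>{1..<n}. ?g j)"
      unfolding ev.eval_sum using closed by (intro A.finsum_cong') (auto simp: ev.eval_mult ev.eval_power)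
    ultimately show ?thesis
      using 3 n_ge_2
      by (simp add: coeff_univ_poly univ_coeff_def ev.eval_uminus ev.eval_add \<eta>_y
          del: minus_add_distrib)
  qed (auto simp: coeff_univ_poly univ_coeff_def)
qed

lemma x_pow_high:
  "x [^] (m + n) = \<ominus> (\<Oplus>j\<in>{..<n}. \<iota> (lam (n - j)) \<otimes> x [^] (m + j))"
proof -
  let ?g = "\<lambda>j. \<iota> (lam (n - j)) \<otimes> x [^] j"
  have "\<zero> = x [^] m \<otimes> (\<Oplus>j\<in>{..n}. ?g j)"
    using equation by simp
  also have "\<dots> = (\<Oplus>j\<in>{..n}. x [^] m \<otimes> ?g j)"
    by (intro A.finsum_rdistr) auto
  also have "\<dots> = (\<Oplus>j\<in>{..n}. \<iota> (lam (n - j)) \<otimes> x [^] (m + j))"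
  proof (intro A.finsum_cong')
    fix j assume "j \<in> {..n}"
    then show "x [^] m \<otimes> ?g j = \<iota> (lam (n - j)) \<otimes> x [^] (m + j)"
      using \<iota>_lam_central[of "n - j" "x [^] m", symmetric]
      by (simp add: A.m_assoc[symmetric]) (simp add: A.m_assoc A.nat_pow_mult)
  qed auto
  also have "{..n} = insert n {..<n}" by auto
  also have "(\<Oplus>j\<in>insert n {..<n}. \<iota> (lam (n - j)) \<otimes> x [^] (m + j))
      = x [^] (m + n) \<oplus> (\<Oplus>j\<in>{..<n}. \<iota> (lam (n - j)) \<otimes> x [^] (m + j))"
    by (subst A.finsum_insert) (auto simp: Pi_iff)
  finally have "x [^] (m + n) \<oplus> (\<Oplus>j\<in>{..<n}. \<iota> (lam (n - j)) \<otimes> x [^] (m + j)) = \<zero>" by simp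
  then show ?thesis
    using A.minus_equality[of "x [^] (m + n)" "\<Oplus>j\<in>{..<n}. \<iota> (lam (n - j)) \<otimes> x [^] (m + j)"]
    by (auto simp: Pi_iff)
qed

lemma rem_xpow_high:
  "coeff (U.rem (xpow (m + n))) l = - (\<Sum>j<n. coeff (univ_poly n) j * coeff (U.rem (xpow (m + j))) l)"
proof -
  have "univ_poly n = xpow n + (\<Sum>j<n. smult (coeff (univ_poly n) j) (xpow j))"
  proof (rule poly_eqI)
    fix i
    have "(\<Sum>j<n. coeff (smult (coeff (univ_poly n) j) (xpow j)) i)
        = (\<Sum>j<n. if j = i then coeff (univ_poly n) i else 0)"
      by (intro sum.cong) auto
    then show "coeff (univ_poly n) i = coeff (xpow n + (\<Sum>j<n. smult (coeff (univ_poly n) j) (xpow j))) i"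
      by (simp add: coeff_sum coeff_univ_poly[of n i])
  qed
  then have "xpow m * univ_poly n = xpow m * (xpow n + (\<Sum>j<n. smult (coeff (univ_poly n) j) (xpow j)))"
    by (rule arg_cong)
  also have "\<dots> = xpow (m + n) + (\<Sum>j<n. smult (coeff (univ_poly n) j) (xpow (m + j)))"
    by (simp add: distrib_left mult_monom sum_distrib_left)
  finally have "xpow m * univ_poly n
      = xpow (m + n) + (\<Sum>j<n. smult (coeff (univ_poly n) j) (xpow (m + j)))" .
  moreover have "U.rem (xpow m * univ_poly n) = 0"
    using U.rem_add_mult_f[of 0 "xpow m"] by simp
  ultimately have "U.rem (xpow (m + n))
      + (\<Sum>j<n. smult (coeff (univ_poly n) j) (U.rem (xpow (m + j)))) = 0"
    by (simp add: U.rem_add U.rem_sum U.rem_smult)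
  then have "coeff (U.rem (xpow (m + n))
      + (\<Sum>j<n. smult (coeff (univ_poly n) j) (U.rem (xpow (m + j))))) l = coeff 0 l"
    by (rule arg_cong)
  then show ?thesis
    by (simp add: coeff_sum eq_neg_iff_add_eq_0 del: U.rem_xpow)
qed

text \<open>
  Powers of \<open>x\<close> and powers of \<open>X\<close> are reduced by the same recursion, so the structure constants of \<open>A\<close> are
  the images of the universal ones.
\<close>

lemma \<eta>_rem: "l < n \<Longrightarrow> \<eta> (coeff (U.rem (xpow m)) l) = \<iota> (coef l (x [^] m))"
proof (induction m rule: less_induct)
  case (less m)
  show ?case
  proof (cases "m < n")
    case True
    then show ?thesis using less.prems by (simp add: coef_pow)
  next
    case False
    then obtain m' where m: "m = m' + n" by (metis add.commute le_Suc_ex not_less)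
    let ?g = "\<lambda>j. \<iota> (lam (n - j)) \<otimes> x [^] (m' + j)"
    have minus: "\<iota> (coef l (\<ominus> a)) = \<ominus> \<iota> (coef l a)" if "a \<in> carrier A" for a
    proof -
      have "\<iota> (coef l (\<ominus> a)) \<oplus> \<iota> (coef l a) = \<iota> (coef l (\<ominus> a \<oplus> a))"
        using that less.prems by (simp add: coef_add \<iota>_add del: A.l_neg)
      also have "\<dots> = \<zero>" using that less.prems by (simp add: A.l_neg)
      finally show ?thesis using that less.prems by (simp add: A.minus_equality)
    qed
    have IH: "\<eta> (coeff (U.rem (xpow (m' + j))) l) = \<iota> (coef l (x [^] (m' + j)))" if "j < n" for j
      using less.IH[of "m' + j"] less.prems that m by simp
    have "\<eta> (coeff (U.rem (xpow m)) l)
        = \<ominus> (\<Oplus>j\<in>{..<n}. \<iota> (lam (n - j)) \<otimes> \<iota> (coef l (x [^] (m' + j))))"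
      unfolding m rem_xpow_high ev.eval_uminus ev.eval_sum
      using IH less.prems by (intro arg_cong[of _ _ "a_inv A"] A.finsum_cong') (auto simp: ev.eval_mult \<eta>_coeff)
    also have "\<dots> = \<ominus> (\<Oplus>j\<in>{..<n}. \<iota> (coef l (?g j)))"
      using less.prems
      by (intro arg_cong[of _ _ "a_inv A"] A.finsum_cong') (auto simp: coef_left \<iota>_mult)
    also have "\<dots> = \<ominus> \<iota> (coef l (\<Oplus>j\<in>{..<n}. ?g j))"
      using less.prems by (subst coef_finsum) (auto simp: \<iota>_finsum)
    also have "\<dots> = \<iota> (coef l (x [^] m))"
      unfolding m x_pow_high using less.prems by (subst minus) (auto intro!: A.finsum_closed)
    finally show ?thesis .
  qed
qed

lemma x_pow_central: "a \<in> carrier A \<Longrightarrow> x [^] (i::nat) \<otimes> a = a \<otimes> x [^] i"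
  by (rule A.group_commutes_pow[OF x_central]) simp_all

lemma \<iota>_coef_mult:
  assumes l: "l < n" and p: "p \<in> carrier A" and q: "q \<in> carrier A"
  shows "\<iota> (coef l (p \<otimes> q)) = (\<Oplus>i\<in>{..<n}. \<Oplus>j\<in>{..<n}.
    \<iota> (coef i p) \<otimes> (\<iota> (coef j q) \<otimes> \<eta> (coeff (U.rem (xpow (i + j))) l)))"
proof -
  let ?p = "\<lambda>i. \<iota> (coef i p) \<otimes> x [^] i" and ?q = "\<lambda>j. \<iota> (coef j q) \<otimes> x [^] j"
  have closed: "?p i \<in> carrier A" "?q i \<in> carrier A" if "i < n" for i
    using that p q by simp_all
  have pq: "\<iota> (coef l (?p i \<otimes> ?q j))
      = \<iota> (coef i p) \<otimes> (\<iota> (coef j q) \<otimes> \<eta> (coeff (U.rem (xpow (i + j))) l))"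
    if "i < n" "j < n" for i j
  proof -
    have "?p i \<otimes> ?q j = \<iota> (coef i p) \<otimes> (x [^] i \<otimes> \<iota> (coef j q)) \<otimes> x [^] j"
      using p q that by (simp add: A.m_assoc)
    also have "\<dots> = \<iota> (coef i p) \<otimes> (\<iota> (coef j q) \<otimes> x [^] (i + j))"
      using p q that x_pow_central[of "\<iota> (coef j q)" i] by (simp add: A.m_assoc A.nat_pow_mult)
    finally show ?thesis
      using p q l that by (simp add: coef_left \<iota>_mult \<eta>_rem)
  qed
  have "p \<otimes> q = (\<Oplus>i\<in>{..<n}. ?p i) \<otimes> (\<Oplus>j\<in>{..<n}. ?q j)"
    using expansion[OF p] expansion[OF q] by simp
  also have "\<dots> = (\<Oplus>i\<in>{..<n}. ?p i \<otimes> (\<Oplus>j\<in>{..<n}. ?q j))"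
    using closed by (intro A.finsum_ldistr) (auto intro!: A.finsum_closed)
  also have "\<dots> = (\<Oplus>i\<in>{..<n}. \<Oplus>j\<in>{..<n}. ?p i \<otimes> ?q j)"
    using closed by (intro A.finsum_cong' A.finsum_rdistr) (auto intro!: A.finsum_closed)
  finally have "\<iota> (coef l (p \<otimes> q)) = \<iota> (coef l (\<Oplus>i\<in>{..<n}. \<Oplus>j\<in>{..<n}. ?p i \<otimes> ?q j))"
    by simp
  also have "\<dots> = (\<Oplus>i\<in>{..<n}. \<iota> (coef l (\<Oplus>j\<in>{..<n}. ?p i \<otimes> ?q j)))"
    using closed l by (intro \<iota>_coef_finsum) (auto intro!: A.finsum_closed)
  also have "\<dots> = (\<Oplus>i\<in>{..<n}. \<Oplus>j\<in>{..<n}. \<iota> (coef l (?p i \<otimes> ?q j)))"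
    using closed l
    by (intro A.finsum_cong' \<iota>_coef_finsum) (auto intro!: A.finsum_closed)
  also have "\<dots> = (\<Oplus>i\<in>{..<n}. \<Oplus>j\<in>{..<n}.
      \<iota> (coef i p) \<otimes> (\<iota> (coef j q) \<otimes> \<eta> (coeff (U.rem (xpow (i + j))) l)))"
    using p q by (intro A.finsum_cong') (auto simp: pq intro!: A.finsum_closed)
  finally show ?thesis .
qed

section \<open>Cochains as multilinear maps\<close>

text \<open>
  By these rules, membership in the set of lists over a carrier would be unfolded into quantified
  statements about elements, on which automatic proofs diverge.
\<close>

declare in_listsD [rule del] in_listsI [rule del]

text \<open>
  The \<open>K\<close>-multilinear extension of a cochain: the sum over all tuples of exponents of the coordinates
  of the arguments, multiplied in their order, times the value of \<open>F\<close>.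
\<close>

fun E :: "(nat list \<Rightarrow> nat multiset \<Rightarrow>\<^sub>0 int) \<Rightarrow> 'b list \<Rightarrow> 'b"
  where "E F [] = \<eta> (F [])"
  | "E F (p # ps) = (\<Oplus>l\<in>{..<n}. \<iota> (coef l p) \<otimes> E (\<lambda>t. F (l # t)) ps)"

abbreviation tuples :: "'b list set"
  where "tuples \<equiv> lists (carrier A)"

lemma sum_closed [simp]: "(\<And>i. i \<in> S \<Longrightarrow> g i \<in> carrier A) \<Longrightarrow> (\<Oplus>i\<in>S. g i) \<in> carrier A"
  by (intro A.finsum_closed) auto

lemma sum_cong:
  "(\<And>i. i \<in> S \<Longrightarrow> g i \<in> carrier A) \<Longrightarrow> (\<And>i. i \<in> S \<Longrightarrow> f i = g i) \<Longrightarrow> (\<Oplus>i\<in>S. f i) = (\<Oplus>i\<in>S. g i)"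
  by (intro A.finsum_cong') auto

lemma sum_add:
  "(\<And>i. i \<in> S \<Longrightarrow> f i \<in> carrier A) \<Longrightarrow> (\<And>i. i \<in> S \<Longrightarrow> g i \<in> carrier A)
    \<Longrightarrow> (\<Oplus>i\<in>S. f i \<oplus> g i) = (\<Oplus>i\<in>S. f i) \<oplus> (\<Oplus>i\<in>S. g i)"
  by (intro A.finsum_addf) auto

lemma sum_rdistr:
  "a \<in> carrier A \<Longrightarrow> (\<And>i. i < m \<Longrightarrow> g i \<in> carrier A) \<Longrightarrow> a \<otimes> (\<Oplus>i\<in>{..<m}. g i) = (\<Oplus>i\<in>{..<m::nat}. a \<otimes> g i)"
  by (intro A.finsum_rdistr) auto

lemma sum_ldistr:
  "a \<in> carrier A \<Longrightarrow> (\<And>i. i < m \<Longrightarrow> g i \<in> carrier A) \<Longrightarrow> (\<Oplus>i\<in>{..<m}. g i) \<otimes> a = (\<Oplus>i\<in>{..<m::nat}. g i \<otimes> a)"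
  by (intro A.finsum_ldistr) auto

lemma E_closed [simp]: "ps \<in> tuples \<Longrightarrow> E F ps \<in> carrier A"
  by (induction ps arbitrary: F) auto

lemma E_cong:
  assumes "\<And>t. t \<in> U.idx \<Longrightarrow> length t = length ps \<Longrightarrow> F t = G t" "ps \<in> tuples"
  shows "E F ps = E G ps"
  using assms
proof (induction ps arbitrary: F G)
  case (Cons p ps)
  have "E (\<lambda>t. F (l # t)) ps = E (\<lambda>t. G (l # t)) ps" if "l < n" for l
    using Cons.prems that by (intro Cons.IH) auto
  then show ?case
    using Cons.prems by (auto intro!: sum_cong)
qed simp

lemma E_add: "ps \<in> tuples \<Longrightarrow> E (\<lambda>t. F t + G t) ps = E F ps \<oplus> E G ps"
proof (induction ps arbitrary: F G)
  case (Cons p ps)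
  have "E (\<lambda>t. F t + G t) (p # ps)
      = (\<Oplus>l\<in>{..<n}. \<iota> (coef l p) \<otimes> E (\<lambda>t. F (l # t)) ps \<oplus> \<iota> (coef l p) \<otimes> E (\<lambda>t. G (l # t)) ps)"
    unfolding E.simps using Cons by (intro sum_cong) (auto simp: A.r_distr)
  then show ?case using Cons.prems by (simp add: sum_add)
qed (simp add: ev.eval_add)

lemma E_scale: "ps \<in> tuples \<Longrightarrow> E (\<lambda>t. r * F t) ps = \<eta> r \<otimes> E F ps"
proof (induction ps arbitrary: F)
  case (Cons p ps)
  have "\<iota> (coef l p) \<otimes> (\<eta> r \<otimes> E (\<lambda>t. F (l # t)) ps) = \<eta> r \<otimes> (\<iota> (coef l p) \<otimes> E (\<lambda>t. F (l # t)) ps)"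
    if "l < n" for l
    using Cons.prems that by (simp add: A.m_assoc[symmetric]) (simp add: ev.eval_central)
  then show ?case
    using Cons by (auto simp: sum_rdistr intro!: sum_cong)
qed (simp add: ev.eval_mult)

lemma E_zero [simp]: "ps \<in> tuples \<Longrightarrow> E (\<lambda>t. 0) ps = \<zero>"
  using E_scale[of ps 0 "\<lambda>t. 0"] by simp

lemma E_diff: "ps \<in> tuples \<Longrightarrow> E (\<lambda>t. F t - G t) ps = E F ps \<ominus> E G ps"
proof -
  assume ps: "ps \<in> tuples"
  have "E (\<lambda>t. - 1 * G t) ps = \<ominus> E G ps"
    unfolding E_scale[OF ps] using ps by (simp add: ev.eval_uminus A.l_minus)
  with E_add[OF ps, of F "\<lambda>t. - 1 * G t"] show ?thesis
    by (simp add: A.minus_eq)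
qed

lemma E_sum: "ps \<in> tuples \<Longrightarrow> E (\<lambda>t. \<Sum>a\<in>S. G a t) ps = (\<Oplus>a\<in>S. E (G a) ps)"
  by (induction S rule: infinite_finite_induct) (auto simp: E_add Pi_iff)

lemma E_ins:
  "ps \<in> tuples \<Longrightarrow>
    E (U.ins F P) ps = (\<Oplus>l\<in>{..<n}. \<eta> (coeff (U.rem P) l) \<otimes> E (\<lambda>t. F (l # t)) ps)"
  unfolding U.ins_def[abs_def] by (simp add: E_sum E_scale)

lemma E_slot_add:
  "us \<in> tuples \<Longrightarrow> vs \<in> tuples \<Longrightarrow> p \<in> carrier A \<Longrightarrow> q \<in> carrier A \<Longrightarrow>
    E F (us @ (p \<oplus> q) # vs) = E F (us @ p # vs) \<oplus> E F (us @ q # vs)"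
proof (induction us arbitrary: F)
  case Nil
  then have "(\<Oplus>l\<in>{..<n}. \<iota> (coef l (p \<oplus> q)) \<otimes> E (\<lambda>t. F (l # t)) vs)
    = (\<Oplus>l\<in>{..<n}. \<iota> (coef l p) \<otimes> E (\<lambda>t. F (l # t)) vs \<oplus> \<iota> (coef l q) \<otimes> E (\<lambda>t. F (l # t)) vs)"
    by (intro sum_cong) (auto simp: coef_add \<iota>_add A.l_distr)
  then show ?case using Nil by (simp add: sum_add)
next
  case (Cons u us)
  then have "(\<Oplus>l\<in>{..<n}. \<iota> (coef l u) \<otimes> E (\<lambda>t. F (l # t)) (us @ (p \<oplus> q) # vs))
    = (\<Oplus>l\<in>{..<n}. \<iota> (coef l u) \<otimes> E (\<lambda>t. F (l # t)) (us @ p # vs)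
        \<oplus> \<iota> (coef l u) \<otimes> E (\<lambda>t. F (l # t)) (us @ q # vs))"
    by (intro sum_cong) (auto simp: A.r_distr)
  then show ?case using Cons by (simp add: sum_add)
qed

lemma E_head:
  "ps \<in> tuples \<Longrightarrow> u \<in> carrier K \<Longrightarrow> p \<in> carrier A \<Longrightarrow> E F ((\<iota> u \<otimes> p) # ps) = \<iota> u \<otimes> E F (p # ps)"
  by (auto simp: sum_rdistr coef_left \<iota>_mult A.m_assoc intro!: sum_cong)

lemma E_balanced:
  "us \<in> tuples \<Longrightarrow> vs \<in> tuples \<Longrightarrow> p \<in> carrier A \<Longrightarrow> q \<in> carrier A \<Longrightarrow> u \<in> carrier K \<Longrightarrow>
    E F (us @ (p \<otimes> \<iota> u) # q # vs) = E F (us @ p # (\<iota> u \<otimes> q) # vs)"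
proof (induction us arbitrary: F)
  case Nil
  have "E F ((p \<otimes> \<iota> u) # q # vs) = (\<Oplus>l\<in>{..<n}. \<iota> (coef l p) \<otimes> (\<iota> u \<otimes> E (\<lambda>t. F (l # t)) (q # vs)))"
    unfolding E.simps(2)[of F "p \<otimes> \<iota> u"]
    using Nil by (intro sum_cong) (auto simp: coef_right \<iota>_mult A.m_assoc simp del: E.simps(2))
  also have "\<dots> = (\<Oplus>l\<in>{..<n}. \<iota> (coef l p) \<otimes> E (\<lambda>t. F (l # t)) ((\<iota> u \<otimes> q) # vs))"
    using Nil by (intro sum_cong) (auto simp: E_head simp del: E.simps(2))
  finally show ?case by simp
next
  case (Cons w us)
  then show ?case by (auto intro!: sum_cong simp del: E.simps(2) simp: E.simps(2)[of F])
qed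

lemma E_last:
  "us \<in> tuples \<Longrightarrow> p \<in> carrier A \<Longrightarrow> u \<in> carrier K \<Longrightarrow>
    E F (us @ [p \<otimes> \<iota> u]) = E F (us @ [p]) \<otimes> \<iota> u"
proof (induction us arbitrary: F)
  case Nil
  then have "\<iota> (coef l (p \<otimes> \<iota> u)) \<otimes> \<eta> (F [l]) = \<iota> (coef l p) \<otimes> \<eta> (F [l]) \<otimes> \<iota> u" if "l < n" for l
    using that by (simp add: coef_right \<iota>_mult A.m_assoc ev.eval_central)
  then show ?case using Nil by (auto simp: sum_ldistr intro!: sum_cong)
next
  case (Cons w us)
  then show ?case by (auto simp: sum_ldistr A.m_assoc intro!: sum_cong)
qed

lemma E_smult:
  assumes "us \<in> tuples" "vs \<in> tuples" "p \<in> carrier A" "c \<in> carrier k"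
  shows "E F (us @ (c \<odot> p) # vs) = c \<odot> E F (us @ p # vs)"
  using assms
proof (induction us arbitrary: F)
  case Nil
  then show ?case
    using E_head[of vs "c \<odot>\<^bsub>K\<^esub> \<one>\<^bsub>K\<^esub>" p F]
    by (simp add: smult_eq_mult del: E.simps)
next
  case (Cons w us)
  have "c \<odot> (\<Oplus>l\<in>{..<n}. \<iota> (coef l w) \<otimes> E (\<lambda>t. F (l # t)) (us @ p # vs))
      = (\<Oplus>l\<in>{..<n}. c \<odot> (\<iota> (coef l w) \<otimes> E (\<lambda>t. F (l # t)) (us @ p # vs)))"
    using Cons by (intro A.finsum_smult_ldistr) auto
  then show ?case
    using Cons by (auto simp: A.smult_mult_right intro!: sum_cong)
qed

text \<open>
  An element of \<open>K\<close> has only the coordinate of exponent \<open>0\<close>, on which \<open>F\<close> vanishes.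
\<close>

lemma E_const:
  assumes "U.normalized F" "us \<in> tuples" "vs \<in> tuples" "u \<in> carrier K"
  shows "E F (us @ \<iota> u # vs) = \<zero>"
  using assms
proof (induction us arbitrary: F)
  case Nil
  have zero: "E (\<lambda>t. F (0 # t)) vs = \<zero>"
    using Nil n_ge_2 E_cong[of vs "\<lambda>t. F (0 # t)" "\<lambda>t. 0"] by (simp add: U.normalizedD)
  have "coef l (\<iota> u) = (if l = 0 then u else \<zero>\<^bsub>K\<^esub>)" if "l < n" for l
    using coef_left[of l u \<one>] coef_pow[of l 0] that Nil n_ge_2 by (auto split: if_splits)
  then have "\<iota> (coef l (\<iota> u)) \<otimes> E (\<lambda>t. F (l # t)) vs = \<zero>" if "l < n" for l
    using zero that Nil by (cases "l = 0") auto
  then have "E F (\<iota> u # vs) = (\<Oplus>l\<in>{..<n}. \<zero>)"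
    unfolding E.simps by (intro sum_cong) auto
  then show ?case by simp
next
  case (Cons w us)
  then have "E F ((w # us) @ \<iota> u # vs) = (\<Oplus>l\<in>{..<n}. \<zero>)"
    unfolding append_Cons E.simps by (intro sum_cong) (auto simp: U.normalized_Cons)
  then show ?case by simp
qed

lemma E_monomials:
  "t \<in> U.idx \<Longrightarrow> E F (map (\<lambda>i. x [^] i) t) = \<eta> (F t)"
proof (induction t arbitrary: F)
  case (Cons i t)
  have closed: "map (\<lambda>i. x [^] i) t \<in> tuples" by (auto simp: in_lists_conv_set)
  have "E F (map (\<lambda>i. x [^] i) (i # t)) = (\<Oplus>l\<in>{..<n}. if i = l then \<eta> (F (l # t)) else \<zero>)"
    using Cons closed by (auto simp: coef_pow intro!: sum_cong)
  also have "\<dots> = \<eta> (F (i # t))"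
    using Cons.prems A.finsum_singleton[of i "{..<n}" "\<lambda>l. \<eta> (F (l # t))"] by simp
  finally show ?case .
qed simp

text \<open>
  For a function on tuples of elements of \<open>A\<close>, the faces at \<open>(p, p\<^sub>1, \<dots>, p\<^sub>r)\<close> other than the first one.
\<close>

fun mid :: "('b list \<Rightarrow> 'b) \<Rightarrow> 'b \<Rightarrow> 'b list \<Rightarrow> 'b"
  where "mid G p [] = G [] \<otimes> p"
  | "mid G p (q # ps) = G ((p \<otimes> q) # ps) \<ominus> mid (\<lambda>us. G (p # us)) q ps"

lemma mid_closed:
  "ps \<in> tuples \<Longrightarrow> p \<in> carrier A \<Longrightarrow> (\<And>us. us \<in> tuples \<Longrightarrow> G us \<in> carrier A) \<Longrightarrow> mid G p ps \<in> carrier A"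
  by (induction ps arbitrary: p G) auto

lemma mid_sum:
  assumes "ps \<in> tuples" "p \<in> carrier A" "\<And>l us. l < m \<Longrightarrow> us \<in> tuples \<Longrightarrow> G l us \<in> carrier A"
    "\<And>l. l < m \<Longrightarrow> a l \<in> carrier A"
  shows "mid (\<lambda>us. \<Oplus>l\<in>{..<m::nat}. a l \<otimes> G l us) p ps = (\<Oplus>l\<in>{..<m}. a l \<otimes> mid (G l) p ps)"
  using assms
proof (induction ps arbitrary: p G rule: list.induct)
  case Nil
  then show ?case by (auto simp: sum_ldistr A.m_assoc intro!: sum_cong)
next
  case (Cons q ps)
  have closed: "mid (\<lambda>us. G l (p # us)) q ps \<in> carrier A" if "l < m" for l
    using Cons.prems that by (intro mid_closed) simp_all
  have minus: "\<ominus> (\<Oplus>l\<in>{..<m}. g l) = (\<Oplus>l\<in>{..<m}. \<ominus> g l)" if "\<And>l. l < m \<Longrightarrow> g l \<in> carrier A" for g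
    using that by (intro additive_finsum[OF A.abelian_monoid_axioms A.abelian_monoid_axioms])
      (auto simp: A.minus_add)
  have "mid (\<lambda>us. \<Oplus>l\<in>{..<m}. a l \<otimes> G l us) p (q # ps)
      = (\<Oplus>l\<in>{..<m}. a l \<otimes> G l ((p \<otimes> q) # ps)) \<oplus> (\<Oplus>l\<in>{..<m}. \<ominus> (a l \<otimes> mid (\<lambda>us. G l (p # us)) q ps))"
    using Cons closed by (simp add: A.minus_eq minus)
  also have "\<dots> = (\<Oplus>l\<in>{..<m}. a l \<otimes> G l ((p \<otimes> q) # ps) \<oplus> \<ominus> (a l \<otimes> mid (\<lambda>us. G l (p # us)) q ps))"
    using Cons closed by (intro sum_add[symmetric]) auto
  also have "\<dots> = (\<Oplus>l\<in>{..<m}. a l \<otimes> mid (G l) p (q # ps))"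
    using Cons.prems closed by (intro sum_cong) (auto simp: A.minus_eq A.r_distr A.r_minus)
  finally show ?case .
qed

text \<open>
  Multiplication of two arguments in \<open>A\<close> corresponds to multiplication in \<open>S\<close>, because \<open>A\<close> has the
  universal structure constants.
\<close>

lemma E_merge:
  assumes ps: "ps \<in> tuples" and p: "p \<in> carrier A" and q: "q \<in> carrier A"
  shows "E F ((p \<otimes> q) # ps) = (\<Oplus>i\<in>{..<n}. \<iota> (coef i p) \<otimes>
    (\<Oplus>j\<in>{..<n}. \<iota> (coef j q) \<otimes> E (U.ins F (xpow (i + j))) ps))"
proof -
  let ?p = "\<lambda>i. \<iota> (coef i p)" and ?q = "\<lambda>j. \<iota> (coef j q)"
    and ?r = "\<lambda>i j l. \<eta> (coeff (U.rem (xpow (i + j))) l)" and ?e = "\<lambda>l. E (\<lambda>t. F (l # t)) ps"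
  have [simp]: "?p i \<in> carrier A" "?q i \<in> carrier A" if "i < n" for i using p q that by simp_all
  have [simp]: "?e l \<in> carrier A" for l using ps by simp
  have "E F ((p \<otimes> q) # ps) = (\<Oplus>l\<in>{..<n}. (\<Oplus>i\<in>{..<n}. \<Oplus>j\<in>{..<n}. ?p i \<otimes> (?q j \<otimes> ?r i j l)) \<otimes> ?e l)"
    using p q by (auto simp: \<iota>_coef_mult intro!: sum_cong)
  also have "\<dots> = (\<Oplus>l\<in>{..<n}. \<Oplus>i\<in>{..<n}. \<Oplus>j\<in>{..<n}. ?p i \<otimes> (?q j \<otimes> (?r i j l \<otimes> ?e l)))"
    by (auto simp: sum_ldistr A.m_assoc intro!: sum_cong)
  also have "\<dots> = (\<Oplus>i\<in>{..<n}. \<Oplus>l\<in>{..<n}. \<Oplus>j\<in>{..<n}. ?p i \<otimes> (?q j \<otimes> (?r i j l \<otimes> ?e l)))"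
    by (intro A.finsum_swap) auto
  also have "\<dots> = (\<Oplus>i\<in>{..<n}. \<Oplus>j\<in>{..<n}. \<Oplus>l\<in>{..<n}. ?p i \<otimes> (?q j \<otimes> (?r i j l \<otimes> ?e l)))"
    by (intro sum_cong A.finsum_swap) auto
  also have "\<dots> = (\<Oplus>i\<in>{..<n}. \<Oplus>j\<in>{..<n}. ?p i \<otimes> (?q j \<otimes> E (U.ins F (xpow (i + j))) ps))"
    using ps by (auto simp: E_ins sum_rdistr intro!: sum_cong)
  also have "\<dots> = (\<Oplus>i\<in>{..<n}. ?p i \<otimes> (\<Oplus>j\<in>{..<n}. ?q j \<otimes> E (U.ins F (xpow (i + j))) ps))"
    using ps by (auto simp: sum_rdistr intro!: sum_cong)
  finally show ?thesis .
qed

lemma E_beta: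
  assumes "ps \<in> tuples" "p \<in> carrier A"
  shows "(\<Oplus>l\<in>{..<n}. \<iota> (coef l p) \<otimes> E (U.beta F (xpow l)) ps) = mid (E F) p ps"
  using assms
proof (induction ps arbitrary: p F rule: list.induct)
  case Nil
  have "(\<Oplus>l\<in>{..<n}. \<iota> (coef l p) \<otimes> E (U.beta F (xpow l)) [])
      = (\<Oplus>l\<in>{..<n}. \<iota> (coef l p) \<otimes> x [^] l) \<otimes> \<eta> (F [])"
    using Nil by (auto simp: sum_ldistr poly_monom ev.eval_mult \<eta>_y A.m_assoc intro!: sum_cong)
  also have "\<dots> = p \<otimes> \<eta> (F [])" using expansion[of p] Nil by simp
  finally show ?case using Nil by (simp add: ev.eval_central)
next
  case (Cons q ps)
  let ?e = "\<lambda>i j. E (U.ins F (xpow (i + j))) ps"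
    and ?b = "\<lambda>i j. E (U.beta (\<lambda>s. F (i # s)) (xpow j)) ps"
  have ps: "ps \<in> tuples" and p: "p \<in> carrier A" and q: "q \<in> carrier A" using Cons.prems by simp_all
  have [simp]: "?e i j \<in> carrier A" "?b i j \<in> carrier A" for i j using ps by simp_all
  have [simp]: "\<iota> (coef i p) \<in> carrier A" "\<iota> (coef i q) \<in> carrier A" if "i < n" for i
    using p q that by simp_all
  have mid: "mid (E (\<lambda>s. F (i # s))) q ps \<in> carrier A" for i
    using ps q by (intro mid_closed) auto
  have minus: "\<ominus> (\<Oplus>l\<in>{..<n}. g l) = (\<Oplus>l\<in>{..<n}. \<ominus> g l)" if "\<And>l. l < n \<Longrightarrow> g l \<in> carrier A" for g
    using that by (intro additive_finsum[OF A.abelian_monoid_axioms A.abelian_monoid_axioms])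
      (auto simp: A.minus_add)
  have sum_minus: "(\<Oplus>l\<in>{..<n}. g l \<ominus> h l) = (\<Oplus>l\<in>{..<n}. g l) \<ominus> (\<Oplus>l\<in>{..<n}. h l)"
    if "\<And>l. l < n \<Longrightarrow> g l \<in> carrier A" "\<And>l. l < n \<Longrightarrow> h l \<in> carrier A" for g h
    using that by (simp add: A.minus_eq minus sum_add)
  have distr: "a \<otimes> (b \<ominus> c) = a \<otimes> b \<ominus> a \<otimes> c"
    if "a \<in> carrier A" "b \<in> carrier A" "c \<in> carrier A" for a b c
    using that by (simp add: A.minus_eq A.r_distr A.r_minus)
  have "E (U.beta F (xpow i)) (q # ps)
      = (\<Oplus>j\<in>{..<n}. \<iota> (coef j q) \<otimes> ?e i j) \<ominus> mid (E (\<lambda>s. F (i # s))) q ps" if "i < n" for i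
  proof -
    have "E (U.beta F (xpow i)) (q # ps)
        = (\<Oplus>j\<in>{..<n}. \<iota> (coef j q) \<otimes> ?e i j \<ominus> \<iota> (coef j q) \<otimes> ?b i j)"
      using that ps by (auto simp: U.beta_xpow_Cons E_diff distr intro!: sum_cong)
    also have "\<dots> = (\<Oplus>j\<in>{..<n}. \<iota> (coef j q) \<otimes> ?e i j) \<ominus> (\<Oplus>j\<in>{..<n}. \<iota> (coef j q) \<otimes> ?b i j)"
      by (intro sum_minus) auto
    finally show ?thesis using Cons.IH[OF ps q] by simp
  qed
  then have "(\<Oplus>i\<in>{..<n}. \<iota> (coef i p) \<otimes> E (U.beta F (xpow i)) (q # ps))
      = (\<Oplus>i\<in>{..<n}. \<iota> (coef i p) \<otimes> (\<Oplus>j\<in>{..<n}. \<iota> (coef j q) \<otimes> ?e i j)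
          \<ominus> \<iota> (coef i p) \<otimes> mid (E (\<lambda>s. F (i # s))) q ps)"
    using mid by (intro sum_cong) (auto simp: distr simp del: E.simps)
  also have "\<dots> = (\<Oplus>i\<in>{..<n}. \<iota> (coef i p) \<otimes> (\<Oplus>j\<in>{..<n}. \<iota> (coef j q) \<otimes> ?e i j))
      \<ominus> (\<Oplus>i\<in>{..<n}. \<iota> (coef i p) \<otimes> mid (E (\<lambda>s. F (i # s))) q ps)"
    using mid by (intro sum_minus) auto
  also have "\<dots> = E F ((p \<otimes> q) # ps) \<ominus> mid (\<lambda>us. E F (p # us)) q ps"
    unfolding E_merge[OF ps p q] using ps p q by (subst mid_sum[symmetric]) auto
  finally show ?case by simp
qed

text \<open>
  In the last face the power of \<open>y\<close> turns into a factor from \<open>A\<close> on the right, since the values of \<open>F\<close> become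
  central in \<open>A\<close>.
\<close>

lemma E_cob:
  assumes "ps \<in> tuples" "p \<in> carrier A"
  shows "E (U.cob F) (p # ps) = p \<otimes> E F ps \<ominus> mid (E F) p ps"
proof -
  let ?b = "\<lambda>l. \<iota> (coef l p) \<otimes> E (U.beta F (xpow l)) ps"
  have minus: "\<ominus> (\<Oplus>l\<in>{..<n}. ?b l) = (\<Oplus>l\<in>{..<n}. \<ominus> ?b l)"
    using assms by (intro additive_finsum[OF A.abelian_monoid_axioms A.abelian_monoid_axioms])
      (auto simp: A.minus_add)
  have "E (U.cob F) (p # ps) = (\<Oplus>l\<in>{..<n}. \<iota> (coef l p) \<otimes> x [^] l \<otimes> E F ps \<oplus> \<ominus> ?b l)"
    unfolding E.simps U.cob.simps using assms
    by (intro sum_cong) (auto simp: E_diff E_scale \<eta>_y A.minus_eq A.r_distr A.r_minus A.m_assoc)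
  also have "\<dots> = (\<Oplus>l\<in>{..<n}. \<iota> (coef l p) \<otimes> x [^] l) \<otimes> E F ps \<oplus> \<ominus> (\<Oplus>l\<in>{..<n}. ?b l)"
    using assms by (simp add: sum_add minus sum_ldistr)
  finally show ?thesis
    using expansion[of p] assms by (simp add: E_beta A.minus_eq)
qed

end

section \<open>Quotients and free modules\<close>

lemma module_homI:
  assumes "\<And>a. a \<in> carrier M \<Longrightarrow> h a \<in> carrier N"
    and "\<And>a b. a \<in> carrier M \<Longrightarrow> b \<in> carrier M \<Longrightarrow> h (a \<oplus>\<^bsub>M\<^esub> b) = h a \<oplus>\<^bsub>N\<^esub> h b"
    and "\<And>c a. c \<in> carrier k \<Longrightarrow> a \<in> carrier M \<Longrightarrow> h (c \<odot>\<^bsub>M\<^esub> a) = c \<odot>\<^bsub>N\<^esub> h a"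
  shows "h \<in> Defs.module_hom k M N"
  using assms by (auto simp: Defs.module_hom_def)

lemma module_homD:
  assumes "h \<in> Defs.module_hom k M N"
  shows "a \<in> carrier M \<Longrightarrow> h a \<in> carrier N"
    and "a \<in> carrier M \<Longrightarrow> b \<in> carrier M \<Longrightarrow> h (a \<oplus>\<^bsub>M\<^esub> b) = h a \<oplus>\<^bsub>N\<^esub> h b"
    and "c \<in> carrier k \<Longrightarrow> a \<in> carrier M \<Longrightarrow> h (c \<odot>\<^bsub>M\<^esub> a) = c \<odot>\<^bsub>N\<^esub> h a"
  using assms by (auto simp: Defs.module_hom_def)

lemma module_hom_zero:
  assumes "h \<in> Defs.module_hom k M N" "Module.module k M" "Module.module k N"
  shows "h \<zero>\<^bsub>M\<^esub> = \<zero>\<^bsub>N\<^esub>"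
proof -
  interpret M: Module.module k M by fact
  interpret N: Module.module k N by fact
  show ?thesis
    using M.additive_zero[of h N] module_homD[OF assms(1)] N.abelian_group_axioms
    by (metis M.zero_closed)
qed

lemma module_hom_uminus:
  assumes h: "h \<in> Defs.module_hom k M N" and "Module.module k M" "Module.module k N" and a: "a \<in> carrier M"
  shows "h (\<ominus>\<^bsub>M\<^esub> a) = \<ominus>\<^bsub>N\<^esub> h a"
proof -
  interpret M: Module.module k M by fact
  interpret N: Module.module k N by fact
  have "h (\<ominus>\<^bsub>M\<^esub> a) \<oplus>\<^bsub>N\<^esub> h a = h (\<ominus>\<^bsub>M\<^esub> a \<oplus>\<^bsub>M\<^esub> a)"
    using a by (simp add: module_homD(2)[OF h] del: M.l_neg)
  then have "h (\<ominus>\<^bsub>M\<^esub> a) \<oplus>\<^bsub>N\<^esub> h a = \<zero>\<^bsub>N\<^esub>"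
    using a by (simp add: M.l_neg module_hom_zero[OF h assms(2,3)])
  then show ?thesis
    using a by (simp add: N.minus_equality module_homD(1)[OF h])
qed

lemma module_hom_minus:
  assumes h: "h \<in> Defs.module_hom k M N" and "Module.module k M" "Module.module k N" and "a \<in> carrier M" "b \<in> carrier M"
  shows "h (a \<ominus>\<^bsub>M\<^esub> b) = h a \<ominus>\<^bsub>N\<^esub> h b"
proof -
  interpret M: Module.module k M by fact
  interpret N: Module.module k N by fact
  show ?thesis
    using assms(4,5) by (simp add: M.minus_eq N.minus_eq module_homD(2)[OF h] module_hom_uminus[OF assms(1-3)])
qed

lemma module_hom_finsum:
  assumes h: "h \<in> Defs.module_hom k M N" and "Module.module k M" "Module.module k N"
    and "\<And>i. i \<in> S \<Longrightarrow> g i \<in> carrier M"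
  shows "h (\<Oplus>\<^bsub>M\<^esub>i\<in>S. g i) = (\<Oplus>\<^bsub>N\<^esub>i\<in>S. h (g i))"
proof -
  interpret M: Module.module k M by fact
  interpret N: Module.module k N by fact
  show ?thesis
    by (rule additive_finsum[OF M.abelian_monoid_axioms N.abelian_monoid_axioms])
      (auto simp: assms(4) module_homD[OF h] module_hom_zero[OF assms(1-3)])
qed

lemma module_hom_compose:
  assumes "h \<in> Defs.module_hom k L M" "g \<in> Defs.module_hom k M N"
  shows "(\<lambda>a. g (h a)) \<in> Defs.module_hom k L N"
  using assms by (auto simp: Defs.module_hom_def Pi_iff)

lemma module_hom_kernel:
  assumes h: "h \<in> Defs.module_hom k M N" and M: "Module.module k M" and N: "Module.module k N"
  shows "submodule {a \<in> carrier M. h a = \<zero>\<^bsub>N\<^esub>} k M"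
proof -
  interpret M: Module.module k M by fact
  interpret N: Module.module k N by fact
  show ?thesis
    by (rule M.submoduleI)
      (auto simp: module_homD[OF h] module_hom_zero[OF h M N] module_hom_uminus[OF h M N])
qed

lemma (in Module.module) submoduleI':
  assumes "H \<subseteq> carrier M" "\<zero>\<^bsub>M\<^esub> \<in> H"
    and "\<And>a b. a \<in> H \<Longrightarrow> b \<in> H \<Longrightarrow> a \<oplus>\<^bsub>M\<^esub> b \<in> H"
    and smult: "\<And>c a. c \<in> carrier R \<Longrightarrow> a \<in> H \<Longrightarrow> c \<odot>\<^bsub>M\<^esub> a \<in> H"
  shows "submodule H R M"
proof (rule submoduleI)
  fix a assume a: "a \<in> H"
  then have "(\<ominus> \<one>) \<odot>\<^bsub>M\<^esub> a \<in> H" by (intro smult) auto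
  then show "\<ominus>\<^bsub>M\<^esub> a \<in> H" using a assms(1) by (simp add: smult_l_minus subsetD)
qed (use assms in auto)

context Module.module
begin

lemma submodule_abelian_subgroup: "submodule N R M \<Longrightarrow> abelian_subgroup N M"
  using abelian_subgroupI2[OF a_comm_group] submodule.axioms(1) by blast

lemma span_submodule:
  assumes "S \<subseteq> carrier M"
  shows "submodule (module_span R M S) R M"
proof -
  have "submodule (carrier M) R M" by (rule carrier_is_submodule)
  then have sub: "module_span R M S \<subseteq> carrier M"
    using assms unfolding module_span_def by blast
  show ?thesis
  proof (rule submoduleI)
    show "module_span R M S \<subseteq> carrier M" by (rule sub)
  qed (auto simp: module_span_def submodule.axioms(1) subgroup.one_closed
      dest: submoduleE intro: submoduleE submodule.axioms(1)[THEN subgroup.one_closed, simplified])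
qed

lemma span_superset: "S \<subseteq> module_span R M S"
  by (auto simp: module_span_def)

lemma span_minimal: "submodule H R M \<Longrightarrow> S \<subseteq> H \<Longrightarrow> module_span R M S \<subseteq> H"
  by (auto simp: module_span_def)

end

locale module_quotient = Module.module R M for R :: "('k, 'c) ring_scheme" and M :: "('k, 'm, 'e) module_scheme" (structure) +
  fixes N :: "'m set"
  assumes sub: "submodule N R M"
begin

sublocale N: abelian_subgroup N M
  by (rule submodule_abelian_subgroup[OF sub])

abbreviation Q :: "('k, 'm set) module"
  where "Q \<equiv> quot_module M N"

lemma N_subset: "N \<subseteq> carrier M" and N_smult: "c \<in> carrier R \<Longrightarrow> a \<in> N \<Longrightarrow> c \<odot> a \<in> N"
  and N_add: "a \<in> N \<Longrightarrow> b \<in> N \<Longrightarrow> a \<oplus> b \<in> N" and N_neg: "a \<in> N \<Longrightarrow> \<ominus> a \<in> N" and N_zero: "\<zero> \<in> N"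
  using submoduleE[OF sub] by auto

lemma cos_eq_iff:
  assumes "a \<in> carrier M" "b \<in> carrier M"
  shows "N +> a = N +> b \<longleftrightarrow> a \<ominus> b \<in> N"
proof
  assume "N +> a = N +> b"
  then have "a \<in> N +> b" using N.a_rcos_self[OF assms(1)] by simp
  then obtain h where h: "h \<in> N" "a = h \<oplus> b" by (auto simp: a_r_coset_def')
  then have "a \<ominus> b = h"
    using assms N_subset by (simp add: minus_eq a_assoc r_neg subsetD)
  with h show "a \<ominus> b \<in> N" by simp
next
  assume *: "a \<ominus> b \<in> N"
  have "a = (a \<ominus> b) \<oplus> b"
    using assms by (simp add: minus_eq a_assoc l_neg)
  with * have "a \<in> N +> b" by (auto simp: a_r_coset_def')
  then show "N +> a = N +> b"
    using a_repr_independence[of a N b] assms N.a_subgroup by simp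
qed

lemma cos_zero_iff: "a \<in> carrier M \<Longrightarrow> N +> a = N \<longleftrightarrow> a \<in> N"
  using cos_eq_iff[of a \<zero>] N_subset minus_equality[of \<zero> \<zero>] by (simp add: minus_eq)

lemma carrier_Q: "carrier Q = {N +> a |a. a \<in> carrier M}"
  by (auto simp: quot_module_def A_RCOSETS_def')

lemma cos_closed [simp]: "a \<in> carrier M \<Longrightarrow> N +> a \<in> carrier Q"
  by (auto simp: carrier_Q)

lemma carrier_QE:
  assumes "X \<in> carrier Q" obtains a where "a \<in> carrier M" "X = N +> a"
  using assms by (auto simp: carrier_Q)

lemma zero_Q: "\<zero>\<^bsub>Q\<^esub> = N"
  by (simp add: quot_module_def)

lemma cos_zero [simp]: "N +> \<zero> = \<zero>\<^bsub>Q\<^esub>"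
  using N_subset by (simp add: zero_Q)

lemma cos_add: "a \<in> carrier M \<Longrightarrow> b \<in> carrier M \<Longrightarrow> (N +> a) \<oplus>\<^bsub>Q\<^esub> (N +> b) = N +> (a \<oplus> b)"
  by (simp add: quot_module_def N.a_rcos_sum)

lemma cos_smult:
  assumes "c \<in> carrier R" "a \<in> carrier M"
  shows "c \<odot>\<^bsub>Q\<^esub> (N +> a) = N +> (c \<odot> a)"
proof -
  have "N +> (c \<odot> m) = N +> (c \<odot> a)" if m: "m \<in> N +> a" for m
  proof -
    obtain h where h: "h \<in> N" "m = h \<oplus> a" using m by (auto simp: a_r_coset_def')
    then have hc: "h \<in> carrier M" using N_subset by auto
    have "c \<odot> m \<ominus> c \<odot> a = c \<odot> h"
      using assms h hc by (simp add: smult_r_distr minus_eq a_assoc r_neg)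
    then show ?thesis
      using assms h hc by (subst cos_eq_iff) (auto simp: N_smult)
  qed
  moreover have "a \<in> N +> a" using N.a_rcos_self assms by simp
  ultimately have "(\<Union>m\<in>N +> a. N +> (c \<odot> m)) = N +> (c \<odot> a)" by blast
  then show ?thesis by (simp add: quot_module_def)
qed

lemma module_Q: "Module.module R Q"
proof (rule moduleI)
  show "cring R" by (rule R.is_cring)
  show "abelian_group Q"
  proof (rule abelian_groupI)
    show "\<exists>Y\<in>carrier Q. Y \<oplus>\<^bsub>Q\<^esub> X = \<zero>\<^bsub>Q\<^esub>" if "X \<in> carrier Q" for X
    proof -
      obtain a where a: "a \<in> carrier M" "X = N +> a" using \<open>X \<in> carrier Q\<close> by (rule carrier_QE)
      then show ?thesis
        by (intro bexI[of _ "N +> (\<ominus> a)"]) (simp_all add: cos_add l_neg)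
    qed
    show "\<zero>\<^bsub>Q\<^esub> \<in> carrier Q" using cos_closed[OF zero_closed] by simp
    show "\<zero>\<^bsub>Q\<^esub> \<oplus>\<^bsub>Q\<^esub> X = X" if "X \<in> carrier Q" for X
    proof -
      obtain a where a: "a \<in> carrier M" "X = N +> a" using \<open>X \<in> carrier Q\<close> by (rule carrier_QE)
      then show ?thesis using cos_add[OF zero_closed, of a] by simp
    qed
  qed (auto elim!: carrier_QE simp: cos_add a_ac)
qed (auto elim!: carrier_QE simp: cos_add cos_smult smult_l_distr smult_r_distr smult_assoc1)

sublocale Q: Module.module R Q
  by (rule module_Q)

lemma cos_hom: "(\<lambda>a. N +> a) \<in> Defs.module_hom R M Q"
  by (rule module_homI) (simp_all add: cos_add cos_smult)

lemma cos_finsum: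
  "(\<And>i. i \<in> S \<Longrightarrow> g i \<in> carrier M) \<Longrightarrow> (\<Oplus>\<^bsub>Q\<^esub>i\<in>S. N +> g i) = N +> (\<Oplus>i\<in>S. g i)"
  by (rule module_hom_finsum[OF cos_hom module_axioms module_Q, symmetric])

lemma quotient_lift:
  assumes h: "h \<in> Defs.module_hom R M P" and P: "Module.module R P" and ker: "\<And>a. a \<in> N \<Longrightarrow> h a = \<zero>\<^bsub>P\<^esub>"
  obtains g where "g \<in> Defs.module_hom R Q P" "\<And>a. a \<in> carrier M \<Longrightarrow> g (N +> a) = h a"
proof
  interpret P: Module.module R P by fact
  let ?g = "\<lambda>X. h (SOME a. a \<in> X)"
  show g: "?g (N +> a) = h a" if a: "a \<in> carrier M" for a
  proof -
    have "(SOME b. b \<in> N +> a) \<in> N +> a"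
      using N.a_rcos_self[OF a] by (rule someI)
    then obtain m where m: "m \<in> N" "(SOME b. b \<in> N +> a) = m \<oplus> a" by (auto simp: a_r_coset_def')
    then show ?thesis
      using a N_subset by (simp add: module_homD[OF h] ker subsetD)
  qed
  show "?g \<in> Defs.module_hom R Q P"
  proof (rule module_homI)
    fix X Y assume "X \<in> carrier Q" "Y \<in> carrier Q"
    then show "?g (X \<oplus>\<^bsub>Q\<^esub> Y) = ?g X \<oplus>\<^bsub>P\<^esub> ?g Y"
      by (auto elim!: carrier_QE simp: cos_add g module_homD[OF h])
  qed (auto elim!: carrier_QE simp: cos_smult g module_homD[OF h])
qed

lemma first_isomorphism:
  assumes h: "h \<in> Defs.module_hom R M P" and P: "Module.module R P"
    and surj: "\<And>b. b \<in> carrier P \<Longrightarrow> \<exists>a\<in>carrier M. h a = b"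
    and ker: "\<And>a. a \<in> carrier M \<Longrightarrow> h a = \<zero>\<^bsub>P\<^esub> \<longleftrightarrow> a \<in> N"
  shows "module_isomorphic R Q P"
proof -
  interpret P: Module.module R P by fact
  have "\<And>a. a \<in> N \<Longrightarrow> h a = \<zero>\<^bsub>P\<^esub>" using ker N_subset by blast
  then obtain g where g: "g \<in> Defs.module_hom R Q P" "\<And>a. a \<in> carrier M \<Longrightarrow> g (N +> a) = h a"
    using quotient_lift[OF h P] by blast
  have "inj_on g (carrier Q)"
  proof (rule inj_onI)
    fix X Y assume XY: "X \<in> carrier Q" "Y \<in> carrier Q" "g X = g Y"
    obtain a b where ab: "a \<in> carrier M" "b \<in> carrier M" "X = N +> a" "Y = N +> b"
      using XY by (auto elim!: carrier_QE)
    then have "h (a \<ominus> b) = h a \<ominus>\<^bsub>P\<^esub> h b"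
      by (intro module_hom_minus[OF h module_axioms P])
    also have "\<dots> = \<zero>\<^bsub>P\<^esub>"
      using XY ab g(2) module_homD(1)[OF h] by (simp add: P.minus_eq P.r_neg)
    finally show "X = Y"
      using ab ker[of "a \<ominus> b"] by (simp add: cos_eq_iff)
  qed
  moreover have "g ` carrier Q = carrier P"
  proof
    show "carrier P \<subseteq> g ` carrier Q"
      using surj g(2) by (force simp: carrier_Q)
  qed (use module_homD(1)[OF g(1)] in auto)
  ultimately show ?thesis
    using g(1) unfolding module_isomorphic_def bij_betw_def by blast
qed

end

locale free_mod = cring k for k :: "('k, 'c) ring_scheme" (structure) + fixes X :: "'x set"
begin

abbreviation Fr :: "('k, 'x \<Rightarrow> 'k) module"
  where "Fr \<equiv> free_module k X"

lemma carrier_Fr: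
  "u \<in> carrier Fr \<longleftrightarrow> (\<forall>x. u x \<in> carrier k) \<and> (\<forall>x. x \<notin> X \<longrightarrow> u x = \<zero>) \<and> finite {x. u x \<noteq> \<zero>}"
  by (simp add: free_module_def)

lemma Fr_simps:
  "\<zero>\<^bsub>Fr\<^esub> = (\<lambda>x. \<zero>)" "u \<oplus>\<^bsub>Fr\<^esub> v = (\<lambda>x. u x \<oplus> v x)" "c \<odot>\<^bsub>Fr\<^esub> u = (\<lambda>x. c \<otimes> u x)"
  by (simp_all add: free_module_def)

lemma module_Fr: "Module.module k Fr"
proof (rule moduleI)
  show "cring k" by (rule is_cring)
  have fin_add: "finite {x. u x \<oplus> v x \<noteq> \<zero>}"
    if "finite {x. u x \<noteq> \<zero>}" "finite {x. v x \<noteq> \<zero>}" for u v :: "'x \<Rightarrow> 'k"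
    by (rule finite_subset[OF _ finite_UnI[OF that]]) auto
  show "abelian_group Fr"
  proof (rule abelian_groupI)
    fix u assume "u \<in> carrier Fr"
    moreover have "{x. \<ominus> (u x) \<noteq> \<zero>} \<subseteq> {x. u x \<noteq> \<zero>}" by auto
    ultimately have "(\<lambda>x. \<ominus> (u x)) \<in> carrier Fr"
      using finite_subset by (auto simp: carrier_Fr)
    then show "\<exists>v\<in>carrier Fr. v \<oplus>\<^bsub>Fr\<^esub> u = \<zero>\<^bsub>Fr\<^esub>"
      using \<open>u \<in> carrier Fr\<close>
      by (intro bexI[of _ "\<lambda>x. \<ominus> (u x)"]) (auto simp: Fr_simps carrier_Fr l_neg)
  qed (auto simp: carrier_Fr Fr_simps fin_add a_ac)
  have fin_smult: "finite {x. c \<otimes> u x \<noteq> \<zero>}" if "finite {x. u x \<noteq> \<zero>}" "c \<in> carrier k" for c u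
    by (rule finite_subset[OF _ that(1)]) (use that in auto)
  show "c \<odot>\<^bsub>Fr\<^esub> u \<in> carrier Fr" if "c \<in> carrier k" "u \<in> carrier Fr" for c u
    using that fin_smult by (auto simp: carrier_Fr Fr_simps)
qed (auto simp: carrier_Fr Fr_simps l_distr r_distr m_assoc)

sublocale Fr: Module.module k Fr
  by (rule module_Fr)

lemma free_gen_closed [simp]: "x \<in> X \<Longrightarrow> free_gen k x \<in> carrier Fr"
  by (auto simp: carrier_Fr free_gen_def)

lemma Fr_expand:
  assumes "u \<in> carrier Fr"
  shows "u = (\<Oplus>\<^bsub>Fr\<^esub>x\<in>{x. u x \<noteq> \<zero>}. u x \<odot>\<^bsub>Fr\<^esub> free_gen k x)"
proof -
  have eval: "(\<Oplus>\<^bsub>Fr\<^esub>x\<in>S. g x) y = (\<Oplus>x\<in>S. g x y)" if "\<And>x. x \<in> S \<Longrightarrow> g x \<in> carrier Fr" for S g y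
    using that
    by (intro additive_finsum[OF Fr.abelian_monoid_axioms abelian_monoid_axioms, where h = "\<lambda>u. u y"])
      (auto simp: Fr_simps carrier_Fr)
  have closed: "u x \<odot>\<^bsub>Fr\<^esub> free_gen k x \<in> carrier Fr" if "u x \<noteq> \<zero>" for x
    using that assms carrier_Fr[of u] by (intro Fr.smult_closed free_gen_closed) auto
  show ?thesis
  proof
    fix y
    have "(\<Oplus>\<^bsub>Fr\<^esub>x\<in>{x. u x \<noteq> \<zero>}. u x \<odot>\<^bsub>Fr\<^esub> free_gen k x) y
        = (\<Oplus>x\<in>{x. u x \<noteq> \<zero>}. if y = x then u x else \<zero>)"
      using closed assms by (subst eval) (auto simp: Fr_simps free_gen_def carrier_Fr intro!: finsum_cong')
    also have "\<dots> = u y"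
    proof (cases "u y = \<zero>")
      case True
      then have "(\<Oplus>x\<in>{x. u x \<noteq> \<zero>}. if y = x then u x else \<zero>) = (\<Oplus>x\<in>{x. u x \<noteq> \<zero>}. \<zero>)"
        by (intro finsum_cong') auto
      then show ?thesis using True by simp
    next
      case False
      then show ?thesis
        using assms finsum_singleton[of y "{x. u x \<noteq> \<zero>}" u] by (auto simp: carrier_Fr)
    qed
    finally show "u y = (\<Oplus>\<^bsub>Fr\<^esub>x\<in>{x. u x \<noteq> \<zero>}. u x \<odot>\<^bsub>Fr\<^esub> free_gen k x) y" by simp
  qed
qed

lemma free_lift:
  assumes P: "Module.module k P" and g: "\<And>x. x \<in> X \<Longrightarrow> g x \<in> carrier P"
  obtains h where "h \<in> Defs.module_hom k Fr P" "\<And>x. x \<in> X \<Longrightarrow> h (free_gen k x) = g x"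
proof
  interpret P: Module.module k P by fact
  let ?h = "\<lambda>u. \<Oplus>\<^bsub>P\<^esub>x\<in>{x. u x \<noteq> \<zero>}. u x \<odot>\<^bsub>P\<^esub> g x"
  have closed: "u x \<odot>\<^bsub>P\<^esub> g x \<in> carrier P" if "u \<in> carrier Fr" "x \<in> X" for u x
    using that g by (auto simp: carrier_Fr)
  have superset: "?h u = (\<Oplus>\<^bsub>P\<^esub>x\<in>S. u x \<odot>\<^bsub>P\<^esub> g x)"
    if "u \<in> carrier Fr" "finite S" "S \<subseteq> X" "{x. u x \<noteq> \<zero>} \<subseteq> S" for u S
    using that closed g
    by (intro P.add.finprod_mono_neutral_cong_left) (auto simp: subset_iff)
  show "?h (free_gen k x) = g x" if "x \<in> X" for x
  proof -
    have "?h (free_gen k x) = (\<Oplus>\<^bsub>P\<^esub>z\<in>{x}. free_gen k x z \<odot>\<^bsub>P\<^esub> g z)"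
      using that by (intro superset free_gen_closed) (auto simp: free_gen_def)
    moreover have "free_gen k x x = \<one>" by (simp add: free_gen_def)
    ultimately show ?thesis using that g by simp
  qed
  show "?h \<in> Defs.module_hom k Fr P"
  proof (rule module_homI)
    fix u assume u: "u \<in> carrier Fr"
    show "?h u \<in> carrier P" using u g by (intro P.finsum_closed) (auto simp: carrier_Fr)
  next
    fix u v assume u: "u \<in> carrier Fr" and v: "v \<in> carrier Fr"
    let ?S = "{x. u x \<noteq> \<zero>} \<union> {x. v x \<noteq> \<zero>}"
    have S: "finite ?S" "?S \<subseteq> X" using u v by (auto simp: carrier_Fr)
    have uv: "u \<oplus>\<^bsub>Fr\<^esub> v \<in> carrier Fr" using u v by simp
    have "?h (u \<oplus>\<^bsub>Fr\<^esub> v) = (\<Oplus>\<^bsub>P\<^esub>x\<in>?S. (u \<oplus>\<^bsub>Fr\<^esub> v) x \<odot>\<^bsub>P\<^esub> g x)"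
      using uv S by (intro superset) (auto simp: Fr_simps)
    also have "\<dots> = (\<Oplus>\<^bsub>P\<^esub>x\<in>?S. u x \<odot>\<^bsub>P\<^esub> g x \<oplus>\<^bsub>P\<^esub> v x \<odot>\<^bsub>P\<^esub> g x)"
      using u v S g
      by (intro P.finsum_cong') (auto simp: Fr_simps carrier_Fr P.smult_l_distr subset_iff)
    also have "\<dots> = (\<Oplus>\<^bsub>P\<^esub>x\<in>?S. u x \<odot>\<^bsub>P\<^esub> g x) \<oplus>\<^bsub>P\<^esub> (\<Oplus>\<^bsub>P\<^esub>x\<in>?S. v x \<odot>\<^bsub>P\<^esub> g x)"
      using u v S closed by (intro P.finsum_addf) blast+
    also have "\<dots> = ?h u \<oplus>\<^bsub>P\<^esub> ?h v"
      using u v S by (simp add: superset[of u ?S] superset[of v ?S])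
    finally show "?h (u \<oplus>\<^bsub>Fr\<^esub> v) = ?h u \<oplus>\<^bsub>P\<^esub> ?h v" .
  next
    fix c u assume c: "c \<in> carrier k" and u: "u \<in> carrier Fr"
    let ?S = "{x. u x \<noteq> \<zero>}"
    have S: "finite ?S" "?S \<subseteq> X" using u by (auto simp: carrier_Fr)
    have "?h (c \<odot>\<^bsub>Fr\<^esub> u) = (\<Oplus>\<^bsub>P\<^esub>x\<in>?S. (c \<odot>\<^bsub>Fr\<^esub> u) x \<odot>\<^bsub>P\<^esub> g x)"
      using c u S by (intro superset Fr.smult_closed) (auto simp: Fr_simps)
    also have "\<dots> = (\<Oplus>\<^bsub>P\<^esub>x\<in>?S. c \<odot>\<^bsub>P\<^esub> (u x \<odot>\<^bsub>P\<^esub> g x))"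
      using u c S g by (intro P.finsum_cong') (auto simp: Fr_simps carrier_Fr P.smult_assoc1 subset_iff)
    also have "\<dots> = c \<odot>\<^bsub>P\<^esub> ?h u"
      using u c S closed by (intro P.finsum_smult_ldistr[symmetric]) auto
    finally show "?h (c \<odot>\<^bsub>Fr\<^esub> u) = c \<odot>\<^bsub>P\<^esub> ?h u" .
  qed
qed

end

section \<open>Hochschild chains by generators and relations\<close>

context central_monogenic
begin

abbreviation Kimg :: "'b set"
  where "Kimg \<equiv> \<iota> ` carrier K"

lemma Kimg_submodule: "submodule Kimg k A"
proof (rule A.submoduleI)
  fix a assume "a \<in> Kimg"
  then obtain u where u: "u \<in> carrier K" "a = \<iota> u" by auto
  have "\<iota> (\<ominus>\<^bsub>K\<^esub> u) \<oplus> \<iota> u = \<iota> (\<ominus>\<^bsub>K\<^esub> u \<oplus>\<^bsub>K\<^esub> u)" using u by (simp add: \<iota>_add del: K.l_neg)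
  also have "\<dots> = \<zero>" using u by (simp add: K.l_neg)
  finally have "\<ominus> a = \<iota> (\<ominus>\<^bsub>K\<^esub> u)" using u by (simp add: A.minus_equality)
  then show "\<ominus> a \<in> Kimg" using u by auto
next
  fix a b assume "a \<in> Kimg" "b \<in> Kimg"
  then show "a \<oplus> b \<in> Kimg" by (auto simp: \<iota>_add[symmetric])
next
  fix c a assume "c \<in> carrier k" "a \<in> Kimg"
  then show "c \<odot> a \<in> Kimg" by (auto simp: \<iota>_smult[symmetric])
next
  show "\<zero> \<in> Kimg" using \<iota>_zero by (metis K.zero_closed imageI)
qed auto

sublocale B: module_quotient k A Kimg
  by (simp add: module_quotient_def module_quotient_axioms_def A.module_axioms Kimg_submodule)

abbreviation bar :: "'b \<Rightarrow> 'b set"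
  where "bar a \<equiv> Kimg +> a"

abbreviation Reg :: "('k, 'l, 'b) bimodule"
  where "Reg \<equiv> regular_bimodule A \<iota>"

abbreviation Red :: "('k, 'l, 'b set) bimodule"
  where "Red \<equiv> reduced_bimodule K A \<iota>"

lemma Reg_simps:
  "carrier Reg = carrier A" "a \<oplus>\<^bsub>Reg\<^esub> b = a \<oplus> b" "c \<odot>\<^bsub>Reg\<^esub> a = c \<odot> a"
  "lact Reg u a = \<iota> u \<otimes> a" "ract Reg a u = a \<otimes> \<iota> u"
  by (simp_all add: regular_bimodule_def)

lemma quot_module_Reg: "quot_module Reg Kimg = B.Q"
  by (simp add: quot_module_def A_RCOSETS_def' a_r_coset_def' set_add_def' Reg_simps fun_eq_iff
      regular_bimodule_def)

lemma Red_simps: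
  "carrier Red = carrier B.Q" "X \<oplus>\<^bsub>Red\<^esub> Y = X \<oplus>\<^bsub>B.Q\<^esub> Y" "c \<odot>\<^bsub>Red\<^esub> X = c \<odot>\<^bsub>B.Q\<^esub> X"
  by (simp_all add: reduced_bimodule_def quot_bimodule_def module.defs quot_module_Reg)

lemma Red_acts:
  assumes "u \<in> carrier K" "p \<in> carrier A"
  shows "lact Red u (bar p) = bar (\<iota> u \<otimes> p)" "ract Red (bar p) u = bar (p \<otimes> \<iota> u)"
proof -
  have mem: "p \<in> bar p" using assms by (intro B.N.a_rcos_self)
  have "bar (\<iota> u \<otimes> q) = bar (\<iota> u \<otimes> p)" "bar (q \<otimes> \<iota> u) = bar (p \<otimes> \<iota> u)" if q: "q \<in> bar p" for q
  proof -
    obtain v where v: "v \<in> carrier K" "q = \<iota> v \<oplus> p" using q by (auto simp: a_r_coset_def')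
    have "\<iota> u \<otimes> q \<ominus> \<iota> u \<otimes> p = \<iota> (u \<otimes>\<^bsub>K\<^esub> v)" "q \<otimes> \<iota> u \<ominus> p \<otimes> \<iota> u = \<iota> (v \<otimes>\<^bsub>K\<^esub> u)"
      using assms v
      by (simp_all add: \<iota>_mult A.r_distr A.l_distr A.minus_eq A.a_assoc A.r_neg)
    then show "bar (\<iota> u \<otimes> q) = bar (\<iota> u \<otimes> p)" "bar (q \<otimes> \<iota> u) = bar (p \<otimes> \<iota> u)"
      using assms v by (auto simp: B.cos_eq_iff)
  qed
  then have "(\<Union>q\<in>bar p. bar (\<iota> u \<otimes> q)) = bar (\<iota> u \<otimes> p)" "(\<Union>q\<in>bar p. bar (q \<otimes> \<iota> u)) = bar (p \<otimes> \<iota> u)"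
    using mem by blast+
  then show "lact Red u (bar p) = bar (\<iota> u \<otimes> p)" "ract Red (bar p) u = bar (p \<otimes> \<iota> u)"
    by (simp_all add: reduced_bimodule_def quot_bimodule_def module.defs Reg_simps a_r_coset_def')
qed

abbreviation gens :: "nat \<Rightarrow> ('b \<times> 'b set list) set"
  where "gens r \<equiv> tensor_gens Reg Red r"

lemma gens_iff:
  "(a, Ps) \<in> gens r \<longleftrightarrow> a \<in> carrier A \<and> (\<exists>ps\<in>tuples. length ps = r \<and> Ps = map bar ps)"
proof -
  have "Ps \<in> lists (carrier B.Q) \<longleftrightarrow> (\<exists>ps\<in>tuples. Ps = map bar ps)"
  proof
    assume "Ps \<in> lists (carrier B.Q)"
    then show "\<exists>ps\<in>tuples. Ps = map bar ps"
    proof (induction Ps rule: list.induct)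
      case (Cons P Ps)
      then obtain p ps where "p \<in> carrier A" "P = bar p" "ps \<in> tuples" "Ps = map bar ps"
        by (auto simp: B.carrier_Q)
      then show ?case by (intro bexI[of _ "p # ps"]) auto
    qed auto
  qed (auto simp: in_lists_conv_set)
  then show ?thesis by (auto simp: tensor_gens_def Reg_simps Red_simps)
qed

sublocale F: free_mod k "gens r" for r
  using A.module_axioms by (simp add: free_mod_def Module.module_def)

abbreviation Rel :: "nat \<Rightarrow> ('b \<times> 'b set list \<Rightarrow> 'k) set"
  where "Rel r \<equiv> cyclic_tensor_relations k K Reg Red r"

abbreviation Chains :: "nat \<Rightarrow> ('k, ('b \<times> 'b set list \<Rightarrow> 'k) set) module"
  where "Chains r \<equiv> hoch_chains k K A \<iota> r"

definition pure :: "'b \<Rightarrow> 'b list \<Rightarrow> ('b \<times> 'b set list \<Rightarrow> 'k) set"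
  where "pure a ps = hoch_pure k K A \<iota> (a, ps)"

lemma gensI: "a \<in> carrier A \<Longrightarrow> ps \<in> tuples \<Longrightarrow> length ps = r \<Longrightarrow> (a, map bar ps) \<in> gens r"
  unfolding gens_iff by blast

lemma relations_closed:
  "tensor_relations k K Reg Red r \<union> cyclic_relations k K Reg Red r \<subseteq> carrier (F.Fr r)"
proof
  have closed: "\<And>a. a \<in> gens r \<Longrightarrow> free_gen k a \<in> carrier (F.Fr r)" by simp
  fix z assume "z \<in> tensor_relations k K Reg Red r \<union> cyclic_relations k K Reg Red r"
  then show "z \<in> carrier (F.Fr r)"
  proof
    assume "z \<in> tensor_relations k K Reg Red r"
    then show ?thesis
    proof cases
      case (add_head m ns m')
      then have "(m \<oplus>\<^bsub>Reg\<^esub> m', ns) \<in> gens r" by (auto simp: gens_iff Reg_simps)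
      then show ?thesis using add_head by simp
    next
      case (smult_head c m ns)
      then have "(c \<odot>\<^bsub>Reg\<^esub> m, ns) \<in> gens r" by (auto simp: gens_iff Reg_simps)
      then show ?thesis using smult_head by simp
    next
      case (add_tail m us N vs N')
      then have "(m, us @ (N \<oplus>\<^bsub>Red\<^esub> N') # vs) \<in> gens r"
        by (auto simp: tensor_gens_def Red_simps)
      then show ?thesis using add_tail by simp
    next
      case (smult_tail c m us N vs)
      then have "(m, us @ (c \<odot>\<^bsub>Red\<^esub> N) # vs) \<in> gens r"
        by (auto simp: tensor_gens_def Red_simps)
      then show ?thesis using smult_tail by simp
    next
      case (balanced_head l m N vs)
      then have "(ract Reg m l, N # vs) \<in> gens r" "(m, lact Red l N # vs) \<in> gens r"
        by (auto simp: tensor_gens_def Red_simps Reg_simps B.carrier_Q Red_acts)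
      then show ?thesis using balanced_head by simp
    next
      case (balanced_tail l m us N N' vs)
      then have "(m, us @ ract Red N l # N' # vs) \<in> gens r" "(m, us @ N # lact Red l N' # vs) \<in> gens r"
        by (auto simp: tensor_gens_def Red_simps Reg_simps B.carrier_Q Red_acts)
      then show ?thesis using balanced_tail by simp
    qed
  next
    assume "z \<in> cyclic_relations k K Reg Red r"
    then obtain a Ps l where z: "(a, Ps) \<in> gens r" "l \<in> carrier K"
      "z = free_gen k (tensor_ract Reg Red (a, Ps) l) \<ominus>\<^bsub>F.Fr r\<^esub> free_gen k (tensor_lact Reg l (a, Ps))"
      by (auto simp: cyclic_relations_def)
    then obtain ps where ps: "a \<in> carrier A" "ps \<in> tuples" "length ps = r" "Ps = map bar ps"
      by (auto simp: gens_iff)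
    have "tensor_lact Reg l (a, Ps) \<in> gens r"
      using z ps by (auto simp: Reg_simps intro!: gensI)
    moreover have "tensor_ract Reg Red (a, Ps) l \<in> gens r"
    proof (cases ps rule: rev_cases)
      case (snoc qs q)
      then show ?thesis
        using z ps gensI[of a "qs @ [q \<otimes> \<iota> l]" r] by (auto simp: Red_acts)
    qed (use z ps in \<open>auto simp: Reg_simps gens_iff\<close>)
    ultimately show ?thesis using z by simp
  qed
qed

lemma Rel_submodule: "submodule (Rel r) k (F.Fr r)"
  unfolding cyclic_tensor_relations_def by (rule F.Fr.span_submodule[OF relations_closed])

sublocale C: module_quotient k "F.Fr r" "Rel r" for r
  by (simp add: module_quotient_def module_quotient_axioms_def F.module_Fr Rel_submodule)

lemma Chains_eq: "Chains r = C.Q r"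
  by (simp add: hoch_chains_def cyclic_tensor_def)

lemma pure_eq: "pure a ps = Rel (length ps) +>\<^bsub>F.Fr (length ps)\<^esub> free_gen k (a, map bar ps)"
  by (simp add: pure_def hoch_pure_def)

lemma module_Chains: "Module.module k (Chains r)"
  unfolding Chains_eq by (rule C.module_Q)

sublocale Ch: Module.module k "Chains r" for r
  by (rule module_Chains)

text \<open>
  The defining relations of the chains, stated for functions on tuples of elements of \<open>A\<close>. Those that
  involve \<open>K\<close> are collected in \<open>balanced\<close>; the last of them makes such a function factor through \<open>A/K\<close> in
  all arguments but the first.
\<close>

definition multilinear ::
  "nat \<Rightarrow> ('k, 'n, 'f) module_scheme \<Rightarrow> ('b \<Rightarrow> 'b list \<Rightarrow> 'n) \<Rightarrow> bool"
  where "multilinear r P g \<longleftrightarrow>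
    (\<forall>a\<in>carrier A. \<forall>ps\<in>tuples. length ps = r \<longrightarrow> g a ps \<in> carrier P) \<and>
    (\<forall>a\<in>carrier A. \<forall>a'\<in>carrier A. \<forall>ps\<in>tuples. length ps = r \<longrightarrow>
      g (a \<oplus> a') ps = g a ps \<oplus>\<^bsub>P\<^esub> g a' ps) \<and>
    (\<forall>c\<in>carrier k. \<forall>a\<in>carrier A. \<forall>ps\<in>tuples. length ps = r \<longrightarrow> g (c \<odot> a) ps = c \<odot>\<^bsub>P\<^esub> g a ps) \<and>
    (\<forall>a\<in>carrier A. \<forall>us\<in>tuples. \<forall>vs\<in>tuples. \<forall>p\<in>carrier A. \<forall>q\<in>carrier A.
      Suc (length us + length vs) = r \<longrightarrow>
      g a (us @ (p \<oplus> q) # vs) = g a (us @ p # vs) \<oplus>\<^bsub>P\<^esub> g a (us @ q # vs)) \<and>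
    (\<forall>a\<in>carrier A. \<forall>us\<in>tuples. \<forall>vs\<in>tuples. \<forall>p\<in>carrier A. \<forall>c\<in>carrier k.
      Suc (length us + length vs) = r \<longrightarrow> g a (us @ (c \<odot> p) # vs) = c \<odot>\<^bsub>P\<^esub> g a (us @ p # vs))"

definition balanced :: "nat \<Rightarrow> ('k, 'n, 'f) module_scheme \<Rightarrow> ('b \<Rightarrow> 'b list \<Rightarrow> 'n) \<Rightarrow> bool"
  where "balanced r P g \<longleftrightarrow>
    (\<forall>a\<in>carrier A. \<forall>vs\<in>tuples. \<forall>p\<in>carrier A. \<forall>u\<in>carrier K.
      Suc (length vs) = r \<longrightarrow> g (a \<otimes> \<iota> u) (p # vs) = g a ((\<iota> u \<otimes> p) # vs)) \<and>
    (\<forall>a\<in>carrier A. \<forall>us\<in>tuples. \<forall>vs\<in>tuples. \<forall>p\<in>carrier A. \<forall>q\<in>carrier A. \<forall>u\<in>carrier K.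
      Suc (Suc (length us + length vs)) = r \<longrightarrow>
      g a (us @ (p \<otimes> \<iota> u) # q # vs) = g a (us @ p # (\<iota> u \<otimes> q) # vs)) \<and>
    (\<forall>a\<in>carrier A. \<forall>u\<in>carrier K. r = 0 \<longrightarrow> g (a \<otimes> \<iota> u) [] = g (\<iota> u \<otimes> a) []) \<and>
    (\<forall>a\<in>carrier A. \<forall>us\<in>tuples. \<forall>p\<in>carrier A. \<forall>u\<in>carrier K.
      Suc (length us) = r \<longrightarrow> g a (us @ [p \<otimes> \<iota> u]) = g (\<iota> u \<otimes> a) (us @ [p])) \<and>
    (\<forall>a\<in>carrier A. \<forall>us\<in>tuples. \<forall>vs\<in>tuples. \<forall>u\<in>carrier K.
      Suc (length us + length vs) = r \<longrightarrow> g a (us @ \<iota> u # vs) = \<zero>\<^bsub>P\<^esub>)"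

lemma multilinearD:
  assumes "multilinear r P g"
  shows "a \<in> carrier A \<Longrightarrow> ps \<in> tuples \<Longrightarrow> length ps = r \<Longrightarrow> g a ps \<in> carrier P"
    and "a \<in> carrier A \<Longrightarrow> a' \<in> carrier A \<Longrightarrow> ps \<in> tuples \<Longrightarrow> length ps = r \<Longrightarrow>
      g (a \<oplus> a') ps = g a ps \<oplus>\<^bsub>P\<^esub> g a' ps"
    and "c \<in> carrier k \<Longrightarrow> a \<in> carrier A \<Longrightarrow> ps \<in> tuples \<Longrightarrow> length ps = r \<Longrightarrow>
      g (c \<odot> a) ps = c \<odot>\<^bsub>P\<^esub> g a ps"
    and "a \<in> carrier A \<Longrightarrow> us \<in> tuples \<Longrightarrow> vs \<in> tuples \<Longrightarrow> p \<in> carrier A \<Longrightarrow> q \<in> carrier A \<Longrightarrow>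
      Suc (length us + length vs) = r \<Longrightarrow>
      g a (us @ (p \<oplus> q) # vs) = g a (us @ p # vs) \<oplus>\<^bsub>P\<^esub> g a (us @ q # vs)"
    and "a \<in> carrier A \<Longrightarrow> us \<in> tuples \<Longrightarrow> vs \<in> tuples \<Longrightarrow> p \<in> carrier A \<Longrightarrow> c \<in> carrier k \<Longrightarrow>
      Suc (length us + length vs) = r \<Longrightarrow> g a (us @ (c \<odot> p) # vs) = c \<odot>\<^bsub>P\<^esub> g a (us @ p # vs)"
  using assms unfolding multilinear_def by blast+

lemma balancedD:
  assumes "balanced r P g"
  shows "a \<in> carrier A \<Longrightarrow> vs \<in> tuples \<Longrightarrow> p \<in> carrier A \<Longrightarrow> u \<in> carrier K \<Longrightarrow>
      Suc (length vs) = r \<Longrightarrow> g (a \<otimes> \<iota> u) (p # vs) = g a ((\<iota> u \<otimes> p) # vs)"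
    and "a \<in> carrier A \<Longrightarrow> us \<in> tuples \<Longrightarrow> vs \<in> tuples \<Longrightarrow> p \<in> carrier A \<Longrightarrow> q \<in> carrier A \<Longrightarrow> u \<in> carrier K \<Longrightarrow>
      Suc (Suc (length us + length vs)) = r \<Longrightarrow>
      g a (us @ (p \<otimes> \<iota> u) # q # vs) = g a (us @ p # (\<iota> u \<otimes> q) # vs)"
    and "a \<in> carrier A \<Longrightarrow> u \<in> carrier K \<Longrightarrow> r = 0 \<Longrightarrow> g (a \<otimes> \<iota> u) [] = g (\<iota> u \<otimes> a) []"
    and "a \<in> carrier A \<Longrightarrow> us \<in> tuples \<Longrightarrow> p \<in> carrier A \<Longrightarrow> u \<in> carrier K \<Longrightarrow>
      Suc (length us) = r \<Longrightarrow> g a (us @ [p \<otimes> \<iota> u]) = g (\<iota> u \<otimes> a) (us @ [p])"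
    and "a \<in> carrier A \<Longrightarrow> us \<in> tuples \<Longrightarrow> vs \<in> tuples \<Longrightarrow> u \<in> carrier K \<Longrightarrow>
      Suc (length us + length vs) = r \<Longrightarrow> g a (us @ \<iota> u # vs) = \<zero>\<^bsub>P\<^esub>"
  using assms unfolding balanced_def by blast+

lemma gen_closed:
  "a \<in> carrier A \<Longrightarrow> ps \<in> tuples \<Longrightarrow> length ps = r \<Longrightarrow> free_gen k (a, map bar ps) \<in> carrier (F.Fr r)"
  by (intro F.free_gen_closed gensI)

lemma relI:
  "z \<in> tensor_relations k K Reg Red r \<Longrightarrow> z \<in> Rel r"
  "z \<in> cyclic_relations k K Reg Red r \<Longrightarrow> z \<in> Rel r"
  unfolding cyclic_tensor_relations_def using F.Fr.span_superset by blast+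

lemma multilinear_pure: "multilinear r (Chains r) pure"
  unfolding multilinear_def
proof (intro conjI ballI impI)
  fix a ps assume "a \<in> carrier A" "ps \<in> tuples" "length ps = r"
  then show "pure a ps \<in> carrier (Chains r)"
    using gen_closed[of a ps r] by (auto simp: pure_eq Chains_eq)
next
  fix a a' ps assume *: "a \<in> carrier A" "a' \<in> carrier A" "ps \<in> tuples" "length ps = r"
  have "free_gen k (a \<oplus>\<^bsub>Reg\<^esub> a', map bar ps)
      \<ominus>\<^bsub>F.Fr r\<^esub> (free_gen k (a, map bar ps) \<oplus>\<^bsub>F.Fr r\<^esub> free_gen k (a', map bar ps)) \<in> Rel r"
    using * by (intro relI(1) tensor_relations.add_head gensI)
  with * show "pure (a \<oplus> a') ps = pure a ps \<oplus>\<^bsub>Chains r\<^esub> pure a' ps"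
    by (simp add: pure_eq Chains_eq C.cos_add gen_closed C.cos_eq_iff Reg_simps)
next
  fix c a ps assume *: "c \<in> carrier k" "a \<in> carrier A" "ps \<in> tuples" "length ps = r"
  have "free_gen k (c \<odot>\<^bsub>Reg\<^esub> a, map bar ps)
      \<ominus>\<^bsub>F.Fr r\<^esub> c \<odot>\<^bsub>F.Fr r\<^esub> free_gen k (a, map bar ps) \<in> Rel r"
    using * by (intro relI(1) tensor_relations.smult_head gensI)
  with * show "pure (c \<odot> a) ps = c \<odot>\<^bsub>Chains r\<^esub> pure a ps"
    by (simp add: pure_eq Chains_eq C.cos_smult gen_closed C.cos_eq_iff Reg_simps)
next
  fix a us vs p q
  assume *: "a \<in> carrier A" "us \<in> tuples" "vs \<in> tuples" "p \<in> carrier A" "q \<in> carrier A"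
    and r: "Suc (length us + length vs) = r"
  have "free_gen k (a, map bar us @ (bar p \<oplus>\<^bsub>Red\<^esub> bar q) # map bar vs)
      \<ominus>\<^bsub>F.Fr r\<^esub> (free_gen k (a, map bar us @ bar p # map bar vs)
        \<oplus>\<^bsub>F.Fr r\<^esub> free_gen k (a, map bar us @ bar q # map bar vs)) \<in> Rel r"
    using * r gensI[of a "us @ p # vs" r] gensI[of a "us @ q # vs" r]
    by (intro relI(1) tensor_relations.add_tail) simp_all
  with * r show "pure a (us @ (p \<oplus> q) # vs) = pure a (us @ p # vs) \<oplus>\<^bsub>Chains r\<^esub> pure a (us @ q # vs)"
    using gen_closed[of a "us @ p # vs" r] gen_closed[of a "us @ q # vs" r]
      gen_closed[of a "us @ (p \<oplus> q) # vs" r]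
    by (simp add: pure_eq Chains_eq C.cos_add C.cos_eq_iff Red_simps B.cos_add)
next
  fix a us vs p c
  assume *: "a \<in> carrier A" "us \<in> tuples" "vs \<in> tuples" "p \<in> carrier A" "c \<in> carrier k"
    and r: "Suc (length us + length vs) = r"
  have "free_gen k (a, map bar us @ (c \<odot>\<^bsub>Red\<^esub> bar p) # map bar vs)
      \<ominus>\<^bsub>F.Fr r\<^esub> c \<odot>\<^bsub>F.Fr r\<^esub> free_gen k (a, map bar us @ bar p # map bar vs) \<in> Rel r"
    using * r gensI[of a "us @ p # vs" r]
    by (intro relI(1) tensor_relations.smult_tail) simp_all
  with * r show "pure a (us @ (c \<odot> p) # vs) = c \<odot>\<^bsub>Chains r\<^esub> pure a (us @ p # vs)"
    using gen_closed[of a "us @ p # vs" r] gen_closed[of a "us @ (c \<odot> p) # vs" r]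
    by (simp add: pure_eq Chains_eq C.cos_smult C.cos_eq_iff Red_simps B.cos_smult)
qed

lemma balanced_pure: "balanced r (Chains r) pure"
  unfolding balanced_def
proof (intro conjI ballI impI)
  fix a vs p u
  assume *: "a \<in> carrier A" "vs \<in> tuples" "p \<in> carrier A" "u \<in> carrier K" and r: "Suc (length vs) = r"
  have "free_gen k (ract Reg a u, bar p # map bar vs)
      \<ominus>\<^bsub>F.Fr r\<^esub> free_gen k (a, lact Red u (bar p) # map bar vs) \<in> Rel r"
    using * r gensI[of a "p # vs" r]
    by (intro relI(1) tensor_relations.balanced_head) simp_all
  with * r show "pure (a \<otimes> \<iota> u) (p # vs) = pure a ((\<iota> u \<otimes> p) # vs)"
    using gen_closed[of "a \<otimes> \<iota> u" "p # vs" r] gen_closed[of a "(\<iota> u \<otimes> p) # vs" r]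
    by (simp add: pure_eq C.cos_eq_iff Reg_simps Red_acts)
next
  fix a us vs p q u
  assume *: "a \<in> carrier A" "us \<in> tuples" "vs \<in> tuples" "p \<in> carrier A" "q \<in> carrier A" "u \<in> carrier K"
    and r: "Suc (Suc (length us + length vs)) = r"
  have "free_gen k (a, map bar us @ ract Red (bar p) u # bar q # map bar vs)
      \<ominus>\<^bsub>F.Fr r\<^esub> free_gen k (a, map bar us @ bar p # lact Red u (bar q) # map bar vs) \<in> Rel r"
    using * r gensI[of a "us @ p # q # vs" r]
    by (intro relI(1) tensor_relations.balanced_tail) simp_all
  with * r show "pure a (us @ (p \<otimes> \<iota> u) # q # vs) = pure a (us @ p # (\<iota> u \<otimes> q) # vs)"
    using gen_closed[of a "us @ (p \<otimes> \<iota> u) # q # vs" r] gen_closed[of a "us @ p # (\<iota> u \<otimes> q) # vs" r]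
    by (simp add: pure_eq C.cos_eq_iff Red_acts)
next
  fix a u assume *: "a \<in> carrier A" "u \<in> carrier K" and r: "r = 0"
  have "free_gen k (tensor_ract Reg Red (a, []) u) \<ominus>\<^bsub>F.Fr 0\<^esub> free_gen k (tensor_lact Reg u (a, [])) \<in> Rel 0"
    using * gensI[of a "[]" 0] by (intro relI(2)) (auto simp: cyclic_relations_def)
  with * show "pure (a \<otimes> \<iota> u) [] = pure (\<iota> u \<otimes> a) []"
    using gen_closed[of "a \<otimes> \<iota> u" "[]" 0] gen_closed[of "\<iota> u \<otimes> a" "[]" 0]
    by (simp add: pure_eq C.cos_eq_iff Reg_simps)
next
  fix a us p u
  assume *: "a \<in> carrier A" "us \<in> tuples" "p \<in> carrier A" "u \<in> carrier K" and r: "Suc (length us) = r"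
  let ?t = "(a, map bar us @ [bar p])"
  have "?t \<in> gens r" using * r gensI[of a "us @ [p]" r] by simp
  then have "free_gen k (tensor_ract Reg Red ?t u) \<ominus>\<^bsub>F.Fr r\<^esub> free_gen k (tensor_lact Reg u ?t) \<in> Rel r"
    using * unfolding cyclic_relations_def by (intro relI(2)) (unfold cyclic_relations_def, blast)
  with * r show "pure a (us @ [p \<otimes> \<iota> u]) = pure (\<iota> u \<otimes> a) (us @ [p])"
    using gen_closed[of a "us @ [p \<otimes> \<iota> u]" r] gen_closed[of "\<iota> u \<otimes> a" "us @ [p]" r]
    by (simp add: pure_eq C.cos_eq_iff Reg_simps Red_acts)
next
  fix a us vs u
  assume *: "a \<in> carrier A" "us \<in> tuples" "vs \<in> tuples" "u \<in> carrier K"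
    and r: "Suc (length us + length vs) = r"
  have zero: "bar (\<iota> u) = bar \<zero>"
    using * by (subst B.cos_eq_iff) (auto simp: A.minus_eq A.minus_equality[of \<zero> \<zero>])
  have "pure a (us @ \<iota> u # vs) = pure a (us @ \<zero> # vs)"
    using zero by (simp add: pure_eq)
  also have "\<dots> = pure a (us @ (\<zero>\<^bsub>k\<^esub> \<odot> \<zero>) # vs)" by simp
  also have "\<dots> = \<zero>\<^bsub>k\<^esub> \<odot>\<^bsub>Chains r\<^esub> pure a (us @ \<zero> # vs)"
    using * r by (intro multilinearD(5)[OF multilinear_pure]) auto
  also have "\<dots> = \<zero>\<^bsub>Chains r\<^esub>"
    using * r multilinearD(1)[OF multilinear_pure, of a "us @ \<zero> # vs" r]
    by (intro Ch.smult_l_null) simp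
  finally show "pure a (us @ \<iota> u # vs) = \<zero>\<^bsub>Chains r\<^esub>" .
qed

section \<open>The universal property of the chains\<close>

text \<open>
  Only the classes modulo \<open>K\<close> of the arguments behind the first one matter.
\<close>

lemma mod_const:
  assumes g: "multilinear r P g" "balanced r P g" and P: "Module.module k P"
    and "a \<in> carrier A" "us \<in> tuples" "vs \<in> tuples" "p \<in> carrier A" "q \<in> carrier A"
    and r: "Suc (length us + length vs) = r" and "bar p = bar q"
  shows "g a (us @ p # vs) = g a (us @ q # vs)"
proof -
  interpret P: Module.module k P by fact
  obtain u where u: "u \<in> carrier K" "p \<ominus> q = \<iota> u"
    using assms B.cos_eq_iff[of p q] by auto
  have "p = (p \<ominus> q) \<oplus> q"
    using assms by (simp add: A.minus_eq A.a_assoc A.l_neg)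
  then have "g a (us @ p # vs) = g a (us @ (\<iota> u \<oplus> q) # vs)" using u by simp
  also have "\<dots> = g a (us @ \<iota> u # vs) \<oplus>\<^bsub>P\<^esub> g a (us @ q # vs)"
    using assms u by (intro multilinearD(4)[OF g(1)]) auto
  also have "\<dots> = g a (us @ q # vs)"
    using assms u multilinearD(1)[OF g(1), of a "us @ q # vs"] balancedD(5)[OF g(2), of a us vs u]
    by simp
  finally show ?thesis .
qed

lemma mod_const_list:
  assumes g: "multilinear r P g" "balanced r P g" and P: "Module.module k P" and a: "a \<in> carrier A"
    and "us \<in> tuples" "ps \<in> tuples" "qs \<in> tuples" "length us + length ps = r" "map bar ps = map bar qs"
  shows "g a (us @ ps) = g a (us @ qs)"
  using assms(5-)
proof (induction ps arbitrary: us qs rule: list.induct)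
  case (Cons p ps)
  then obtain q qs' where qs: "qs = q # qs'" "bar p = bar q" "map bar ps = map bar qs'" by auto
  have "g a (us @ p # ps) = g a (us @ q # ps)"
    using Cons.prems qs by (intro mod_const[OF g P a]) auto
  also have "\<dots> = g a ((us @ [q]) @ ps)" by simp
  also have "\<dots> = g a ((us @ [q]) @ qs')"
    using Cons.prems qs by (intro Cons.IH) auto
  finally show ?case using qs by simp
qed auto

lemma gens_splitE:
  assumes "(m, us @ N # vs) \<in> gens r"
  obtains us' p vs' where "us' \<in> tuples" "p \<in> carrier A" "vs' \<in> tuples"
    "us = map bar us'" "N = bar p" "vs = map bar vs'" "m \<in> carrier A" "Suc (length us' + length vs') = r"
  using assms by (auto simp: gens_iff append_eq_map_conv Cons_eq_map_conv)

text \<open>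
  Classes modulo \<open>K\<close> are replaced by arbitrary representatives, on which the values of \<open>g\<close> do not depend. It
  remains to see that each relation is mapped to zero.
\<close>

theorem chain_lift:
  assumes g: "multilinear r P g" "balanced r P g" and P: "Module.module k P"
  obtains h where "h \<in> Defs.module_hom k (Chains r) P"
    "\<And>a ps. a \<in> carrier A \<Longrightarrow> ps \<in> tuples \<Longrightarrow> length ps = r \<Longrightarrow> h (pure a ps) = g a ps"
proof -
  interpret P: Module.module k P by fact
  note lin = multilinearD[OF g(1)] and bal = balancedD[OF g(2)]
  define rep where "rep X = (SOME p. p \<in> carrier A \<and> X = bar p)" for X
  have rep: "rep (bar p) \<in> carrier A \<and> bar p = bar (rep (bar p))" if "p \<in> carrier A" for p
    unfolding rep_def by (rule someI[where P = "\<lambda>q. q \<in> carrier A \<and> bar p = bar q"]) (use that in simp)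
  define G where "G t = g (fst t) (map rep (snd t))" for t
  have G: "G (a, map bar ps) = g a ps" if "a \<in> carrier A" "ps \<in> tuples" "length ps = r" for a ps
  proof -
    have "map rep (map bar ps) \<in> tuples" "map bar (map rep (map bar ps)) = map bar ps"
      using that(2) rep by (auto simp: in_lists_conv_set)
    then show ?thesis
      using mod_const_list[OF g P that(1), of "[]" "map rep (map bar ps)" ps] that
      by (simp add: G_def)
  qed
  have "G t \<in> carrier P" if "t \<in> gens r" for t
    using that G lin(1) by (cases t) (auto simp: gens_iff)
  then obtain h0 where h0: "h0 \<in> Defs.module_hom k (F.Fr r) P" "\<And>t. t \<in> gens r \<Longrightarrow> h0 (free_gen k t) = G t"
    using F.free_lift[OF P] by blast
  have h0_gen: "h0 (free_gen k (a, map bar ps)) = g a ps"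
    if "a \<in> carrier A" "ps \<in> tuples" "length ps = r" for a ps
    using that by (simp add: h0(2) gensI G)
  note hom = module_homD[OF h0(1)] module_hom_minus[OF h0(1) F.module_Fr P]
  let ?ker = "{z \<in> carrier (F.Fr r). h0 z = \<zero>\<^bsub>P\<^esub>}"
  have rel: "tensor_relations k K Reg Red r \<union> cyclic_relations k K Reg Red r \<subseteq> ?ker"
  proof
    fix z assume z: "z \<in> tensor_relations k K Reg Red r \<union> cyclic_relations k K Reg Red r"
    have "h0 z = \<zero>\<^bsub>P\<^esub>"
      using z
    proof
      assume "z \<in> tensor_relations k K Reg Red r"
      then show ?thesis
      proof cases
        case (add_head m ns m')
        then obtain ps where ps: "ps \<in> tuples" "length ps = r" "ns = map bar ps" and m: "m \<in> carrier A"
          and m': "m' \<in> carrier A"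
          by (auto simp: gens_iff)
        then show ?thesis
          using add_head lin(1)[of m ps] lin(1)[of m' ps]
          by (simp add: hom gen_closed h0_gen Reg_simps lin P.minus_eq P.r_neg)
      next
        case (smult_head c m ns)
        then obtain ps where ps: "ps \<in> tuples" "length ps = r" "ns = map bar ps" and m: "m \<in> carrier A"
          by (auto simp: gens_iff)
        then show ?thesis
          using smult_head lin(1)[of m ps]
          by (simp add: hom gen_closed h0_gen Reg_simps lin P.minus_eq P.r_neg)
      next
        case (add_tail m us N vs N')
        obtain us' p vs' where ps: "us' \<in> tuples" "p \<in> carrier A" "vs' \<in> tuples"
            "us = map bar us'" "N = bar p" "vs = map bar vs'" and m: "m \<in> carrier A"
            and len: "Suc (length us' + length vs') = r"
          using add_tail(2) by (rule gens_splitE)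
        obtain q where q: "q \<in> carrier A" "N' = bar q"
          using add_tail(3) by (auto simp: tensor_gens_def Red_simps B.carrier_Q)
        have c: "us' @ p # vs' \<in> tuples" "us' @ q # vs' \<in> tuples" "us' @ (p \<oplus> q) # vs' \<in> tuples"
          using ps q by auto
        have "free_gen k (m, map bar us' @ (bar p \<oplus>\<^bsub>Red\<^esub> bar q) # map bar vs')
          = free_gen k (m, map bar (us' @ (p \<oplus> q) # vs'))"
          using ps q by (simp add: Red_simps B.cos_add)
        then have "z = free_gen k (m, map bar (us' @ (p \<oplus> q) # vs')) \<ominus>\<^bsub>F.Fr r\<^esub>
            (free_gen k (m, map bar (us' @ p # vs')) \<oplus>\<^bsub>F.Fr r\<^esub> free_gen k (m, map bar (us' @ q # vs')))"
          using add_tail(1) ps q by simp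
        moreover have "g m (us' @ (p \<oplus> q) # vs') = g m (us' @ p # vs') \<oplus>\<^bsub>P\<^esub> g m (us' @ q # vs')"
          using m ps q len by (intro lin(4)) auto
        ultimately show ?thesis
          using m c len lin(1)[of m] 
          by (simp add: hom gen_closed h0_gen P.minus_eq P.r_neg del: map_append list.map)
      next
        case (smult_tail c m us N vs)
        obtain us' p vs' where ps: "us' \<in> tuples" "p \<in> carrier A" "vs' \<in> tuples"
            "us = map bar us'" "N = bar p" "vs = map bar vs'" and m: "m \<in> carrier A"
            and len: "Suc (length us' + length vs') = r"
          using smult_tail(3) by (rule gens_splitE)
        have c: "us' @ p # vs' \<in> tuples" "us' @ (c \<odot> p) # vs' \<in> tuples"
          using ps smult_tail by auto
        have "free_gen k (m, map bar us' @ (c \<odot>\<^bsub>Red\<^esub> bar p) # map bar vs')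
          = free_gen k (m, map bar (us' @ (c \<odot> p) # vs'))"
          using ps smult_tail by (simp add: Red_simps B.cos_smult)
        then have "z = free_gen k (m, map bar (us' @ (c \<odot> p) # vs')) \<ominus>\<^bsub>F.Fr r\<^esub>
            c \<odot>\<^bsub>F.Fr r\<^esub> free_gen k (m, map bar (us' @ p # vs'))"
          using smult_tail(1) ps by simp
        moreover have "g m (us' @ (c \<odot> p) # vs') = c \<odot>\<^bsub>P\<^esub> g m (us' @ p # vs')"
          using m ps smult_tail len by (intro lin(5)) auto
        ultimately show ?thesis
          using m c len lin(1)[of m] smult_tail(2)
          by (simp add: hom gen_closed h0_gen P.minus_eq P.r_neg del: map_append list.map)
      next
        case (balanced_head l m N vs)
        then obtain p vs' where ps: "p \<in> carrier A" "vs' \<in> tuples" "N = bar p" "vs = map bar vs'"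
            and m: "m \<in> carrier A" and len: "Suc (length vs') = r"
          by (auto simp: gens_iff map_eq_Cons_conv Cons_eq_map_conv)
        have "z = free_gen k (m \<otimes> \<iota> l, map bar (p # vs')) \<ominus>\<^bsub>F.Fr r\<^esub>
            free_gen k (m, map bar ((\<iota> l \<otimes> p) # vs'))"
          using balanced_head ps by (simp add: Reg_simps Red_acts)
        moreover have "g (m \<otimes> \<iota> l) (p # vs') = g m ((\<iota> l \<otimes> p) # vs')"
          using m ps balanced_head len by (intro bal(1)) auto
        ultimately show ?thesis
          using m ps len balanced_head(2) lin(1)[of m "(\<iota> l \<otimes> p) # vs'"]
          by (simp add: hom gen_closed h0_gen P.minus_eq P.r_neg del: list.map)
      next
        case (balanced_tail l m us N N' vs)
        then obtain us' p ws where ws: "us' \<in> tuples" "p \<in> carrier A" "ws \<in> tuples"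
            "us = map bar us'" "N = bar p" "N' # vs = map bar ws" and m: "m \<in> carrier A"
            and len': "Suc (length us' + length ws) = r"
          by (elim gens_splitE)
        then obtain q vs' where ps: "us' \<in> tuples" "p \<in> carrier A" "q \<in> carrier A" "vs' \<in> tuples"
            "us = map bar us'" "N = bar p" "N' = bar q" "vs = map bar vs'"
            and len: "Suc (Suc (length us' + length vs')) = r"
          by (auto simp: Cons_eq_map_conv)
        have "z = free_gen k (m, map bar (us' @ (p \<otimes> \<iota> l) # q # vs')) \<ominus>\<^bsub>F.Fr r\<^esub>
            free_gen k (m, map bar (us' @ p # (\<iota> l \<otimes> q) # vs'))"
          using balanced_tail ps by (simp add: Red_acts)
        moreover have "g m (us' @ (p \<otimes> \<iota> l) # q # vs') = g m (us' @ p # (\<iota> l \<otimes> q) # vs')"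
          using m ps balanced_tail len by (intro bal(2)) auto
        ultimately show ?thesis
          using m ps len balanced_tail(2) lin(1)[of m "us' @ p # (\<iota> l \<otimes> q) # vs'"]
          by (simp add: hom gen_closed h0_gen P.minus_eq P.r_neg del: map_append list.map)
      qed
    next
      assume "z \<in> cyclic_relations k K Reg Red r"
      then obtain a Ps l where z: "(a, Ps) \<in> gens r" and l: "l \<in> carrier K" and z_eq:
        "z = free_gen k (tensor_ract Reg Red (a, Ps) l) \<ominus>\<^bsub>F.Fr r\<^esub> free_gen k (tensor_lact Reg l (a, Ps))"
        by (auto simp: cyclic_relations_def)
      then obtain ps where a: "a \<in> carrier A" and ps: "ps \<in> tuples" "length ps = r" "Ps = map bar ps"
        by (auto simp: gens_iff)
      show ?thesis
      proof (cases ps rule: rev_cases)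
        case Nil
        have "z = free_gen k (a \<otimes> \<iota> l, map bar []) \<ominus>\<^bsub>F.Fr r\<^esub> free_gen k (\<iota> l \<otimes> a, map bar [])"
          using z_eq ps Nil by (simp add: Reg_simps)
        moreover have "length ([] :: 'b list) = r" "a \<otimes> \<iota> l \<in> carrier A" "\<iota> l \<otimes> a \<in> carrier A"
          using ps Nil a l by auto
        ultimately have "h0 z = g (a \<otimes> \<iota> l) [] \<ominus>\<^bsub>P\<^esub> g (\<iota> l \<otimes> a) []"
          by (metis hom(4) gen_closed h0_gen lists.Nil)
        moreover have "g (a \<otimes> \<iota> l) [] = g (\<iota> l \<otimes> a) []"
          using a l ps Nil by (intro bal(3)) auto
        ultimately show ?thesis
          using a l ps Nil lin(1)[of "\<iota> l \<otimes> a" "[]"]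
          by (simp add: P.minus_eq P.r_neg)
      next
        case (snoc us p)
        have "z = free_gen k (a, map bar (us @ [p \<otimes> \<iota> l])) \<ominus>\<^bsub>F.Fr r\<^esub>
            free_gen k (\<iota> l \<otimes> a, map bar (us @ [p]))"
          using z_eq l ps snoc by (simp add: Reg_simps Red_acts)
        moreover have "g a (us @ [p \<otimes> \<iota> l]) = g (\<iota> l \<otimes> a) (us @ [p])"
          using a l ps snoc by (intro bal(4)) auto
        ultimately show ?thesis
          using a l ps snoc lin(1)[of "\<iota> l \<otimes> a" "us @ [p]"]
          by (simp add: hom gen_closed h0_gen P.minus_eq P.r_neg del: map_append list.map)
      qed
    qed
    then show "z \<in> ?ker" using z relations_closed by blast
  qed
  have "Rel r \<subseteq> ?ker"
    unfolding cyclic_tensor_relations_def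
    by (rule F.Fr.span_minimal[OF module_hom_kernel[OF h0(1) F.module_Fr P] rel])
  then obtain h where h: "h \<in> Defs.module_hom k (C.Q r) P"
    "\<And>z. z \<in> carrier (F.Fr r) \<Longrightarrow> h (Rel r +>\<^bsub>F.Fr r\<^esub> z) = h0 z"
    using C.quotient_lift[OF h0(1) P] by blast
  show thesis
  proof (rule that)
    show "h \<in> Defs.module_hom k (Chains r) P" using h(1) by (simp add: Chains_eq)
    show "h (pure a ps) = g a ps" if "a \<in> carrier A" "ps \<in> tuples" "length ps = r" for a ps
      using that by (simp add: pure_eq h(2) gen_closed h0_gen)
  qed
qed

lemma pure_closed [simp]:
  "a \<in> carrier A \<Longrightarrow> ps \<in> tuples \<Longrightarrow> length ps = r \<Longrightarrow> pure a ps \<in> carrier (Chains r)"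
  by (rule multilinearD(1)[OF multilinear_pure])

text \<open>
  Scalars can be absorbed into the first factor, so that sums of pure tensors exhaust the chains.
\<close>

lemma chains_induct [consumes 1, case_names zero add pure]:
  assumes c: "c \<in> carrier (Chains r)"
    and zero: "S \<zero>\<^bsub>Chains r\<^esub>"
    and add: "\<And>c d. c \<in> carrier (Chains r) \<Longrightarrow> d \<in> carrier (Chains r) \<Longrightarrow> S c \<Longrightarrow> S d \<Longrightarrow> S (c \<oplus>\<^bsub>Chains r\<^esub> d)"
    and pure: "\<And>a ps. a \<in> carrier A \<Longrightarrow> ps \<in> tuples \<Longrightarrow> length ps = r \<Longrightarrow> S (pure a ps)"
  shows "S c"
proof -
  obtain u where u: "u \<in> carrier (F.Fr r)" "c = Rel r +>\<^bsub>F.Fr r\<^esub> u"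
    using c unfolding Chains_eq by (rule C.carrier_QE)
  let ?g = "\<lambda>t. u t \<odot>\<^bsub>F.Fr r\<^esub> free_gen k t"
  have supp: "t \<in> gens r" if "u t \<noteq> \<zero>\<^bsub>k\<^esub>" for t using u that unfolding F.carrier_Fr by blast
  have uk: "u t \<in> carrier k" for t using u unfolding F.carrier_Fr by blast
  have closed: "?g t \<in> carrier (F.Fr r)" if "u t \<noteq> \<zero>\<^bsub>k\<^esub>" for t
    using supp[OF that] uk by simp
  have term_eq: "\<exists>a ps. a \<in> carrier A \<and> ps \<in> tuples \<and> length ps = r \<and> Rel r +>\<^bsub>F.Fr r\<^esub> ?g t = pure a ps"
    if nz: "u t \<noteq> \<zero>\<^bsub>k\<^esub>" for t
  proof -
    obtain a ps where t: "a \<in> carrier A" "ps \<in> tuples" "length ps = r" "t = (a, map bar ps)"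
      using supp[OF nz] by (cases t) (auto simp: gens_iff)
    have "Rel r +>\<^bsub>F.Fr r\<^esub> ?g t = u t \<odot>\<^bsub>Chains r\<^esub> pure a ps"
      using t uk by (simp add: C.cos_smult[symmetric] gen_closed pure_eq Chains_eq)
    also have "\<dots> = pure (u t \<odot> a) ps"
      using t uk by (simp add: multilinearD(3)[OF multilinear_pure])
    finally show ?thesis using t uk by (intro exI[of _ "u t \<odot> a"] exI[of _ ps]) simp
  qed
  have "c = Rel r +>\<^bsub>F.Fr r\<^esub> (\<Oplus>\<^bsub>F.Fr r\<^esub>t\<in>{t. u t \<noteq> \<zero>\<^bsub>k\<^esub>}. ?g t)"
    using u F.Fr_expand[OF u(1)] by simp
  also have "\<dots> = (\<Oplus>\<^bsub>Chains r\<^esub>t\<in>{t. u t \<noteq> \<zero>\<^bsub>k\<^esub>}. Rel r +>\<^bsub>F.Fr r\<^esub> ?g t)"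
    unfolding Chains_eq by (rule C.cos_finsum[symmetric]) (use closed in auto)
  finally have c_eq: "c = (\<Oplus>\<^bsub>Chains r\<^esub>t\<in>{t. u t \<noteq> \<zero>\<^bsub>k\<^esub>}. Rel r +>\<^bsub>F.Fr r\<^esub> ?g t)" .
  have "S (\<Oplus>\<^bsub>Chains r\<^esub>t\<in>T. Rel r +>\<^bsub>F.Fr r\<^esub> ?g t)" if "finite T" "T \<subseteq> {t. u t \<noteq> \<zero>\<^bsub>k\<^esub>}" for T
    using that
  proof (induction T rule: finite_induct)
    case (insert t T)
    have S: "S (Rel r +>\<^bsub>F.Fr r\<^esub> ?g s) \<and> Rel r +>\<^bsub>F.Fr r\<^esub> ?g s \<in> carrier (Chains r)"
      if s: "s \<in> insert t T" for s
    proof -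
      have "u s \<noteq> \<zero>\<^bsub>k\<^esub>" using s insert.prems by auto
      from term_eq[OF this] show ?thesis using pure by fastforce
    qed
    then have g: "(\<lambda>t. Rel r +>\<^bsub>F.Fr r\<^esub> ?g t) \<in> T \<rightarrow> carrier (Chains r)"
      "Rel r +>\<^bsub>F.Fr r\<^esub> ?g t \<in> carrier (Chains r)" by auto
    have "S (\<Oplus>\<^bsub>Chains r\<^esub>t\<in>T. Rel r +>\<^bsub>F.Fr r\<^esub> ?g t)"
      using insert by auto
    then have "S ((Rel r +>\<^bsub>F.Fr r\<^esub> ?g t) \<oplus>\<^bsub>Chains r\<^esub> (\<Oplus>\<^bsub>Chains r\<^esub>t\<in>T. Rel r +>\<^bsub>F.Fr r\<^esub> ?g t))"
      using S[of t] g by (intro add Ch.finsum_closed) auto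
    moreover have "(\<Oplus>\<^bsub>Chains r\<^esub>t\<in>insert t T. Rel r +>\<^bsub>F.Fr r\<^esub> ?g t)
        = (Rel r +>\<^bsub>F.Fr r\<^esub> ?g t) \<oplus>\<^bsub>Chains r\<^esub> (\<Oplus>\<^bsub>Chains r\<^esub>t\<in>T. Rel r +>\<^bsub>F.Fr r\<^esub> ?g t)"
      by (rule Ch.finsum_insert[OF insert.hyps g])
    ultimately show ?case by (rule ssubst[rotated])
  qed (simp add: zero)
  then show ?thesis
    using c_eq u(1) by (simp add: F.carrier_Fr)
qed

lemma chain_hom_eqI:
  assumes h: "h \<in> Defs.module_hom k (Chains r) P" and g: "g \<in> Defs.module_hom k (Chains r) P"
    and P: "Module.module k P" and c: "c \<in> carrier (Chains r)"
    and "\<And>a ps. a \<in> carrier A \<Longrightarrow> ps \<in> tuples \<Longrightarrow> length ps = r \<Longrightarrow> h (pure a ps) = g (pure a ps)"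
  shows "h c = g c"
  using c
proof (induction rule: chains_induct)
  case zero
  then show ?case using h g P module_Chains by (simp add: module_hom_zero)
qed (simp_all add: assms module_homD(2)[OF h] module_homD(2)[OF g])

section \<open>Chains as families of elements of \<open>A/[A, A]\<close>\<close>

definition AA :: "'b set"
  where "AA = commutator_submodule k A"

lemma AA_submodule: "submodule AA k A"
  unfolding AA_def commutator_submodule_def by (rule A.span_submodule) auto

lemma commutator_in_AA: "a \<in> carrier A \<Longrightarrow> b \<in> carrier A \<Longrightarrow> a \<otimes> b \<ominus> b \<otimes> a \<in> AA"
  unfolding AA_def commutator_submodule_def by (rule subsetD[OF A.span_superset]) blast

sublocale H: module_quotient k A AA
  by (simp add: module_quotient_def module_quotient_axioms_def A.module_axioms AA_submodule)

lemma cos_commute: "a \<in> carrier A \<Longrightarrow> b \<in> carrier A \<Longrightarrow> AA +> (a \<otimes> b) = AA +> (b \<otimes> a)"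
  by (simp add: H.cos_eq_iff commutator_in_AA)

lemma multilinear_E: "multilinear r H.Q (\<lambda>a ps. AA +> (a \<otimes> E F ps))"
  unfolding multilinear_def
proof (intro conjI ballI impI)
  fix a us vs p q assume "a \<in> carrier A" "us \<in> tuples" "vs \<in> tuples" "p \<in> carrier A" "q \<in> carrier A"
  then show "AA +> (a \<otimes> E F (us @ (p \<oplus> q) # vs))
      = (AA +> (a \<otimes> E F (us @ p # vs))) \<oplus>\<^bsub>H.Q\<^esub> (AA +> (a \<otimes> E F (us @ q # vs)))"
    by (simp add: H.cos_add A.r_distr E_slot_add)
next
  fix a us vs p c assume "a \<in> carrier A" "us \<in> tuples" "vs \<in> tuples" "p \<in> carrier A" "c \<in> carrier k"
  then show "AA +> (a \<otimes> E F (us @ (c \<odot> p) # vs)) = c \<odot>\<^bsub>H.Q\<^esub> (AA +> (a \<otimes> E F (us @ p # vs)))"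
    by (simp add: H.cos_smult E_smult A.smult_mult_right)
qed (simp_all add: H.cos_add H.cos_smult A.l_distr A.smult_mult_left)

text \<open>
  An element of \<open>K\<close> at the right end of the tuple comes out on the right, and may return to the left
  because commutators have been divided out.
\<close>

lemma balanced_E: "U.normalized F \<Longrightarrow> balanced r H.Q (\<lambda>a ps. AA +> (a \<otimes> E F ps))"
  unfolding balanced_def
proof (intro conjI ballI impI)
  fix a vs p u assume "a \<in> carrier A" "vs \<in> tuples" "p \<in> carrier A" "u \<in> carrier K"
  then show "AA +> (a \<otimes> \<iota> u \<otimes> E F (p # vs)) = AA +> (a \<otimes> E F ((\<iota> u \<otimes> p) # vs))"
    by (simp add: E_head A.m_assoc del: E.simps)
next
  fix a us vs p q u
  assume "a \<in> carrier A" "us \<in> tuples" "vs \<in> tuples" "p \<in> carrier A" "q \<in> carrier A" "u \<in> carrier K"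
  then show "AA +> (a \<otimes> E F (us @ (p \<otimes> \<iota> u) # q # vs)) = AA +> (a \<otimes> E F (us @ p # (\<iota> u \<otimes> q) # vs))"
    by (simp add: E_balanced)
next
  fix a u assume *: "a \<in> carrier A" "u \<in> carrier K"
  then have "AA +> (a \<otimes> \<iota> u \<otimes> E F []) = AA +> ((a \<otimes> E F []) \<otimes> \<iota> u)"
    by (simp add: A.m_assoc ev.eval_central)
  also have "\<dots> = AA +> (\<iota> u \<otimes> (a \<otimes> E F []))"
    using * by (intro cos_commute) simp_all
  finally show "AA +> (a \<otimes> \<iota> u \<otimes> E F []) = AA +> (\<iota> u \<otimes> a \<otimes> E F [])"
    using * by (simp add: A.m_assoc)
next
  fix a us p u assume *: "a \<in> carrier A" "us \<in> tuples" "p \<in> carrier A" "u \<in> carrier K"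
  then have "AA +> (a \<otimes> E F (us @ [p \<otimes> \<iota> u])) = AA +> ((a \<otimes> E F (us @ [p])) \<otimes> \<iota> u)"
    by (simp add: E_last A.m_assoc)
  also have "\<dots> = AA +> (\<iota> u \<otimes> (a \<otimes> E F (us @ [p])))"
    using * by (intro cos_commute) simp_all
  finally show "AA +> (a \<otimes> E F (us @ [p \<otimes> \<iota> u])) = AA +> (\<iota> u \<otimes> a \<otimes> E F (us @ [p]))"
    using * by (simp add: A.m_assoc)
next
  fix a us vs u assume "U.normalized F" "a \<in> carrier A" "us \<in> tuples" "vs \<in> tuples" "u \<in> carrier K"
  then show "AA +> (a \<otimes> E F (us @ \<iota> u # vs)) = \<zero>\<^bsub>H.Q\<^esub>"
    by (simp add: E_const)
qed

text \<open>
  The linear map with \<open>a \<otimes> a\<^sub>1 \<otimes> \<dots> \<otimes> a\<^sub>r \<mapsto> a F(a\<^sub>1, \<dots>, a\<^sub>r)\<close> that a normalized cochain \<open>F\<close> induces.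
\<close>

definition \<theta> :: "nat \<Rightarrow> (nat list \<Rightarrow> nat multiset \<Rightarrow>\<^sub>0 int) \<Rightarrow> ('b \<times> 'b set list \<Rightarrow> 'k) set \<Rightarrow> 'b set"
  where "\<theta> r F = (SOME h. h \<in> Defs.module_hom k (Chains r) H.Q \<and>
    (\<forall>a\<in>carrier A. \<forall>ps\<in>tuples. length ps = r \<longrightarrow> h (pure a ps) = AA +> (a \<otimes> E F ps)))"

lemma \<theta>_props:
  assumes "U.normalized F"
  shows "\<theta> r F \<in> Defs.module_hom k (Chains r) H.Q"
    and "a \<in> carrier A \<Longrightarrow> ps \<in> tuples \<Longrightarrow> length ps = r \<Longrightarrow> \<theta> r F (pure a ps) = AA +> (a \<otimes> E F ps)"
proof -
  obtain h where "h \<in> Defs.module_hom k (Chains r) H.Q"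
    "\<And>a ps. a \<in> carrier A \<Longrightarrow> ps \<in> tuples \<Longrightarrow> length ps = r \<Longrightarrow> h (pure a ps) = AA +> (a \<otimes> E F ps)"
    using chain_lift[OF multilinear_E balanced_E[OF assms] H.module_Q] by blast
  then have "\<exists>h. h \<in> Defs.module_hom k (Chains r) H.Q \<and>
    (\<forall>a\<in>carrier A. \<forall>ps\<in>tuples. length ps = r \<longrightarrow> h (pure a ps) = AA +> (a \<otimes> E F ps))"
    by (intro exI[of _ h] conjI ballI impI)
  note \<theta> = someI_ex[OF this, folded \<theta>_def]
  show "\<theta> r F \<in> Defs.module_hom k (Chains r) H.Q"
    by (rule conjunct1[OF \<theta>])
  show "a \<in> carrier A \<Longrightarrow> ps \<in> tuples \<Longrightarrow> length ps = r \<Longrightarrow> \<theta> r F (pure a ps) = AA +> (a \<otimes> E F ps)"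
    by (rule conjunct2[OF \<theta>, rule_format])
qed

abbreviation mono :: "nat list \<Rightarrow> 'b list"
  where "mono t \<equiv> map (\<lambda>i. x [^] i) t"

lemma mono_tuples [simp]: "mono t \<in> tuples"
  by (auto simp: in_lists_conv_set)

text \<open>
  Powers of \<open>x\<close> commute with \<open>K\<close>, so they let an element of \<open>K\<close> pass to the left.
\<close>

lemma pure_move:
  assumes "a \<in> carrier A" "p \<in> carrier A" "vs \<in> tuples" "u \<in> carrier K"
  shows "pure a (mono s @ (\<iota> u \<otimes> p) # vs) = pure (a \<otimes> \<iota> u) (mono s @ p # vs)"
  using assms
proof (induction s arbitrary: p vs rule: rev_induct)
  case Nil
  then show ?case using balancedD(1)[OF balanced_pure, of a vs p u] by simp
next
  case (snoc i s)
  have "pure a (mono (s @ [i]) @ (\<iota> u \<otimes> p) # vs) = pure a (mono s @ x [^] i # (\<iota> u \<otimes> p) # vs)"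
    by simp
  also have "\<dots> = pure a (mono s @ (x [^] i \<otimes> \<iota> u) # p # vs)"
    using snoc.prems by (intro balancedD(2)[OF balanced_pure, symmetric]) auto
  also have "\<dots> = pure a (mono s @ (\<iota> u \<otimes> x [^] i) # p # vs)"
    using snoc.prems x_pow_central[of "\<iota> u" i] by simp
  also have "\<dots> = pure (a \<otimes> \<iota> u) (mono s @ x [^] i # p # vs)"
    using snoc.prems by (intro snoc.IH) auto
  finally show ?case by simp
qed

lemma pure_cyclic:
  assumes a: "a \<in> carrier A" and u: "u \<in> carrier K"
  shows "pure (a \<otimes> \<iota> u) (mono t) = pure (\<iota> u \<otimes> a) (mono t)"
proof (cases t rule: rev_cases)
  case Nil
  then show ?thesis using balancedD(3)[OF balanced_pure, of a u] a u by simp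
next
  case (snoc s i)
  have "pure (\<iota> u \<otimes> a) (mono s @ [x [^] i]) = pure a (mono s @ [x [^] i \<otimes> \<iota> u])"
    using a u by (intro balancedD(4)[OF balanced_pure, symmetric]) auto
  also have "\<dots> = pure a (mono s @ [\<iota> u \<otimes> x [^] i])"
    using u x_pow_central[of "\<iota> u" i] by simp
  also have "\<dots> = pure (a \<otimes> \<iota> u) (mono s @ [x [^] i])"
    using pure_move[of a "x [^] i" "[]" u s] a u by simp
  finally show ?thesis using snoc by simp
qed

lemma pure_hom: "ps \<in> tuples \<Longrightarrow> length ps = r \<Longrightarrow> (\<lambda>a. pure a ps) \<in> Defs.module_hom k A (Chains r)"
  by (rule module_homI) (simp_all add: multilinearD(2,3)[OF multilinear_pure])

text \<open>
  One of the two elements may be taken to be the product of an element of \<open>K\<close> with a power of \<open>x\<close>. As \<open>x\<close>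
  is central, the commutator is then one with an element of \<open>K\<close>, where \<open>pure_cyclic\<close> applies.
\<close>

lemma pure_AA:
  assumes "a \<in> AA" "length t = r"
  shows "pure a (mono t) = \<zero>\<^bsub>Chains r\<^esub>"
proof -
  note hom = pure_hom[OF mono_tuples, of t r]
  let ?ker = "{a \<in> carrier A. pure a (mono t) = \<zero>\<^bsub>Chains r\<^esub>}"
  have "submodule ?ker k A"
    using assms by (intro module_hom_kernel[OF hom A.module_axioms module_Chains]) simp
  moreover have "a \<otimes> b \<ominus> b \<otimes> a \<in> ?ker" if a: "a \<in> carrier A" and b: "b \<in> carrier A" for a b
  proof -
    have len: "length (mono t) = r" using assms by simp
    let ?b = "\<lambda>l. \<iota> (coef l b) \<otimes> x [^] l"
    have closed [simp]: "?b l \<in> carrier A" if "l < n" for l using b that by simp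
    have eq: "pure (a \<otimes> ?b l) (mono t) = pure (?b l \<otimes> a) (mono t)" if "l < n" for l
    proof -
      have "a \<otimes> ?b l = (x [^] l \<otimes> a) \<otimes> \<iota> (coef l b)"
        using a b that x_pow_central[of "\<iota> (coef l b)" l] x_pow_central[of "a \<otimes> \<iota> (coef l b)" l]
        by (simp add: A.m_assoc)
      moreover have "?b l \<otimes> a = \<iota> (coef l b) \<otimes> (x [^] l \<otimes> a)"
        using a b that by (simp add: A.m_assoc)
      ultimately show ?thesis using a b that by (simp add: pure_cyclic)
    qed
    have "pure (a \<otimes> b) (mono t) = pure (a \<otimes> (\<Oplus>l\<in>{..<n}. ?b l)) (mono t)"
      using expansion[OF b] by simp
    also have "\<dots> = pure (\<Oplus>l\<in>{..<n}. a \<otimes> ?b l) (mono t)"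
      using a by (simp add: sum_rdistr)
    also have "\<dots> = (\<Oplus>\<^bsub>Chains r\<^esub>l\<in>{..<n}. pure (a \<otimes> ?b l) (mono t))"
      using a by (intro module_hom_finsum[OF hom[OF len] A.module_axioms module_Chains]) simp
    also have "\<dots> = (\<Oplus>\<^bsub>Chains r\<^esub>l\<in>{..<n}. pure (?b l \<otimes> a) (mono t))"
      using a len eq by (intro Ch.finsum_cong') auto
    also have "\<dots> = pure (\<Oplus>l\<in>{..<n}. ?b l \<otimes> a) (mono t)"
      using a by (intro module_hom_finsum[OF hom[OF len] A.module_axioms module_Chains, symmetric]) simp
    also have "\<dots> = pure ((\<Oplus>l\<in>{..<n}. ?b l) \<otimes> a) (mono t)"
      using a by (simp add: sum_ldistr)
    also have "\<dots> = pure (b \<otimes> a) (mono t)"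
      using expansion[OF b] by simp
    finally have "pure (a \<otimes> b) (mono t) = pure (b \<otimes> a) (mono t)" .
    then show ?thesis
      using a b len module_hom_minus[OF hom[OF len] A.module_axioms module_Chains, of "a \<otimes> b" "b \<otimes> a"]
      by (simp add: Ch.minus_eq Ch.r_neg)
  qed
  ultimately have "AA \<subseteq> ?ker"
    unfolding AA_def commutator_submodule_def by (intro A.span_minimal) auto
  then show ?thesis using assms by blast
qed

text \<open>
  Exponent \<open>0\<close> is excluded because the class of \<open>1\<close> in \<open>A/K\<close> is zero.
\<close>

definition idx1 :: "nat \<Rightarrow> nat list set"
  where "idx1 r = {t \<in> lists {1..<n}. length t = r}"

lemma finite_idx1: "finite (idx1 r)"
proof -
  have "idx1 r = {t. set t \<subseteq> {1..<n} \<and> length t = r}"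
    by (auto simp: idx1_def in_lists_conv_set)
  then show ?thesis using finite_lists_length_eq[of "{1..<n}" r] by simp
qed

lemma idx1_idx: "t \<in> idx1 r \<Longrightarrow> t \<in> U.idx \<and> 0 \<notin> set t \<and> length t = r"
  by (auto simp: idx1_def U.idx_def in_lists_conv_set)

lemma idx1_I: "t \<in> U.idx \<Longrightarrow> 0 \<notin> set t \<Longrightarrow> length t = r \<Longrightarrow> t \<in> idx1 r"
  by (auto simp: idx1_def U.idx_def in_lists_conv_set Suc_le_eq intro!: gr0I)

lemma pure_mono_closed [simp]: "t \<in> idx1 r \<Longrightarrow> a \<in> carrier A \<Longrightarrow> pure a (mono t) \<in> carrier (Chains r)"
  using idx1_idx by simp

definition normal_form :: "nat \<Rightarrow> ('b \<times> 'b set list \<Rightarrow> 'k) set \<Rightarrow> bool"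
  where "normal_form r c \<longleftrightarrow> (\<exists>a. (\<forall>t\<in>idx1 r. a t \<in> carrier A) \<and>
    c = (\<Oplus>\<^bsub>Chains r\<^esub>t\<in>idx1 r. pure (a t) (mono t)))"

lemma normal_form_zero: "normal_form r \<zero>\<^bsub>Chains r\<^esub>"
  unfolding normal_form_def
proof (intro exI conjI)
  have "pure \<zero> (mono t) = \<zero>\<^bsub>Chains r\<^esub>" if "t \<in> idx1 r" for t
    using idx1_idx[OF that] pure_AA[of \<zero> t r] H.N_zero by simp
  then have "(\<Oplus>\<^bsub>Chains r\<^esub>t\<in>idx1 r. pure \<zero> (mono t)) = (\<Oplus>\<^bsub>Chains r\<^esub>t\<in>idx1 r. \<zero>\<^bsub>Chains r\<^esub>)"
    by (intro Ch.finsum_cong') auto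
  then show "\<zero>\<^bsub>Chains r\<^esub> = (\<Oplus>\<^bsub>Chains r\<^esub>t\<in>idx1 r. pure \<zero> (mono t))" by simp
qed simp

lemma normal_form_add:
  assumes "normal_form r c" "normal_form r d"
  shows "normal_form r (c \<oplus>\<^bsub>Chains r\<^esub> d)"
proof -
  obtain a b where a: "\<And>t. t \<in> idx1 r \<Longrightarrow> a t \<in> carrier A" "c = (\<Oplus>\<^bsub>Chains r\<^esub>t\<in>idx1 r. pure (a t) (mono t))"
    and b: "\<And>t. t \<in> idx1 r \<Longrightarrow> b t \<in> carrier A" "d = (\<Oplus>\<^bsub>Chains r\<^esub>t\<in>idx1 r. pure (b t) (mono t))"
    using assms unfolding normal_form_def by blast
  have closed: "(\<lambda>t. pure (a t) (mono t)) \<in> idx1 r \<rightarrow> carrier (Chains r)"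
    "(\<lambda>t. pure (b t) (mono t)) \<in> idx1 r \<rightarrow> carrier (Chains r)"
    using a(1) b(1) by auto
  have "c \<oplus>\<^bsub>Chains r\<^esub> d = (\<Oplus>\<^bsub>Chains r\<^esub>t\<in>idx1 r. pure (a t) (mono t) \<oplus>\<^bsub>Chains r\<^esub> pure (b t) (mono t))"
    unfolding a(2) b(2) by (rule Ch.finsum_addf[OF closed, symmetric])
  also have "\<dots> = (\<Oplus>\<^bsub>Chains r\<^esub>t\<in>idx1 r. pure (a t \<oplus> b t) (mono t))"
    using a(1) b(1) closed idx1_idx
    by (intro Ch.finsum_cong') (auto simp: multilinearD(2)[OF multilinear_pure])
  finally show ?thesis
    unfolding normal_form_def using a(1) b(1) by (intro exI[of _ "\<lambda>t. a t \<oplus> b t"]) auto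
qed

lemma normal_form_mono:
  assumes t: "t \<in> U.idx" "length t = r" and a: "a \<in> carrier A"
  shows "normal_form r (pure a (mono t))"
proof (cases "0 \<in> set t")
  case True
  then obtain s s' where s: "t = s @ 0 # s'" by (meson split_list)
  have "pure a (mono s @ \<iota> \<one>\<^bsub>K\<^esub> # mono s') = \<zero>\<^bsub>Chains r\<^esub>"
    using a t s by (intro balancedD(5)[OF balanced_pure]) auto
  then show ?thesis using normal_form_zero s by simp
next
  case False
  then have t1: "t \<in> idx1 r" using t by (intro idx1_I) auto
  let ?a = "\<lambda>s. if t = s then a else \<zero>"
  have "pure (?a s) (mono s) = (if t = s then pure a (mono s) else \<zero>\<^bsub>Chains r\<^esub>)" if "s \<in> idx1 r" for s
    using pure_AA[of \<zero> s r] H.N_zero idx1_idx[OF that] by simp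
  then have "(\<Oplus>\<^bsub>Chains r\<^esub>s\<in>idx1 r. pure (?a s) (mono s))
      = (\<Oplus>\<^bsub>Chains r\<^esub>s\<in>idx1 r. if t = s then pure a (mono s) else \<zero>\<^bsub>Chains r\<^esub>)"
    using a by (intro Ch.finsum_cong') auto
  also have "\<dots> = pure a (mono t)"
    using a t1 finite_idx1 by (intro Ch.add.finprod_singleton) auto
  finally show ?thesis unfolding normal_form_def using a by (intro exI[of _ ?a]) auto
qed

text \<open>
  The factors are expanded into powers of \<open>x\<close> one after the other, from the left. Their coefficients go
  into the first factor.
\<close>

lemma normal_form_pure:
  assumes "s \<in> U.idx" "ps \<in> tuples" "length s + length ps = r" "a \<in> carrier A"
  shows "normal_form r (pure a (mono s @ ps))"
  using assms
proof (induction ps arbitrary: s a rule: list.induct)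
  case Nil
  then show ?case by (simp add: normal_form_mono)
next
  case (Cons p ps)
  have p: "p \<in> carrier A" and ps: "ps \<in> tuples" and a: "a \<in> carrier A"
    and len: "Suc (length (mono s) + length ps) = r" using Cons.prems by auto
  let ?p = "\<lambda>l. \<iota> (coef l p) \<otimes> x [^] l" and ?c = "\<lambda>l. pure (a \<otimes> \<iota> (coef l p)) (mono (s @ [l]) @ ps)"
  have slot: "(\<lambda>q. pure a (mono s @ q # ps)) \<in> Defs.module_hom k A (Chains r)"
    using a ps len by (intro module_homI) (simp_all add: multilinearD(4,5)[OF multilinear_pure])
  have "pure a (mono s @ p # ps) = pure a (mono s @ (\<Oplus>l\<in>{..<n}. ?p l) # ps)"
    using expansion[OF p] by simp
  also have "\<dots> = (\<Oplus>\<^bsub>Chains r\<^esub>l\<in>{..<n}. pure a (mono s @ ?p l # ps))"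
    using p by (intro module_hom_finsum[OF slot A.module_axioms module_Chains]) simp
  also have "\<dots> = (\<Oplus>\<^bsub>Chains r\<^esub>l\<in>{..<n}. ?c l)"
    using p ps a len by (intro Ch.finsum_cong') (auto simp: pure_move)
  finally have eq: "pure a (mono s @ p # ps) = (\<Oplus>\<^bsub>Chains r\<^esub>l\<in>{..<n}. ?c l)" .
  have nf: "normal_form r (?c l)" if "l < n" for l
    using that p ps a Cons.prems by (intro Cons.IH) (auto simp: U.idx_def)
  have closed: "?c l \<in> carrier (Chains r)" if "l < n" for l
    using that p ps a len by (intro pure_closed) auto
  have "normal_form r (\<Oplus>\<^bsub>Chains r\<^esub>l\<in>{..<m}. ?c l)" if "m \<le> n" for m
    using that
  proof (induction m)
    case (Suc m)
    have "(\<Oplus>\<^bsub>Chains r\<^esub>l\<in>{..<Suc m}. ?c l) = ?c m \<oplus>\<^bsub>Chains r\<^esub> (\<Oplus>\<^bsub>Chains r\<^esub>l\<in>{..<m}. ?c l)"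
      unfolding lessThan_Suc using Suc.prems closed by (intro Ch.finsum_insert) auto
    then show ?case using Suc nf by (auto intro: normal_form_add)
  qed (simp add: normal_form_zero)
  then show ?case using eq by simp
qed

theorem chain_normal_form: "c \<in> carrier (Chains r) \<Longrightarrow> normal_form r c"
proof (induction rule: chains_induct)
  case (pure a ps)
  then show ?case using normal_form_pure[of "[]" ps r a] by simp
qed (simp_all add: normal_form_zero normal_form_add)

text \<open>
  The cochains dual to the tuples of powers; they pick out the coefficients of a normal form.
\<close>

definition delta :: "nat list \<Rightarrow> nat list \<Rightarrow> nat multiset \<Rightarrow>\<^sub>0 int"
  where "delta t s = (if s = t then 1 else 0)"

lemma normalized_delta: "t \<in> idx1 r \<Longrightarrow> U.normalized (delta t)"
  by (auto simp: U.normalized_def delta_def dest: idx1_idx)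

text \<open>
  The dual cochains show that the coefficients of a normal form of \<open>c\<close> are in \<open>[A, A]\<close>, where they do not
  contribute, by \<open>pure_AA\<close>.
\<close>

theorem \<theta>_jointly_injective:
  assumes c: "c \<in> carrier (Chains r)" and zero: "\<And>F. U.normalized F \<Longrightarrow> \<theta> r F c = \<zero>\<^bsub>H.Q\<^esub>"
  shows "c = \<zero>\<^bsub>Chains r\<^esub>"
proof -
  obtain a where a: "\<And>t. t \<in> idx1 r \<Longrightarrow> a t \<in> carrier A" and c_eq: "c = (\<Oplus>\<^bsub>Chains r\<^esub>t\<in>idx1 r. pure (a t) (mono t))"
    using chain_normal_form[OF c] unfolding normal_form_def by blast
  have "a s \<in> AA" if s: "s \<in> idx1 r" for s
  proof -
    note F = normalized_delta[OF s]
    have "\<zero>\<^bsub>H.Q\<^esub> = \<theta> r (delta s) c" using zero[OF F] by simp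
    also have "\<dots> = (\<Oplus>\<^bsub>H.Q\<^esub>t\<in>idx1 r. \<theta> r (delta s) (pure (a t) (mono t)))"
      unfolding c_eq using a
      by (intro module_hom_finsum[OF \<theta>_props(1)[OF F] module_Chains H.module_Q]) auto
    also have "\<dots> = (\<Oplus>\<^bsub>H.Q\<^esub>t\<in>idx1 r. if s = t then AA +> a t else \<zero>\<^bsub>H.Q\<^esub>)"
    proof (intro H.Q.finsum_cong')
      fix t assume t: "t \<in> idx1 r"
      have "\<theta> r (delta s) (pure (a t) (mono t)) = AA +> (a t \<otimes> \<eta> (delta s t))"
        using a[OF t] idx1_idx[OF t] by (simp add: \<theta>_props(2)[OF F] E_monomials)
      then show "\<theta> r (delta s) (pure (a t) (mono t)) = (if s = t then AA +> a t else \<zero>\<^bsub>H.Q\<^esub>)"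
        using a[OF t] by (simp add: delta_def)
    qed (use a in auto)
    also have "\<dots> = AA +> a s"
      using a s finite_idx1 by (intro H.Q.add.finprod_singleton) auto
    finally show ?thesis using a[OF s] H.cos_zero_iff[of "a s"] by (simp add: H.zero_Q)
  qed
  then have "c = (\<Oplus>\<^bsub>Chains r\<^esub>t\<in>idx1 r. \<zero>\<^bsub>Chains r\<^esub>)"
    unfolding c_eq by (intro Ch.finsum_cong') (use idx1_idx pure_AA in auto)
  then show ?thesis by simp
qed

end

section \<open>The Hochschild boundary\<close>

context central_monogenic
begin

lemma chains_eqI:
  assumes c: "c \<in> carrier (Chains r)" and d: "d \<in> carrier (Chains r)"
    and eq: "\<And>F. U.normalized F \<Longrightarrow> \<theta> r F c = \<theta> r F d"
  shows "c = d"
proof -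
  have "c \<ominus>\<^bsub>Chains r\<^esub> d = \<zero>\<^bsub>Chains r\<^esub>"
  proof (rule \<theta>_jointly_injective)
    fix F assume F: "U.normalized F"
    note h = \<theta>_props(1)[OF F, of r]
    have "\<theta> r F (c \<ominus>\<^bsub>Chains r\<^esub> d) = \<theta> r F c \<ominus>\<^bsub>H.Q\<^esub> \<theta> r F d"
      by (rule module_hom_minus[OF h module_Chains H.module_Q c d])
    also have "\<dots> = \<zero>\<^bsub>H.Q\<^esub>"
      unfolding eq[OF F] using module_homD(1)[OF h d] by (simp add: H.Q.minus_eq H.Q.r_neg)
    finally show "\<theta> r F (c \<ominus>\<^bsub>Chains r\<^esub> d) = \<zero>\<^bsub>H.Q\<^esub>" .
  qed (use c d in simp)
  moreover have "c = (c \<ominus>\<^bsub>Chains r\<^esub> d) \<oplus>\<^bsub>Chains r\<^esub> d"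
    using c d by (simp add: Ch.minus_eq Ch.a_assoc Ch.l_neg)
  ultimately show ?thesis using d by simp
qed

text \<open>
  Since the maps \<open>\<theta>\<close> separate chains, it suffices to check relations between chains after applying them. A
  family of chains that is transposed to an operator on cochains satisfies the relations, because
  multilinear extensions of cochains do. The boundary is well defined for this reason, although its
  individual summands are not.
\<close>

lemma multilinear_transpose:
  assumes closed: "\<And>a ps. a \<in> carrier A \<Longrightarrow> ps \<in> tuples \<Longrightarrow> length ps = r \<Longrightarrow> g a ps \<in> carrier (Chains s)"
    and T: "\<And>F. U.normalized F \<Longrightarrow> U.normalized (T F)"
    and g: "\<And>F a ps. U.normalized F \<Longrightarrow> a \<in> carrier A \<Longrightarrow> ps \<in> tuples \<Longrightarrow> length ps = r \<Longrightarrow>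
      \<theta> s F (g a ps) = AA +> (a \<otimes> E (T F) ps)"
  shows "multilinear r (Chains s) g" "balanced r (Chains s) g"
proof -
  note lin = multilinearD[OF multilinear_E] and bal = balancedD[OF balanced_E[OF T]]
  note add = module_homD(2)[OF \<theta>_props(1)] and smult = module_homD(3)[OF \<theta>_props(1)]
    and zero = module_hom_zero[OF \<theta>_props(1) module_Chains H.module_Q]
  show "multilinear r (Chains s) g"
    unfolding multilinear_def
  proof (intro conjI ballI impI)
    fix a a' ps assume "a \<in> carrier A" "a' \<in> carrier A" "ps \<in> tuples" "length ps = r"
    then show "g (a \<oplus> a') ps = g a ps \<oplus>\<^bsub>Chains s\<^esub> g a' ps"
      by (intro chains_eqI[of _ s]) (simp_all add: closed add g lin(2)[of _ _ _ r])
  next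
    fix c a ps assume "c \<in> carrier k" "a \<in> carrier A" "ps \<in> tuples" "length ps = r"
    then show "g (c \<odot> a) ps = c \<odot>\<^bsub>Chains s\<^esub> g a ps"
      by (intro chains_eqI[of _ s]) (simp_all add: closed smult g lin(3)[of _ _ _ r])
  next
    fix a us vs p q
    assume "a \<in> carrier A" "us \<in> tuples" "vs \<in> tuples" "p \<in> carrier A" "q \<in> carrier A"
      "Suc (length us + length vs) = r"
    then show "g a (us @ (p \<oplus> q) # vs) = g a (us @ p # vs) \<oplus>\<^bsub>Chains s\<^esub> g a (us @ q # vs)"
      by (intro chains_eqI[of _ s]) (simp_all add: closed add g lin(4)[of _ _ _ _ _ r])
  next
    fix a us vs p c
    assume "a \<in> carrier A" "us \<in> tuples" "vs \<in> tuples" "p \<in> carrier A" "c \<in> carrier k"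
      "Suc (length us + length vs) = r"
    then show "g a (us @ (c \<odot> p) # vs) = c \<odot>\<^bsub>Chains s\<^esub> g a (us @ p # vs)"
      by (intro chains_eqI[of _ s]) (simp_all add: closed smult g lin(5)[of _ _ _ _ _ r])
  qed (simp add: closed)
  show "balanced r (Chains s) g"
    unfolding balanced_def
  proof (intro conjI ballI impI)
    fix a vs p u
    assume "a \<in> carrier A" "vs \<in> tuples" "p \<in> carrier A" "u \<in> carrier K" "Suc (length vs) = r"
    then show "g (a \<otimes> \<iota> u) (p # vs) = g a ((\<iota> u \<otimes> p) # vs)"
      by (intro chains_eqI[of _ s]) (simp_all add: closed g bal(1)[of _ _ _ _ _ r] del: E.simps)
  next
    fix a us vs p q u
    assume "a \<in> carrier A" "us \<in> tuples" "vs \<in> tuples" "p \<in> carrier A" "q \<in> carrier A" "u \<in> carrier K"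
      "Suc (Suc (length us + length vs)) = r"
    then show "g a (us @ (p \<otimes> \<iota> u) # q # vs) = g a (us @ p # (\<iota> u \<otimes> q) # vs)"
      by (intro chains_eqI[of _ s]) (simp_all add: closed g bal(2)[of _ _ _ _ _ _ _ r])
  next
    fix a u assume *: "a \<in> carrier A" "u \<in> carrier K" "r = 0"
    then show "g (a \<otimes> \<iota> u) [] = g (\<iota> u \<otimes> a) []"
      by (intro chains_eqI[of _ s]) (simp_all add: closed g bal(3)[of _ _ _ r, simplified *(3)] del: E.simps)
  next
    fix a us p u
    assume "a \<in> carrier A" "us \<in> tuples" "p \<in> carrier A" "u \<in> carrier K" "Suc (length us) = r"
    then show "g a (us @ [p \<otimes> \<iota> u]) = g (\<iota> u \<otimes> a) (us @ [p])"
      by (intro chains_eqI[of _ s]) (simp_all add: closed g bal(4)[of _ _ _ _ _ r])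
  next
    fix a us vs u
    assume "a \<in> carrier A" "us \<in> tuples" "vs \<in> tuples" "u \<in> carrier K" "Suc (length us + length vs) = r"
    then show "g a (us @ \<iota> u # vs) = \<zero>\<^bsub>Chains s\<^esub>"
      by (intro chains_eqI[of _ s]) (simp_all add: closed g zero bal(5)[of _ _ _ _ _ r])
  qed
qed

definition sign :: "nat \<Rightarrow> 'k"
  where "sign i = (\<ominus>\<^bsub>k\<^esub> \<one>\<^bsub>k\<^esub>) [^]\<^bsub>k\<^esub> i"

lemma sign_closed [simp]: "sign i \<in> carrier k" and sign_0 [simp]: "sign 0 = \<one>\<^bsub>k\<^esub>"
  by (simp_all add: sign_def)

lemma sign_Suc: "a \<in> carrier A \<Longrightarrow> sign (Suc i) \<odot> a = \<ominus> (sign i \<odot> a)"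
proof -
  assume a: "a \<in> carrier A"
  have "sign (Suc i) = \<ominus>\<^bsub>k\<^esub> (sign i)"
    by (simp add: sign_def K.R.r_minus)
  then show ?thesis using a by (simp only: A.smult_l_minus sign_closed)
qed

text \<open>
  The value of \<open>G\<close> at a face of the tuple \<open>ps\<close>. In the last one there is no neighbour to multiply with,
  and the last entry becomes a factor on the right.
\<close>

definition merged :: "('b list \<Rightarrow> 'b) \<Rightarrow> nat \<Rightarrow> 'b list \<Rightarrow> 'b"
  where "merged G j ps = (if Suc j = length ps then G (butlast ps) \<otimes> last ps
    else G (take j ps @ (ps ! j \<otimes> ps ! Suc j) # drop (Suc (Suc j)) ps))"

lemma merged_closed:
  assumes "ps \<in> tuples" "j < length ps" "\<And>us. us \<in> tuples \<Longrightarrow> G us \<in> carrier A"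
  shows "merged G j ps \<in> carrier A"
proof -
  have mem: "q \<in> carrier A" if "q \<in> set ps" for q
    using assms(1) that by (simp add: in_lists_conv_set)
  have sub: "us \<in> tuples" if "set us \<subseteq> set ps" for us
    using assms(1) that by (auto simp: in_lists_conv_set)
  have "butlast ps \<in> tuples" "take j ps \<in> tuples" "drop (Suc (Suc j)) ps \<in> tuples"
    by (auto intro!: sub dest: in_set_butlastD in_set_takeD in_set_dropD)
  moreover have "last ps \<in> carrier A" using assms(2) by (intro mem last_in_set) auto
  moreover have "ps ! j \<in> carrier A" "Suc j < length ps \<Longrightarrow> ps ! Suc j \<in> carrier A"
    using assms(2) by (auto intro!: mem)
  ultimately show ?thesis
    using assms(2,3) by (auto simp: merged_def)
qed

lemma mid_eq_sum:
  assumes "qs \<in> tuples" "p \<in> carrier A" "\<And>us. us \<in> tuples \<Longrightarrow> G us \<in> carrier A"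
  shows "mid G p qs = (\<Oplus>j\<in>{..length qs}. sign j \<odot> merged G j (p # qs))"
  using assms
proof (induction qs arbitrary: p G rule: list.induct)
  case Nil
  then show ?case by (simp add: merged_def)
next
  case (Cons q qs)
  let ?G = "\<lambda>us. G (p # us)"
  have merged_Suc: "merged G (Suc j) (p # q # qs) = merged ?G j (q # qs)" for j
    by (simp add: merged_def)
  have closed: "merged G j (p # q # qs) \<in> carrier A" if "j \<le> Suc (length qs)" for j
    using Cons.prems that by (intro merged_closed) auto
  have closed': "merged ?G j (q # qs) \<in> carrier A" if "j \<le> length qs" for j
    using Cons.prems that by (intro merged_closed) auto
  have "(\<Oplus>j\<in>{..length (q # qs)}. sign j \<odot> merged G j (p # q # qs))
      = (\<Oplus>j\<in>{..length qs}. sign (Suc j) \<odot> merged G (Suc j) (p # q # qs)) \<oplus> sign 0 \<odot> merged G 0 (p # q # qs)"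
    using closed by (simp only: list.size add_0_right add_Suc_right, intro A.finsum_Suc2) auto
  also have "(\<Oplus>j\<in>{..length qs}. sign (Suc j) \<odot> merged G (Suc j) (p # q # qs))
      = (\<Oplus>j\<in>{..length qs}. \<ominus> (sign j \<odot> merged ?G j (q # qs)))"
    using closed' unfolding merged_Suc by (intro sum_cong) (auto simp: sign_Suc)
  also have "\<dots> = \<ominus> (\<Oplus>j\<in>{..length qs}. sign j \<odot> merged ?G j (q # qs))"
    using closed' by (intro additive_finsum[OF A.abelian_monoid_axioms A.abelian_monoid_axioms, symmetric])
      (auto simp: A.minus_add)
  also have "(\<Oplus>j\<in>{..length qs}. sign j \<odot> merged ?G j (q # qs)) = mid ?G q qs"
    using Cons.prems by (intro Cons.IH[symmetric]) auto
  also have "sign 0 \<odot> merged G 0 (p # q # qs) = G ((p \<otimes> q) # qs)"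
    using closed[of 0] by (simp add: merged_def)
  finally show ?case
    using Cons.prems mid_closed[of qs q ?G] by (simp add: A.minus_eq A.a_comm)
qed

lemma face_closed:
  assumes "a \<in> carrier A" "ps \<in> tuples" "ps \<noteq> []" "i \<le> length ps"
  shows "fst (hoch_face A i (a, ps)) \<in> carrier A" "snd (hoch_face A i (a, ps)) \<in> tuples"
    "length (snd (hoch_face A i (a, ps))) = length ps - 1"
proof -
  have mem: "q \<in> carrier A" if "q \<in> set ps" for q
    using assms(2) that by (simp add: in_lists_conv_set)
  have sub: "us \<in> tuples" if "set us \<subseteq> set ps" for us
    using assms(2) that by (auto simp: in_lists_conv_set)
  have "butlast ps \<in> tuples" "tl ps \<in> tuples" "take (i - 1) ps \<in> tuples" "drop (i + 1) ps \<in> tuples"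
    using assms(3) by (auto intro!: sub dest: in_set_butlastD in_set_takeD in_set_dropD list.set_sel(2))
  moreover have "last ps \<in> carrier A" "hd ps \<in> carrier A"
    "i < length ps \<Longrightarrow> ps ! i \<in> carrier A" "ps ! (i - 1) \<in> carrier A"
    using assms(3,4) by (auto intro!: mem nth_mem) (cases i; simp)
  ultimately show "fst (hoch_face A i (a, ps)) \<in> carrier A" "snd (hoch_face A i (a, ps)) \<in> tuples"
    "length (snd (hoch_face A i (a, ps))) = length ps - 1"
    using assms by (auto simp: min_def)
qed

definition bfun :: "nat \<Rightarrow> 'b \<Rightarrow> 'b list \<Rightarrow> ('b \<times> 'b set list \<Rightarrow> 'k) set"
  where "bfun r a ps = (\<Oplus>\<^bsub>Chains (r - 1)\<^esub>i\<in>{..r}.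
    sign i \<odot>\<^bsub>Chains (r - 1)\<^esub> hoch_pure k K A \<iota> (hoch_face A i (a, ps)))"

lemma hoch_pure_eq: "hoch_pure k K A \<iota> t = pure (fst t) (snd t)"
  by (simp add: pure_def)

lemma face_pure_closed:
  assumes "a \<in> carrier A" "ps \<in> tuples" "length ps = r" "r > 0" "i \<le> r"
  shows "hoch_pure k K A \<iota> (hoch_face A i (a, ps)) \<in> carrier (Chains (r - 1))"
  using face_closed[of a ps i] assms unfolding hoch_pure_eq by (intro pure_closed) auto

lemma bfun_closed:
  "a \<in> carrier A \<Longrightarrow> ps \<in> tuples \<Longrightarrow> length ps = r \<Longrightarrow> r > 0 \<Longrightarrow> bfun r a ps \<in> carrier (Chains (r - 1))"
  unfolding bfun_def by (intro Ch.finsum_closed Pi_I Ch.smult_closed face_pure_closed) auto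

text \<open>
  The face that multiplies the last entry from the left into the first factor is moved to the right modulo
  \<open>[A, A]\<close>. There it is the last face of the coboundary.
\<close>

lemma \<theta>_bfun:
  assumes F: "U.normalized F" and a: "a \<in> carrier A" and ps: "ps \<in> tuples" "length ps = r" "r > 0"
  shows "\<theta> (r - 1) F (bfun r a ps) = AA +> (a \<otimes> E (U.cob F) ps)"
proof -
  obtain p qs where pq: "ps = p # qs" using ps by (cases ps) auto
  have p: "p \<in> carrier A" and qs: "qs \<in> tuples" and r: "r = Suc (length qs)" using ps pq by auto
  let ?m = "\<lambda>i. case i of 0 \<Rightarrow> p \<otimes> E F qs | Suc j \<Rightarrow> merged (E F) j ps"
  have m_closed: "?m i \<in> carrier A" if "i \<le> r" for i
    using that p qs ps by (auto split: nat.split intro!: merged_closed)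
  have face: "AA +> (fst t \<otimes> E F (snd t)) = AA +> (a \<otimes> ?m i)" if i: "i \<le> r" and t: "t = hoch_face A i (a, ps)" for i t
  proof (cases i)
    case 0
    then show ?thesis using a p qs t pq by (simp add: A.m_assoc)
  next
    case (Suc j)
    show ?thesis
    proof (cases "i = r")
      case True
      have l: "last ps \<in> carrier A" "butlast ps \<in> tuples"
        using face_closed[OF a ps(1), of i] True ps by (auto simp: in_lists_conv_set dest: in_set_butlastD)
      then have "AA +> (last ps \<otimes> a \<otimes> E F (butlast ps)) = AA +> (a \<otimes> E F (butlast ps) \<otimes> last ps)"
        using a cos_commute[of "last ps" "a \<otimes> E F (butlast ps)"] by (simp add: A.m_assoc)
      moreover have "?m i = E F (butlast ps) \<otimes> last ps"
        using Suc True ps by (simp add: merged_def)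
      moreover have "fst t \<otimes> E F (snd t) = last ps \<otimes> a \<otimes> E F (butlast ps)"
        using True ps t by simp
      ultimately show ?thesis
        using a l by (simp add: A.m_assoc)
    next
      case False
      then show ?thesis using Suc i ps t by (simp add: merged_def)
    qed
  qed
  note hom = \<theta>_props(1)[OF F, of "r - 1"]
  have "\<theta> (r - 1) F (bfun r a ps)
      = (\<Oplus>\<^bsub>H.Q\<^esub>i\<in>{..r}. \<theta> (r - 1) F (sign i \<odot>\<^bsub>Chains (r - 1)\<^esub> hoch_pure k K A \<iota> (hoch_face A i (a, ps))))"
    unfolding bfun_def using a ps
    by (intro module_hom_finsum[OF hom module_Chains H.module_Q] Ch.smult_closed face_pure_closed) auto
  also have "\<dots> = (\<Oplus>\<^bsub>H.Q\<^esub>i\<in>{..r}. AA +> (sign i \<odot> (a \<otimes> ?m i)))"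
  proof (intro H.Q.finsum_cong')
    fix i assume "i \<in> {..r}"
    then have i: "i \<le> r" by simp
    let ?t = "hoch_face A i (a, ps)"
    have t: "fst ?t \<in> carrier A" "snd ?t \<in> tuples" "length (snd ?t) = r - 1"
      using face_closed[OF a ps(1), of i] i ps by auto
    have "\<theta> (r - 1) F (sign i \<odot>\<^bsub>Chains (r - 1)\<^esub> hoch_pure k K A \<iota> ?t)
        = sign i \<odot>\<^bsub>H.Q\<^esub> \<theta> (r - 1) F (pure (fst ?t) (snd ?t))"
      unfolding hoch_pure_eq using t by (intro module_homD(3)[OF hom]) auto
    also have "\<dots> = sign i \<odot>\<^bsub>H.Q\<^esub> (AA +> (a \<otimes> ?m i))"
      using t face[OF i refl] by (simp only: \<theta>_props(2)[OF F])
    also have "\<dots> = AA +> (sign i \<odot> (a \<otimes> ?m i))"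
      using a m_closed[OF i] by (intro H.cos_smult) auto
    finally show "\<theta> (r - 1) F (sign i \<odot>\<^bsub>Chains (r - 1)\<^esub> hoch_pure k K A \<iota> ?t) = AA +> (sign i \<odot> (a \<otimes> ?m i))" .
  next
    show "(\<lambda>i. AA +> (sign i \<odot> (a \<otimes> ?m i))) \<in> {..r} \<rightarrow> carrier H.Q"
      using a m_closed by (intro Pi_I H.cos_closed A.smult_closed) auto
  qed simp
  also have "\<dots> = AA +> (\<Oplus>i\<in>{..r}. sign i \<odot> (a \<otimes> ?m i))"
    using a m_closed by (intro H.cos_finsum) (auto intro!: A.smult_closed)
  also have "(\<Oplus>i\<in>{..r}. sign i \<odot> (a \<otimes> ?m i)) = (\<Oplus>i\<in>{..r}. a \<otimes> (sign i \<odot> ?m i))"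
    using a m_closed by (intro sum_cong) (auto simp: A.smult_mult_right)
  also have "\<dots> = a \<otimes> (\<Oplus>i\<in>{..r}. sign i \<odot> ?m i)"
    using a m_closed by (intro A.finsum_rdistr[symmetric]) auto
  also have "(\<Oplus>i\<in>{..r}. sign i \<odot> ?m i) = (\<Oplus>j\<in>{..length qs}. sign (Suc j) \<odot> ?m (Suc j)) \<oplus> sign 0 \<odot> ?m 0"
    unfolding r using m_closed r by (intro A.finsum_Suc2) (auto intro!: A.smult_closed)
  also have "(\<Oplus>j\<in>{..length qs}. sign (Suc j) \<odot> ?m (Suc j)) = (\<Oplus>j\<in>{..length qs}. \<ominus> (sign j \<odot> merged (E F) j ps))"
  proof (intro sum_cong)
    fix j assume "j \<in> {..length qs}"
    then have "merged (E F) j ps \<in> carrier A" using m_closed[of "Suc j"] r by simp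
    then show "sign (Suc j) \<odot> ?m (Suc j) = \<ominus> (sign j \<odot> merged (E F) j ps)"
      "\<ominus> (sign j \<odot> merged (E F) j ps) \<in> carrier A"
      by (simp_all only: sign_Suc nat.case) auto
  qed
  also have "\<dots> = \<ominus> (\<Oplus>j\<in>{..length qs}. sign j \<odot> merged (E F) j ps)"
    using ps r
    by (intro additive_finsum[OF A.abelian_monoid_axioms A.abelian_monoid_axioms, symmetric])
      (auto simp: A.minus_add intro!: A.smult_closed merged_closed)
  also have "(\<Oplus>j\<in>{..length qs}. sign j \<odot> merged (E F) j ps) = mid (E F) p qs"
    unfolding pq using p qs by (intro mid_eq_sum[symmetric]) auto
  also have "\<ominus> mid (E F) p qs \<oplus> sign 0 \<odot> ?m 0 = E (U.cob F) ps"
    unfolding pq E_cob[OF qs p] using p qs mid_closed[of qs p "E F"] by (simp add: A.minus_eq A.a_comm)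
  finally show ?thesis .
qed

abbreviation bdry :: "nat \<Rightarrow> ('b \<times> 'b set list \<Rightarrow> 'k) set \<Rightarrow> ('b \<times> 'b set list \<Rightarrow> 'k) set"
  where "bdry r \<equiv> hoch_boundary k K A \<iota> r"

text \<open>
  The description in the definition of the boundary denotes: a linear map with the prescribed values exists by
  \<open>multilinear_transpose\<close>, and pure tensors generate.
\<close>

lemma boundary:
  assumes r: "r > 0"
  shows "bdry r \<in> Defs.module_hom k (Chains r) (Chains (r - 1))"
    and "a \<in> carrier A \<Longrightarrow> ps \<in> tuples \<Longrightarrow> length ps = r \<Longrightarrow> bdry r (pure a ps) = bfun r a ps"
proof -
  let ?P = "\<lambda>b. b \<in> Defs.module_hom k (Chains r) (Chains (r - 1)) \<and>
      b \<in> extensional (carrier (Chains r)) \<and>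
      (\<forall>a\<in>carrier A. \<forall>as\<in>lists (carrier A). length as = r \<longrightarrow>
        b (hoch_pure k K A \<iota> (a, as)) = bfun r a as)"
  have closed: "bfun r a ps \<in> carrier (Chains (r - 1))"
    if "a \<in> carrier A" "ps \<in> tuples" "length ps = r" for a ps
    using that r by (rule bfun_closed)
  have transpose: "\<theta> (r - 1) F (bfun r a ps) = AA +> (a \<otimes> E (U.cob F) ps)"
    if "U.normalized F" "a \<in> carrier A" "ps \<in> tuples" "length ps = r" for F a ps
    using that r by (rule \<theta>_bfun)
  note ml = multilinear_transpose[of r "bfun r" "r - 1" U.cob, OF closed U.normalized_cob transpose]
  obtain h where h: "h \<in> Defs.module_hom k (Chains r) (Chains (r - 1))"
    "\<And>a ps. a \<in> carrier A \<Longrightarrow> ps \<in> tuples \<Longrightarrow> length ps = r \<Longrightarrow> h (pure a ps) = bfun r a ps"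
    using chain_lift[OF ml module_Chains] by blast
  let ?h = "restrict h (carrier (Chains r))"
  have h_hom: "?h \<in> Defs.module_hom k (Chains r) (Chains (r - 1))"
    using module_homD[OF h(1)] by (intro module_homI) simp_all
  have h_pure: "?h (hoch_pure k K A \<iota> (a, ps)) = bfun r a ps"
    if "a \<in> carrier A" "ps \<in> tuples" "length ps = r" for a ps
    using h(2)[OF that] pure_closed[OF that] by (simp add: pure_def)
  have ex: "?P ?h"
    by (intro conjI ballI impI h_hom h_pure restrict_extensional)
  have unique: "b = ?h" if b: "?P b" for b
  proof (rule extensionalityI[of _ "carrier (Chains r)"])
    fix c assume c: "c \<in> carrier (Chains r)"
    show "b c = ?h c"
    proof (rule chain_hom_eqI[OF conjunct1[OF b] h_hom module_Chains c])
      fix a ps assume *: "a \<in> carrier A" "ps \<in> tuples" "length ps = r"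
      have "b (pure a ps) = bfun r a ps"
        unfolding pure_def using b * by blast
      then show "b (pure a ps) = ?h (pure a ps)"
        using h_pure[OF *] by (simp only: pure_def)
    qed
  qed (use b in blast, rule restrict_extensional)
  have eq: "bdry r = (THE b. ?P b)"
    unfolding hoch_boundary_def bfun_def sign_def ..
  have *: "?P (bdry r)"
    unfolding eq by (rule theI[of ?P, OF ex unique])
  show "bdry r \<in> Defs.module_hom k (Chains r) (Chains (r - 1))" by (rule conjunct1[OF *])
  show "bdry r (pure a ps) = bfun r a ps" if "a \<in> carrier A" "ps \<in> tuples" "length ps = r" for a ps
    unfolding pure_def using * that by blast
qed

lemma bdry_closed: "c \<in> carrier (Chains (Suc r)) \<Longrightarrow> bdry (Suc r) c \<in> carrier (Chains r)"
  using module_homD(1)[OF boundary(1)[of "Suc r"]] by simp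

theorem \<theta>_boundary:
  assumes F: "U.normalized F" and c: "c \<in> carrier (Chains (Suc r))"
  shows "\<theta> r F (bdry (Suc r) c) = \<theta> (Suc r) (U.cob F) c"
proof -
  note d = boundary[of "Suc r", simplified]
  note cF = U.normalized_cob[OF F]
  show ?thesis
  proof (rule chain_hom_eqI[OF module_hom_compose[OF d(1) \<theta>_props(1)[OF F]] \<theta>_props(1)[OF cF] H.module_Q c])
    fix a ps assume "a \<in> carrier A" "ps \<in> tuples" "length ps = Suc r"
    then show "\<theta> r F (bdry (Suc r) (pure a ps)) = \<theta> (Suc r) (U.cob F) (pure a ps)"
      using \<theta>_bfun[OF F, of a ps "Suc r"] by (simp add: d(2) \<theta>_props(2)[OF cF])
  qed
qed

section \<open>Transposing the homotopy\<close>

lemma \<theta>_cong: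
  assumes F: "U.normalized F" and G: "U.normalized G" and c: "c \<in> carrier (Chains r)"
    and eq: "\<And>t. t \<in> U.idx \<Longrightarrow> length t = r \<Longrightarrow> F t = G t"
  shows "\<theta> r F c = \<theta> r G c"
proof (rule chain_hom_eqI[OF \<theta>_props(1)[OF F] \<theta>_props(1)[OF G] H.module_Q c])
  fix a ps assume "a \<in> carrier A" "ps \<in> tuples" "length ps = r"
  moreover from this have "E F ps = E G ps" by (intro E_cong eq) auto
  ultimately show "\<theta> r F (pure a ps) = \<theta> r G (pure a ps)"
    by (simp add: \<theta>_props(2)[OF F] \<theta>_props(2)[OF G])
qed

lemma H_add_hom:
  assumes f: "f \<in> Defs.module_hom k (Chains r) H.Q" and g: "g \<in> Defs.module_hom k (Chains r) H.Q"
  shows "(\<lambda>c. f c \<oplus>\<^bsub>H.Q\<^esub> g c) \<in> Defs.module_hom k (Chains r) H.Q"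
  by (rule module_homI)
    (simp_all add: module_homD[OF f] module_homD[OF g] H.Q.smult_r_distr H.Q.a_ac)

lemma normalized_add: "U.normalized F \<Longrightarrow> U.normalized G \<Longrightarrow> U.normalized (\<lambda>t. F t + G t)"
  and normalized_scale: "U.normalized F \<Longrightarrow> U.normalized (\<lambda>t. s * F t)"
  by (simp_all add: U.normalized_def)

lemma \<theta>_add:
  assumes F: "U.normalized F" and G: "U.normalized G" and c: "c \<in> carrier (Chains r)"
  shows "\<theta> r (\<lambda>t. F t + G t) c = \<theta> r F c \<oplus>\<^bsub>H.Q\<^esub> \<theta> r G c"
proof (rule chain_hom_eqI[OF \<theta>_props(1)[OF normalized_add[OF F G]]
      H_add_hom[OF \<theta>_props(1)[OF F] \<theta>_props(1)[OF G]] H.module_Q c])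
  fix a ps assume "a \<in> carrier A" "ps \<in> tuples" "length ps = r"
  then show "\<theta> r (\<lambda>t. F t + G t) (pure a ps) = \<theta> r F (pure a ps) \<oplus>\<^bsub>H.Q\<^esub> \<theta> r G (pure a ps)"
    by (simp add: \<theta>_props(2) normalized_add F G E_add H.cos_add A.r_distr)
qed

lemma \<eta>_hom: "(\<lambda>a. \<eta> s \<otimes> a) \<in> Defs.module_hom k A A"
  by (rule module_homI) (simp_all add: A.r_distr A.smult_mult_right)

lemma \<eta>_AA: "a \<in> AA \<Longrightarrow> \<eta> s \<otimes> a \<in> AA"
proof -
  assume a: "a \<in> AA"
  note hom = module_hom_compose[OF \<eta>_hom[of s] H.cos_hom]
  let ?ker = "{a \<in> carrier A. AA +> (\<eta> s \<otimes> a) = \<zero>\<^bsub>H.Q\<^esub>}"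
  have "submodule ?ker k A"
    by (rule module_hom_kernel[OF hom A.module_axioms H.module_Q])
  moreover have "b \<otimes> c \<ominus> c \<otimes> b \<in> ?ker" if b: "b \<in> carrier A" and c: "c \<in> carrier A" for b c
  proof -
    have "\<eta> s \<otimes> (b \<otimes> c \<ominus> c \<otimes> b) = (\<eta> s \<otimes> b) \<otimes> c \<ominus> c \<otimes> (\<eta> s \<otimes> b)"
      using b c ev.eval_central[of c s]
      by (simp add: A.minus_eq A.r_distr A.r_minus A.m_assoc[symmetric])
    also have "\<dots> \<in> AA" using b c by (intro commutator_in_AA) auto
    finally show ?thesis using b c H.cos_zero_iff by (simp add: H.zero_Q)
  qed
  ultimately have "AA \<subseteq> ?ker"
    unfolding AA_def commutator_submodule_def by (intro A.span_minimal) auto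
  then show ?thesis using a H.N_subset H.cos_zero_iff[of "\<eta> s \<otimes> a"] by (auto simp: H.zero_Q)
qed

text \<open>
  Multiplication by central elements preserves \<open>[A, A]\<close>, so that \<open>A/[A, A]\<close> is a module over the universal
  ring.
\<close>

lemma \<theta>_scale:
  assumes F: "U.normalized F" and c: "c \<in> carrier (Chains r)" and a: "a \<in> carrier A" "\<theta> r F c = AA +> a"
  shows "\<theta> r (\<lambda>t. s * F t) c = AA +> (\<eta> s \<otimes> a)"
proof -
  have "AA +> (\<eta> s \<otimes> a) = \<zero>\<^bsub>H.Q\<^esub>" if "a \<in> AA" for a
    using \<eta>_AA[OF that] that H.N_subset H.cos_zero_iff[of "\<eta> s \<otimes> a"] by (auto simp: H.zero_Q)
  then obtain m where m: "m \<in> Defs.module_hom k H.Q H.Q" "\<And>a. a \<in> carrier A \<Longrightarrow> m (AA +> a) = AA +> (\<eta> s \<otimes> a)"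
    using H.quotient_lift[OF module_hom_compose[OF \<eta>_hom[of s] H.cos_hom] H.module_Q] by blast
  have "\<theta> r (\<lambda>t. s * F t) c = m (\<theta> r F c)"
  proof (rule chain_hom_eqI[OF \<theta>_props(1)[OF normalized_scale[OF F]]
        module_hom_compose[OF \<theta>_props(1)[OF F] m(1)] H.module_Q c])
    fix b ps assume *: "b \<in> carrier A" "ps \<in> tuples" "length ps = r"
    then have "b \<otimes> (\<eta> s \<otimes> E F ps) = \<eta> s \<otimes> (b \<otimes> E F ps)"
      using ev.eval_central[of b s] by (simp add: A.m_assoc[symmetric])
    with * show "\<theta> r (\<lambda>t. s * F t) (pure b ps) = m (\<theta> r F (pure b ps))"
      by (simp add: \<theta>_props(2)[OF F] \<theta>_props(2)[OF normalized_scale[OF F]] E_scale m(2))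
  qed
  then show ?thesis using a by (simp add: m(2))
qed

lemma \<theta>_value:
  assumes "U.normalized F" "c \<in> carrier (Chains r)"
  obtains a where "a \<in> carrier A" "\<theta> r F c = AA +> a"
  using H.carrier_QE[OF module_homD(1)[OF \<theta>_props(1)[OF assms(1)] assms(2)]] by blast

lemma normalized_zero: "U.normalized (\<lambda>t. 0)"
  by (simp add: U.normalized_def)

lemma \<theta>_zero:
  assumes "c \<in> carrier (Chains r)"
  shows "\<theta> r (\<lambda>t. 0) c = \<zero>\<^bsub>H.Q\<^esub>"
proof -
  obtain a where a: "a \<in> carrier A" "\<theta> r (\<lambda>t. 0) c = AA +> a"
    using \<theta>_value[OF normalized_zero assms] .
  show ?thesis using \<theta>_scale[OF normalized_zero assms a, of 0] a by simp
qed

text \<open>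
  The functionals on cochains that are linear combinations of values at tuples of length \<open>r\<close>. These are
  the ones that can be represented by chains, see \<open>realize\<close>.
\<close>

inductive lincomb :: "nat \<Rightarrow> ((nat list \<Rightarrow> nat multiset \<Rightarrow>\<^sub>0 int) \<Rightarrow> nat multiset \<Rightarrow>\<^sub>0 int) \<Rightarrow> bool"
  for r where
    at: "t \<in> U.idx \<Longrightarrow> length t = r \<Longrightarrow> lincomb r (\<lambda>F. F t)"
  | zero: "lincomb r (\<lambda>F. 0)"
  | add: "lincomb r L \<Longrightarrow> lincomb r L' \<Longrightarrow> lincomb r (\<lambda>F. L F + L' F)"
  | scale: "lincomb r L \<Longrightarrow> lincomb r (\<lambda>F. s * L F)"

lemma lincomb_sum:
  "(\<And>i. i \<in> S \<Longrightarrow> lincomb r (L i)) \<Longrightarrow> lincomb r (\<lambda>F. \<Sum>i\<in>S. L i F)"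
  by (induction S rule: infinite_finite_induct) (auto intro: lincomb.zero lincomb.add)

lemma lincomb_ins: "lincomb r L \<Longrightarrow> lincomb (Suc r) (\<lambda>F. L (U.ins F P))"
proof (induction rule: lincomb.induct)
  case (at t)
  then show ?case
    unfolding U.ins_def by (intro lincomb_sum lincomb.scale lincomb.at) auto
qed (auto intro: lincomb.intros)

lemma lincomb_Cons: "lincomb r L \<Longrightarrow> i < n \<Longrightarrow> lincomb (Suc r) (\<lambda>F. L (\<lambda>t. F (i # t)))"
  using lincomb_ins[of r L "xpow i"] by simp

lemma lincomb_W: "lincomb r (U.W r)"
proof (induction r)
  case 0
  have "U.W 0 = (\<lambda>F. F [])" by (simp add: fun_eq_iff)
  then show ?case using lincomb.at[of "[]" 0] by simp
next
  case (Suc r)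
  have "U.W (Suc r) = (\<lambda>F. U.W r (U.ins F (U.stepel r)))" by (simp add: fun_eq_iff)
  then show ?case using lincomb_ins[OF Suc] by simp
qed

lemma lincomb_hmt: "t \<in> U.idx \<Longrightarrow> lincomb (Suc (length t)) (\<lambda>F. U.hmt F t)"
proof (induction t)
  case Nil
  then show ?case by (simp add: lincomb.zero)
next
  case (Cons i t)
  let ?L = "\<lambda>F. U.hmt (\<lambda>s. F (i # s)) t"
    and ?s = "if even (length t) then - U.psi_even t else 0"
    and ?L' = "\<lambda>F. U.W (Suc (length t)) (U.ins F (U.sd (xpow i)))"
  have "lincomb (Suc (Suc (length t))) (\<lambda>F. - 1 * ?L F + ?s * ?L' F)"
    using Cons by (intro lincomb.add lincomb.scale lincomb_Cons lincomb_ins[OF lincomb_W]) auto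
  moreover have "(\<lambda>F. - 1 * ?L F + ?s * ?L' F) = (\<lambda>F. U.hmt F (i # t))"
    by (simp add: fun_eq_iff del: U.W.simps)
  ultimately show ?case by (simp only: list.size add_0_right add_Suc_right)
qed

text \<open>
  The combination of the values at \<open>t\<close> with coefficients \<open>s\<^sub>t\<close> is represented by the sum of the chains
  \<open>s\<^sub>t a \<otimes> x\<^sup>t\<^sup>1 \<otimes> \<dots> \<otimes> x\<^sup>t\<^sup>r\<close>.
\<close>

lemma realize:
  assumes "lincomb r L"
  shows "a \<in> carrier A \<Longrightarrow> \<exists>z\<in>carrier (Chains r). \<forall>F. U.normalized F \<longrightarrow> \<theta> r F z = AA +> (\<eta> (L F) \<otimes> a)"
  using assms
proof (induction arbitrary: a rule: lincomb.induct)
  case (at t)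
  then show ?case
    by (intro bexI[of _ "pure a (mono t)"]) (auto simp: \<theta>_props(2) E_monomials ev.eval_central)
next
  case zero
  have "\<theta> r F \<zero>\<^bsub>Chains r\<^esub> = AA +> (\<eta> 0 \<otimes> a)" if "U.normalized F" for F
    using module_hom_zero[OF \<theta>_props(1)[OF that] module_Chains H.module_Q] zero by simp
  then show ?case by (intro bexI[of _ "\<zero>\<^bsub>Chains r\<^esub>"]) auto
next
  case (add L L')
  obtain y z where y: "y \<in> carrier (Chains r)" "\<And>F. U.normalized F \<Longrightarrow> \<theta> r F y = AA +> (\<eta> (L F) \<otimes> a)"
    and z: "z \<in> carrier (Chains r)" "\<And>F. U.normalized F \<Longrightarrow> \<theta> r F z = AA +> (\<eta> (L' F) \<otimes> a)"
    using add.IH[OF add.prems] by blast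
  have "\<theta> r F (y \<oplus>\<^bsub>Chains r\<^esub> z) = AA +> (\<eta> (L F + L' F) \<otimes> a)" if F: "U.normalized F" for F
    using y z add.prems F
    by (simp add: module_homD(2)[OF \<theta>_props(1)[OF F]] H.cos_add ev.eval_add A.l_distr)
  then show ?case using y z by (intro bexI[of _ "y \<oplus>\<^bsub>Chains r\<^esub> z"]) auto
next
  case (scale L s)
  obtain z where z: "z \<in> carrier (Chains r)" "\<And>F. U.normalized F \<Longrightarrow> \<theta> r F z = AA +> (\<eta> (L F) \<otimes> (\<eta> s \<otimes> a))"
    using scale.IH[of "\<eta> s \<otimes> a"] scale.prems by auto
  have "\<eta> (L F) \<otimes> (\<eta> s \<otimes> a) = \<eta> (s * L F) \<otimes> a" for F
    using scale.prems by (simp add: mult.commute[of s] ev.eval_mult A.m_assoc)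
  then show ?case using z by (intro bexI[of _ z]) auto
qed

text \<open>
  The transpose of the homotopy exists on chains: on the terms of a normal form it is given by \<open>realize\<close>.
\<close>

lemma homotopy_realize:
  assumes c: "c \<in> carrier (Chains r)"
  shows "\<exists>z\<in>carrier (Chains (Suc r)). \<forall>F. U.normalized F \<longrightarrow> \<theta> (Suc r) F z = \<theta> r (U.hmt F) c"
proof -
  obtain a where a: "\<And>t. t \<in> idx1 r \<Longrightarrow> a t \<in> carrier A"
    and c_eq: "c = (\<Oplus>\<^bsub>Chains r\<^esub>t\<in>idx1 r. pure (a t) (mono t))"
    using chain_normal_form[OF c] unfolding normal_form_def by blast
  have "\<exists>z. z \<in> carrier (Chains (Suc r)) \<and>
      (\<forall>F. U.normalized F \<longrightarrow> \<theta> (Suc r) F z = \<theta> r (U.hmt F) (pure (a t) (mono t)))"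
    if t: "t \<in> idx1 r" for t
  proof -
    have t': "t \<in> U.idx" "length t = r" using idx1_idx[OF t] by auto
    obtain z where z: "z \<in> carrier (Chains (Suc r))"
      "\<And>F. U.normalized F \<Longrightarrow> \<theta> (Suc r) F z = AA +> (\<eta> (U.hmt F t) \<otimes> a t)"
      using realize[OF lincomb_hmt[OF t'(1)] a[OF t]] t'(2) by auto
    have "\<theta> r (U.hmt F) (pure (a t) (mono t)) = AA +> (\<eta> (U.hmt F t) \<otimes> a t)" if "U.normalized F" for F
      using that t' a[OF t] by (simp add: \<theta>_props(2) U.normalized_hmt E_monomials ev.eval_central)
    then show ?thesis using z by auto
  qed
  then obtain z where z: "\<And>t. t \<in> idx1 r \<Longrightarrow> z t \<in> carrier (Chains (Suc r))"
    "\<And>t F. t \<in> idx1 r \<Longrightarrow> U.normalized F \<Longrightarrow> \<theta> (Suc r) F (z t) = \<theta> r (U.hmt F) (pure (a t) (mono t))"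
    by metis
  have "\<theta> (Suc r) F (\<Oplus>\<^bsub>Chains (Suc r)\<^esub>t\<in>idx1 r. z t) = \<theta> r (U.hmt F) c" if F: "U.normalized F" for F
  proof -
    note hF = U.normalized_hmt[OF F]
    have "\<theta> (Suc r) F (\<Oplus>\<^bsub>Chains (Suc r)\<^esub>t\<in>idx1 r. z t) = (\<Oplus>\<^bsub>H.Q\<^esub>t\<in>idx1 r. \<theta> (Suc r) F (z t))"
      using z(1) by (intro module_hom_finsum[OF \<theta>_props(1)[OF F] module_Chains H.module_Q])
    also have "\<dots> = (\<Oplus>\<^bsub>H.Q\<^esub>t\<in>idx1 r. \<theta> r (U.hmt F) (pure (a t) (mono t)))"
      using z F a by (intro H.Q.finsum_cong' Pi_I module_homD(1)[OF \<theta>_props(1)[OF hF]]) auto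
    also have "\<dots> = \<theta> r (U.hmt F) c"
      unfolding c_eq using a
      by (intro module_hom_finsum[OF \<theta>_props(1)[OF hF] module_Chains H.module_Q, symmetric]) auto
    finally show ?thesis .
  qed
  moreover have "(\<Oplus>\<^bsub>Chains (Suc r)\<^esub>t\<in>idx1 r. z t) \<in> carrier (Chains (Suc r))"
    using z(1) by (intro Ch.finsum_closed) auto
  ultimately show ?thesis by blast
qed

abbreviation Z :: "nat \<Rightarrow> ('b \<times> 'b set list \<Rightarrow> 'k) set set"
  where "Z r \<equiv> hoch_cycles k K A \<iota> r"

lemma Z_iff:
  "c \<in> Z r \<longleftrightarrow> c \<in> carrier (Chains r) \<and> (r = 0 \<or> bdry r c = \<zero>\<^bsub>Chains (r - 1)\<^esub>)"
  by (auto simp: hoch_cycles_def)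

lemma Z_submodule: "submodule (Z r) k (Chains r)"
proof (cases "r = 0")
  case True
  then show ?thesis using Ch.carrier_is_submodule by (simp add: hoch_cycles_def)
next
  case False
  then have r: "r > 0" by simp
  have "Z r = {c \<in> carrier (Chains r). bdry r c = \<zero>\<^bsub>Chains (r - 1)\<^esub>}"
    using False by (auto simp: hoch_cycles_def)
  then show ?thesis
    using module_hom_kernel[OF boundary(1)[OF r] module_Chains module_Chains] by (simp only:)
qed

lemma \<theta>_cycle:
  assumes F: "U.normalized F" and c: "c \<in> Z (Suc r)"
  shows "\<theta> (Suc r) (U.cob F) c = \<zero>\<^bsub>H.Q\<^esub>"
  using \<theta>_boundary[OF F, of c r] c module_hom_zero[OF \<theta>_props(1)[OF F] module_Chains H.module_Q]
  by (simp add: Z_iff)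

lemma bdry_cycle: "z \<in> carrier (Chains (Suc r)) \<Longrightarrow> bdry (Suc r) z \<in> Z r"
proof (cases r)
  case (Suc s)
  assume z: "z \<in> carrier (Chains (Suc r))"
  have "bdry (Suc s) (bdry (Suc r) z) = \<zero>\<^bsub>Chains s\<^esub>"
  proof (rule \<theta>_jointly_injective)
    fix F assume F: "U.normalized F"
    have "\<theta> s F (bdry (Suc s) (bdry (Suc r) z)) = \<theta> (Suc r) (U.cob (U.cob F)) z"
      using z bdry_closed[OF z] Suc by (simp add: \<theta>_boundary F U.normalized_cob)
    also have "U.cob (U.cob F) = (\<lambda>t. 0)" by (simp add: fun_eq_iff U.cob_cob)
    finally show "\<theta> s F (bdry (Suc s) (bdry (Suc r) z)) = \<zero>\<^bsub>H.Q\<^esub>"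
      using \<theta>_zero[OF z] by simp
  qed (use bdry_closed[OF bdry_closed[OF z, unfolded Suc]] Suc in simp)
  then show ?thesis using bdry_closed[OF z] Suc by (simp add: Z_iff)
qed (simp add: Z_iff bdry_closed)

text \<open>
  The homotopy formula, transposed to chains. At a cycle the term in which the coboundary comes last
  vanishes, and the other one is a boundary.
\<close>

theorem cycle_decomposition:
  assumes c: "c \<in> Z r" and a: "a \<in> carrier A" "\<theta> r U.psi c = AA +> a"
  shows "\<exists>z\<in>carrier (Chains (Suc r)). \<forall>F. U.normalized F \<longrightarrow>
    \<theta> r F c = \<theta> r F (bdry (Suc r) z) \<oplus>\<^bsub>H.Q\<^esub> (AA +> (\<eta> (U.W r F) \<otimes> a))"
proof -
  have cC: "c \<in> carrier (Chains r)" using c by (simp add: Z_iff)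
  obtain z where z: "z \<in> carrier (Chains (Suc r))"
    "\<And>F. U.normalized F \<Longrightarrow> \<theta> (Suc r) F z = \<theta> r (U.hmt F) c"
    using homotopy_realize[OF cC] by blast
  have "\<theta> r F c = \<theta> r F (bdry (Suc r) z) \<oplus>\<^bsub>H.Q\<^esub> (AA +> (\<eta> (U.W r F) \<otimes> a))" if F: "U.normalized F" for F
  proof -
    note psi = U.normalized_psi and hc = U.normalized_hmt[OF U.normalized_cob[OF F]]
      and ch = U.normalized_cob[OF U.normalized_hmt[OF F]]
    have ch_zero: "\<theta> r (U.cob (U.hmt F)) c = \<zero>\<^bsub>H.Q\<^esub>"
    proof (cases r)
      case 0
      then have "\<theta> r (U.cob (U.hmt F)) c = \<theta> r (\<lambda>t. 0) c"
        using cC by (intro \<theta>_cong[OF ch normalized_zero]) auto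
      then show ?thesis using \<theta>_zero[OF cC] by simp
    next
      case (Suc s)
      then show ?thesis using \<theta>_cycle[OF U.normalized_hmt[OF F], of c s] c by simp
    qed
    have "\<theta> r F c = \<theta> r (\<lambda>t. (U.hmt (U.cob F) t + U.cob (U.hmt F) t) + U.W r F * U.psi t) c"
    proof (rule \<theta>_cong[OF F _ cC])
      fix t assume "t \<in> U.idx" "length t = r"
      then show "F t = (U.hmt (U.cob F) t + U.cob (U.hmt F) t) + U.W r F * U.psi t"
        using U.homotopy[of t F] F by (simp add: diff_eq_eq)
    qed (intro normalized_add normalized_scale hc ch psi)
    also have "\<dots> = (\<theta> r (U.hmt (U.cob F)) c \<oplus>\<^bsub>H.Q\<^esub> \<theta> r (U.cob (U.hmt F)) c) \<oplus>\<^bsub>H.Q\<^esub>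
        \<theta> r (\<lambda>t. U.W r F * U.psi t) c"
      by (simp only: \<theta>_add[OF normalized_add[OF hc ch] normalized_scale[OF psi] cC] \<theta>_add[OF hc ch cC])
    also have "\<theta> r (\<lambda>t. U.W r F * U.psi t) c = AA +> (\<eta> (U.W r F) \<otimes> a)"
      by (rule \<theta>_scale[OF psi cC a])
    also have "\<theta> r (U.hmt (U.cob F)) c = \<theta> r F (bdry (Suc r) z)"
      using z(2)[OF U.normalized_cob[OF F]] \<theta>_boundary[OF F z(1)] by simp
    finally show ?thesis
      using ch_zero module_homD(1)[OF \<theta>_props(1)[OF F] bdry_closed[OF z(1)]] by simp
  qed
  then show ?thesis using z(1) by blast
qed

text \<open>
  The chain with first factor \<open>a\<close> whose further factors are the entries of the tuple of \<open>W\<close>.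
\<close>

lemma representative:
  assumes "a \<in> carrier A"
  shows "\<exists>z\<in>carrier (Chains r). (\<forall>F. U.normalized F \<longrightarrow> \<theta> r F z = AA +> (\<eta> (U.W r F) \<otimes> a))
    \<and> \<theta> r U.psi z = AA +> a"
proof -
  obtain z where z: "z \<in> carrier (Chains r)" "\<And>F. U.normalized F \<Longrightarrow> \<theta> r F z = AA +> (\<eta> (U.W r F) \<otimes> a)"
    using realize[OF lincomb_W assms] by blast
  moreover have "\<theta> r U.psi z = AA +> a"
    using z(2)[OF U.normalized_psi] assms by (simp add: U.W_psi del: U.W.simps)
  ultimately show ?thesis by blast
qed

abbreviation fprime :: 'b
  where "fprime \<equiv> \<eta> (U.deriv (univ_poly n))"

lemma \<theta>_bdry_representative:
  assumes a: "a \<in> carrier A" and z: "z \<in> carrier (Chains (Suc r))"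
    "\<And>F. U.normalized F \<Longrightarrow> \<theta> (Suc r) F z = AA +> (\<eta> (U.W (Suc r) F) \<otimes> a)" and F: "U.normalized F"
  shows "\<theta> r F (bdry (Suc r) z) = (if even r then \<zero>\<^bsub>H.Q\<^esub> else AA +> (\<eta> (U.W r F) \<otimes> (fprime \<otimes> a)))"
proof -
  have "\<theta> r F (bdry (Suc r) z) = AA +> (\<eta> (U.W (Suc r) (U.cob F)) \<otimes> a)"
    by (simp only: \<theta>_boundary[OF F z(1)] z(2)[OF U.normalized_cob[OF F]])
  moreover have "\<eta> (U.W (Suc r) (U.cob F)) \<otimes> a = \<eta> (U.W r F) \<otimes> (fprime \<otimes> a)" if "odd r"
  proof -
    have "U.W (Suc r) (U.cob F) = U.W r F * U.deriv (univ_poly n)"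
      using that by (simp add: U.W_cob mult.commute del: U.W.simps)
    then show ?thesis using a by (simp add: ev.eval_mult A.m_assoc del: U.W.simps)
  qed
  ultimately show ?thesis using a by (simp add: U.W_cob del: U.W.simps)
qed

lemma \<theta>_psi_bdry:
  assumes z: "z \<in> carrier (Chains (Suc r))" and a: "a \<in> carrier A" "\<theta> (Suc r) U.psi z = AA +> a"
  shows "\<theta> r U.psi (bdry (Suc r) z) = (if even r then \<zero>\<^bsub>H.Q\<^esub> else AA +> (fprime \<otimes> a))"
proof -
  note psi = U.normalized_psi
  have eq: "\<theta> r U.psi (bdry (Suc r) z) = \<theta> (Suc r) (U.cob U.psi) z"
    by (rule \<theta>_boundary[OF psi z])
  show ?thesis
  proof (cases "even r")
    case True
    have "\<theta> (Suc r) (U.cob U.psi) z = \<theta> (Suc r) (\<lambda>t. 0) z"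
      using True by (intro \<theta>_cong[OF U.normalized_cob[OF psi] normalized_zero z] U.cob_psi_odd_degree) auto
    then show ?thesis using eq True \<theta>_zero[OF z] by simp
  next
    case False
    have "\<theta> (Suc r) (U.cob U.psi) z = \<theta> (Suc r) (\<lambda>t. U.deriv (univ_poly n) * U.psi t) z"
      using False
      by (intro \<theta>_cong[OF U.normalized_cob[OF psi] normalized_scale[OF psi] z] U.cob_psi_even_degree) auto
    also have "\<dots> = AA +> (fprime \<otimes> a)" by (rule \<theta>_scale[OF psi z a])
    finally show ?thesis using eq False by simp
  qed
qed

section \<open>The homology\<close>

abbreviation Zm :: "nat \<Rightarrow> ('k, ('b \<times> 'b set list \<Rightarrow> 'k) set) module"
  where "Zm r \<equiv> (Chains r)\<lparr>carrier := Z r\<rparr>"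

abbreviation Bd :: "nat \<Rightarrow> ('b \<times> 'b set list \<Rightarrow> 'k) set set"
  where "Bd r \<equiv> bdry (Suc r) ` carrier (Chains (Suc r))"

lemma homology_eq: "hoch_homology k K A \<iota> r = quot_module (Zm r) (Bd r)"
  by (simp add: hoch_homology_def)

lemma module_Zm: "Module.module k (Zm r)"
  by (rule submodule.submodule_is_module[OF Z_submodule module_Chains])

lemma Bd_submodule: "submodule (Bd r) k (Zm r)"
proof (rule module.submoduleI'[OF module_Zm])
  note d = boundary(1)[of "Suc r", simplified]
  show "Bd r \<subseteq> carrier (Zm r)" using bdry_cycle by auto
  show "\<zero>\<^bsub>Zm r\<^esub> \<in> Bd r"
    using module_hom_zero[OF d module_Chains module_Chains]
    by (auto intro!: image_eqI[of _ _ "\<zero>\<^bsub>Chains (Suc r)\<^esub>"])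
  show "c \<oplus>\<^bsub>Zm r\<^esub> c' \<in> Bd r" if "c \<in> Bd r" "c' \<in> Bd r" for c c'
  proof -
    obtain z z' where z: "z \<in> carrier (Chains (Suc r))" "c = bdry (Suc r) z"
      "z' \<in> carrier (Chains (Suc r))" "c' = bdry (Suc r) z'" using \<open>c \<in> Bd r\<close> \<open>c' \<in> Bd r\<close> by auto
    then have "c \<oplus>\<^bsub>Zm r\<^esub> c' = bdry (Suc r) (z \<oplus>\<^bsub>Chains (Suc r)\<^esub> z')"
      by (simp add: module_homD(2)[OF d])
    then show ?thesis using z by simp
  qed
  show "s \<odot>\<^bsub>Zm r\<^esub> c \<in> Bd r" if "s \<in> carrier k" "c \<in> Bd r" for s c
  proof -
    obtain z where z: "z \<in> carrier (Chains (Suc r))" "c = bdry (Suc r) z" using \<open>c \<in> Bd r\<close> by auto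
    then have "s \<odot>\<^bsub>Zm r\<^esub> c = bdry (Suc r) (s \<odot>\<^bsub>Chains (Suc r)\<^esub> z)"
      using \<open>s \<in> carrier k\<close> by (simp add: module_homD(3)[OF d])
    then show ?thesis using z \<open>s \<in> carrier k\<close> by simp
  qed
qed

lemma homology_quotient: "module_quotient k (Zm r) (Bd r)"
  by (simp add: module_quotient_def module_quotient_axioms_def module_Zm Bd_submodule)

lemma \<theta>_psi_hom: "\<theta> r U.psi \<in> Defs.module_hom k (Zm r) H.Q"
  using module_homD[OF \<theta>_props(1)[OF U.normalized_psi]] by (intro module_homI) (auto simp: Z_iff)

text \<open>
  If the value at \<open>psi\<close> is zero, the decomposition exhibits the cycle as a boundary. Conversely, in an
  even degree the coboundary of \<open>psi\<close> vanishes.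
\<close>

lemma boundary_iff_even:
  assumes c: "c \<in> Z r" and r: "even r"
  shows "\<theta> r U.psi c = \<zero>\<^bsub>H.Q\<^esub> \<longleftrightarrow> c \<in> Bd r"
proof
  assume "\<theta> r U.psi c = \<zero>\<^bsub>H.Q\<^esub>"
  then have "\<theta> r U.psi c = AA +> \<zero>" by simp
  from cycle_decomposition[OF c A.zero_closed this]
  obtain z where z: "z \<in> carrier (Chains (Suc r))" "\<And>F. U.normalized F \<Longrightarrow>
    \<theta> r F c = \<theta> r F (bdry (Suc r) z) \<oplus>\<^bsub>H.Q\<^esub> (AA +> (\<eta> (U.W r F) \<otimes> \<zero>))" by blast
  have "c = bdry (Suc r) z"
  proof (rule chains_eqI[of _ r])
    fix F assume F: "U.normalized F"
    show "\<theta> r F c = \<theta> r F (bdry (Suc r) z)"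
      using z(2)[OF F] module_homD(1)[OF \<theta>_props(1)[OF F] bdry_closed[OF z(1)]] by simp
  qed (use c bdry_closed[OF z(1)] in \<open>auto simp: Z_iff\<close>)
  then show "c \<in> Bd r" using z(1) by auto
next
  assume "c \<in> Bd r"
  then obtain z where z: "z \<in> carrier (Chains (Suc r))" "c = bdry (Suc r) z" by auto
  obtain a where "a \<in> carrier A" "\<theta> (Suc r) U.psi z = AA +> a"
    using \<theta>_value[OF U.normalized_psi z(1)] .
  then show "\<theta> r U.psi c = \<zero>\<^bsub>H.Q\<^esub>"
    using \<theta>_psi_bdry[OF z(1)] z(2) r by simp
qed

text \<open>
  In all degrees the isomorphism is induced by \<open>\<theta>\<close> at \<open>psi\<close>.
\<close>

theorem homology_zero: "module_isomorphic k (hoch_homology k K A \<iota> 0) (quot_module A AA)"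
  unfolding homology_eq
proof (rule module_quotient.first_isomorphism[OF homology_quotient \<theta>_psi_hom H.module_Q])
  fix X assume "X \<in> carrier H.Q"
  then obtain a where a: "a \<in> carrier A" "X = AA +> a" by (rule H.carrier_QE)
  obtain z where "z \<in> carrier (Chains 0)"
    "\<And>F. U.normalized F \<Longrightarrow> \<theta> 0 F z = AA +> (\<eta> (U.W 0 F) \<otimes> a)" "\<theta> 0 U.psi z = AA +> a"
    using representative[OF a(1), of 0] by blast
  then show "\<exists>c\<in>carrier (Zm 0). \<theta> 0 U.psi c = X"
    using a by (intro bexI[of _ z]) (simp_all add: Z_iff)
next
  fix c assume "c \<in> carrier (Zm 0)"
  then show "\<theta> 0 U.psi c = \<zero>\<^bsub>H.Q\<^esub> \<longleftrightarrow> c \<in> Bd 0" by (intro boundary_iff_even) simp_all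
qed

definition annihilator :: "'b set"
  where "annihilator = {a \<in> carrier A. fprime \<otimes> a \<in> AA}"

lemma annihilator_submodule: "submodule annihilator k A"
proof -
  note hom = module_hom_compose[OF \<eta>_hom[of "U.deriv (univ_poly n)"] H.cos_hom]
  have "AA +> (fprime \<otimes> a) = \<zero>\<^bsub>H.Q\<^esub> \<longleftrightarrow> fprime \<otimes> a \<in> AA" if "a \<in> carrier A" for a
    unfolding H.zero_Q using that by (intro H.cos_zero_iff) simp
  then have "annihilator = {a \<in> carrier A. AA +> (fprime \<otimes> a) = \<zero>\<^bsub>H.Q\<^esub>}"
    unfolding annihilator_def by blast
  then show ?thesis
    using module_hom_kernel[OF hom A.module_axioms H.module_Q] by (rule ssubst)
qed

lemma quot_restrict:
  "quot_module (A\<lparr>carrier := T\<rparr>) AA = H.Q\<lparr>carrier := {AA +> a |a. a \<in> T}\<rparr>"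
proof -
  have coset: "a_r_coset (A\<lparr>carrier := T\<rparr>) = a_r_coset A"
    by (intro ext) (simp add: a_r_coset_def')
  have set_add: "set_add (A\<lparr>carrier := T\<rparr>) = set_add A"
    by (intro ext) (simp add: set_add_def')
  have "a_rcosets\<^bsub>A\<lparr>carrier := T\<rparr>\<^esub> AA = {AA +> a |a. a \<in> T}"
    unfolding A_RCOSETS_def' coset by auto
  then show ?thesis by (simp add: quot_module_def coset set_add)
qed

lemma quot_annihilator:
  "quot_module (A\<lparr>carrier := annihilator\<rparr>) AA = H.Q\<lparr>carrier := {AA +> a |a. a \<in> annihilator}\<rparr>"
  by (rule quot_restrict)

lemma module_quot_annihilator: "Module.module k (quot_module (A\<lparr>carrier := annihilator\<rparr>) AA)"
  unfolding quot_annihilator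
proof (rule submodule.submodule_is_module[OF _ H.module_Q], rule H.Q.submoduleI')
  note ann = A.submoduleE[OF annihilator_submodule]
  have closed: "a \<in> carrier A" if "a \<in> annihilator" for a using that ann(1) by auto
  show "{AA +> a |a. a \<in> annihilator} \<subseteq> carrier H.Q" using closed by auto
  have "\<zero> \<in> annihilator" using H.N_zero by (simp add: annihilator_def)
  then show "\<zero>\<^bsub>H.Q\<^esub> \<in> {AA +> a |a. a \<in> annihilator}"
    using H.cos_zero[symmetric] by blast
  show "X \<oplus>\<^bsub>H.Q\<^esub> Y \<in> {AA +> a |a. a \<in> annihilator}"
    if XY: "X \<in> {AA +> a |a. a \<in> annihilator}" "Y \<in> {AA +> a |a. a \<in> annihilator}" for X Y
  proof -
    obtain a b where ab: "a \<in> annihilator" "b \<in> annihilator" "X = AA +> a" "Y = AA +> b"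
      using XY by auto
    then have "X \<oplus>\<^bsub>H.Q\<^esub> Y = AA +> (a \<oplus> b)" by (simp add: closed H.cos_add)
    with ann(5)[OF ab(1,2)] show ?thesis by blast
  qed
  show "c \<odot>\<^bsub>H.Q\<^esub> X \<in> {AA +> a |a. a \<in> annihilator}"
    if c: "c \<in> carrier k" and X: "X \<in> {AA +> a |a. a \<in> annihilator}" for c X
  proof -
    obtain a where a: "a \<in> annihilator" "X = AA +> a" using X by auto
    then have "c \<odot>\<^bsub>H.Q\<^esub> X = AA +> (c \<odot> a)" using c by (simp add: closed H.cos_smult)
    with ann(4)[OF c a(1)] show ?thesis by blast
  qed
qed

text \<open>
  By \<open>\<theta>_psi_bdry\<close> the values at cycles are annihilated by \<open>f'\<close>; conversely, the representative of an element
  annihilated by \<open>f'\<close> is a cycle.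
\<close>

theorem homology_even:
  assumes r: "even r" "r > 0"
  shows "module_isomorphic k (hoch_homology k K A \<iota> r) (quot_module (A\<lparr>carrier := annihilator\<rparr>) AA)"
  unfolding homology_eq
proof (rule module_quotient.first_isomorphism[OF homology_quotient _ module_quot_annihilator])
  obtain s where s: "r = Suc s" using r by (cases r) auto
  let ?P = "quot_module (A\<lparr>carrier := annihilator\<rparr>) AA"
  have psi_value: "\<exists>a\<in>annihilator. \<theta> r U.psi c = AA +> a" if c: "c \<in> Z r" for c
  proof -
    have cC: "c \<in> carrier (Chains (Suc s))" using c s by (simp add: Z_iff)
    obtain a where a: "a \<in> carrier A" "\<theta> (Suc s) U.psi c = AA +> a"
      using \<theta>_value[OF U.normalized_psi cC] .
    have "bdry (Suc s) c = \<zero>\<^bsub>Chains s\<^esub>" using c s by (simp add: Z_iff)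
    then have "AA +> (fprime \<otimes> a) = \<zero>\<^bsub>H.Q\<^esub>"
      using \<theta>_psi_bdry[OF cC a] r s
        module_hom_zero[OF \<theta>_props(1)[OF U.normalized_psi] module_Chains H.module_Q, of s] by simp
    then have "fprime \<otimes> a \<in> AA"
      using a(1) H.cos_zero_iff[of "fprime \<otimes> a"] by (simp add: H.zero_Q)
    then show ?thesis
      using a s by (intro bexI[of _ a]) (simp_all add: annihilator_def)
  qed
  show "\<theta> r U.psi \<in> Defs.module_hom k (Zm r) ?P"
  proof (rule module_homI)
    fix c assume "c \<in> carrier (Zm r)"
    then have "\<exists>a\<in>annihilator. \<theta> r U.psi c = AA +> a" by (intro psi_value) simp
    then show "\<theta> r U.psi c \<in> carrier ?P" unfolding quot_annihilator by auto
  qed (simp_all add: quot_annihilator module_homD(2,3)[OF \<theta>_psi_hom, simplified])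
  show "\<exists>c\<in>carrier (Zm r). \<theta> r U.psi c = X" if X: "X \<in> carrier ?P" for X
  proof -
    obtain a where a: "a \<in> carrier A" "fprime \<otimes> a \<in> AA" "X = AA +> a"
      using X[unfolded quot_annihilator] by (auto simp: annihilator_def)
    obtain z where z: "z \<in> carrier (Chains (Suc s))"
      "\<And>F. U.normalized F \<Longrightarrow> \<theta> (Suc s) F z = AA +> (\<eta> (U.W (Suc s) F) \<otimes> a)"
      "\<theta> (Suc s) U.psi z = AA +> a"
      using representative[OF a(1), of "Suc s"] by blast
    have "bdry (Suc s) z = \<zero>\<^bsub>Chains s\<^esub>"
    proof (rule \<theta>_jointly_injective)
      fix F assume F: "U.normalized F"
      have "\<theta> s F (bdry (Suc s) z) = AA +> (\<eta> (U.W s F) \<otimes> (fprime \<otimes> a))"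
        using \<theta>_bdry_representative[OF a(1) z(1,2) F] r s by (simp del: U.W.simps)
      also have "\<dots> = \<zero>\<^bsub>H.Q\<^esub>"
        using \<eta>_AA[OF a(2)] a(1) by (simp add: H.zero_Q H.cos_zero_iff)
      finally show "\<theta> s F (bdry (Suc s) z) = \<zero>\<^bsub>H.Q\<^esub>" .
    qed (rule bdry_closed[OF z(1)])
    then show ?thesis using z a s by (intro bexI[of _ z]) (simp_all add: Z_iff)
  qed
  show "\<theta> r U.psi c = \<zero>\<^bsub>?P\<^esub> \<longleftrightarrow> c \<in> Bd r" if "c \<in> carrier (Zm r)" for c
    using that boundary_iff_even[OF _ r(1), of c] by (simp add: quot_annihilator)
qed

definition comm_deriv :: "'b set"
  where "comm_deriv = AA <+> (fprime <# carrier A)"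

lemma comm_deriv_iff: "a \<in> comm_deriv \<longleftrightarrow> (\<exists>d\<in>AA. \<exists>b\<in>carrier A. a = d \<oplus> fprime \<otimes> b)"
  by (auto simp: comm_deriv_def set_add_def' l_coset_def)

lemma comm_deriv_submodule: "submodule comm_deriv k A"
proof (rule A.submoduleI')
  have AA: "d \<in> carrier A" if "d \<in> AA" for d using that H.N_subset by auto
  show "comm_deriv \<subseteq> carrier A" using AA by (auto simp: comm_deriv_iff)
  show "\<zero> \<in> comm_deriv" unfolding comm_deriv_iff
    by (intro bexI[of _ \<zero>]) (simp_all add: H.N_zero)
  show "a \<oplus> a' \<in> comm_deriv" if aa: "a \<in> comm_deriv" "a' \<in> comm_deriv" for a a'
  proof -
    obtain d b d' b' where *: "d \<in> AA" "b \<in> carrier A" "a = d \<oplus> fprime \<otimes> b"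
      "d' \<in> AA" "b' \<in> carrier A" "a' = d' \<oplus> fprime \<otimes> b'"
      using aa unfolding comm_deriv_iff by blast
    then have "a \<oplus> a' = (d \<oplus> d') \<oplus> fprime \<otimes> (b \<oplus> b')"
      using AA by (simp add: A.r_distr A.a_ac)
    then show ?thesis using * H.N_add unfolding comm_deriv_iff by blast
  qed
  show "c \<odot> a \<in> comm_deriv" if c: "c \<in> carrier k" and a: "a \<in> comm_deriv" for c a
  proof -
    obtain d b where *: "d \<in> AA" "b \<in> carrier A" "a = d \<oplus> fprime \<otimes> b"
      using a unfolding comm_deriv_iff by blast
    then have "c \<odot> a = c \<odot> d \<oplus> fprime \<otimes> (c \<odot> b)"
      using AA c by (simp add: A.smult_r_distr A.smult_mult_right)
    then show ?thesis using * c H.N_smult unfolding comm_deriv_iff by blast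
  qed
qed

sublocale D: module_quotient k A comm_deriv
  by (simp add: module_quotient_def module_quotient_axioms_def A.module_axioms comm_deriv_submodule)

text \<open>
  All representatives are cycles here. The boundaries of representatives one degree higher account for the
  multiples of \<open>f'\<close>.
\<close>

theorem homology_odd:
  assumes r: "odd r"
  shows "module_isomorphic k (hoch_homology k K A \<iota> r) (quot_module A comm_deriv)"
proof -
  have "AA \<subseteq> comm_deriv"
  proof
    fix d assume "d \<in> AA"
    then show "d \<in> comm_deriv" unfolding comm_deriv_iff
      using H.N_subset by (intro bexI[of _ d] bexI[of _ \<zero>]) auto
  qed
  then have "comm_deriv +> a = \<zero>\<^bsub>D.Q\<^esub>" if "a \<in> AA" for a
    unfolding D.zero_Q using that H.N_subset by (subst D.cos_zero_iff) auto
  then obtain p where p: "p \<in> Defs.module_hom k H.Q D.Q" "\<And>a. a \<in> carrier A \<Longrightarrow> p (AA +> a) = comm_deriv +> a"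
    using H.quotient_lift[OF D.cos_hom D.module_Q] by blast
  let ?h = "\<lambda>c. p (\<theta> r U.psi c)"
  show ?thesis
    unfolding homology_eq
  proof (rule module_quotient.first_isomorphism[OF homology_quotient _ D.module_Q])
    show "?h \<in> Defs.module_hom k (Zm r) D.Q"
      by (rule module_hom_compose[OF \<theta>_psi_hom p(1)])
    show "\<exists>c\<in>carrier (Zm r). ?h c = X" if X: "X \<in> carrier D.Q" for X
    proof -
      obtain a where a: "a \<in> carrier A" "X = comm_deriv +> a" using X by (rule D.carrier_QE)
      obtain s where s: "r = Suc s" using r by (cases r) auto
      obtain z where z: "z \<in> carrier (Chains (Suc s))"
        "\<And>F. U.normalized F \<Longrightarrow> \<theta> (Suc s) F z = AA +> (\<eta> (U.W (Suc s) F) \<otimes> a)"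
        "\<theta> (Suc s) U.psi z = AA +> a"
        using representative[OF a(1), of "Suc s"] by blast
      have "bdry (Suc s) z = \<zero>\<^bsub>Chains s\<^esub>"
      proof (rule \<theta>_jointly_injective)
        fix F assume F: "U.normalized F"
        show "\<theta> s F (bdry (Suc s) z) = \<zero>\<^bsub>H.Q\<^esub>"
          using \<theta>_bdry_representative[OF a(1) z(1,2) F] r s by simp
      qed (rule bdry_closed[OF z(1)])
      then show ?thesis using z a s p(2) by (intro bexI[of _ z]) (simp_all add: Z_iff)
    qed
    show "?h c = \<zero>\<^bsub>D.Q\<^esub> \<longleftrightarrow> c \<in> Bd r" if "c \<in> carrier (Zm r)" for c
    proof
      have c: "c \<in> Z r" using that by simp
      then have cC: "c \<in> carrier (Chains r)" by (simp add: Z_iff)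
      obtain a where a: "a \<in> carrier A" "\<theta> r U.psi c = AA +> a"
        using \<theta>_value[OF U.normalized_psi cC] .
      assume "?h c = \<zero>\<^bsub>D.Q\<^esub>"
      then have "a \<in> comm_deriv" using a p(2) by (simp add: D.zero_Q D.cos_zero_iff)
      then obtain d b where b: "d \<in> AA" "b \<in> carrier A" "a = d \<oplus> fprime \<otimes> b"
        by (auto simp: comm_deriv_iff)
      have d: "d \<in> carrier A" using b H.N_subset by auto
      have "a \<ominus> fprime \<otimes> b = d"
        using b d by (simp add: A.minus_eq A.a_assoc A.r_neg)
      then have "\<theta> r U.psi c = AA +> (fprime \<otimes> b)"
        using a b by (simp add: H.cos_eq_iff)
      from cycle_decomposition[OF c _ this] b obtain z where z: "z \<in> carrier (Chains (Suc r))"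
        "\<And>F. U.normalized F \<Longrightarrow> \<theta> r F c
          = \<theta> r F (bdry (Suc r) z) \<oplus>\<^bsub>H.Q\<^esub> (AA +> (\<eta> (U.W r F) \<otimes> (fprime \<otimes> b)))"
        by auto
      obtain w where w: "w \<in> carrier (Chains (Suc r))"
        "\<And>F. U.normalized F \<Longrightarrow> \<theta> (Suc r) F w = AA +> (\<eta> (U.W (Suc r) F) \<otimes> b)"
        "\<theta> (Suc r) U.psi w = AA +> b"
        using representative[OF b(2), of "Suc r"] by blast
      note hom = boundary(1)[of "Suc r", simplified]
      have "c = bdry (Suc r) (z \<oplus>\<^bsub>Chains (Suc r)\<^esub> w)"
      proof (rule chains_eqI[of _ r])
        fix F assume F: "U.normalized F"
        have "\<theta> r F (bdry (Suc r) w) = AA +> (\<eta> (U.W r F) \<otimes> (fprime \<otimes> b))"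
          using \<theta>_bdry_representative[OF b(2) w(1,2) F] r by (simp del: U.W.simps)
        then show "\<theta> r F c = \<theta> r F (bdry (Suc r) (z \<oplus>\<^bsub>Chains (Suc r)\<^esub> w))"
          using z w(1) F
          by (simp add: module_homD(2)[OF hom] module_homD(2)[OF \<theta>_props(1)[OF F]] bdry_closed del: U.W.simps)
      qed (use cC z w bdry_closed in auto)
      then show "c \<in> Bd r" using z w by auto
    next
      assume "c \<in> Bd r"
      then obtain z where z: "z \<in> carrier (Chains (Suc r))" "c = bdry (Suc r) z" by auto
      obtain a where a: "a \<in> carrier A" "\<theta> (Suc r) U.psi z = AA +> a"
        using \<theta>_value[OF U.normalized_psi z(1)] .
      have "?h c = comm_deriv +> (fprime \<otimes> a)"
        using \<theta>_psi_bdry[OF z(1) a] z(2) r a p(2) by simp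
      moreover have "fprime \<otimes> a \<in> comm_deriv" unfolding comm_deriv_iff
        using a by (intro bexI[of _ \<zero>] bexI[of _ a]) (auto simp: H.N_zero)
      ultimately show "?h c = \<zero>\<^bsub>D.Q\<^esub>" using a by (simp add: D.zero_Q D.cos_zero_iff)
    qed
  qed
qed

lemma fprime_eq: "fprime = (\<Oplus>i\<in>{1..n}. [i] \<cdot> (\<iota> (lam (n - i)) \<otimes> x [^] (i - 1)))"
proof -
  let ?c = "\<lambda>i. coeff (univ_poly n) i" and ?g = "\<lambda>i. [i] \<cdot> (\<iota> (lam (n - i)) \<otimes> x [^] (i - 1))"
  have "univ_poly n = (\<Sum>i\<le>n. smult (?c i) (xpow i))"
    using poly_as_sum_of_monoms[of "univ_poly n"] U.degree_f by (simp add: smult_monom)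
  then have "U.deriv (univ_poly n) = U.deriv (\<Sum>i\<le>n. smult (?c i) (xpow i))"
    by (rule arg_cong)
  also have "\<dots> = (\<Sum>i\<le>n. ?c i * (of_nat i * var 0 ^ (i - 1)))"
    by (simp add: U.deriv_sum U.deriv_smult U.deriv_xpow)
  finally have "fprime = (\<Oplus>i\<in>{..n}. \<eta> (?c i * (of_nat i * var 0 ^ (i - 1))))"
    by (simp add: ev.eval_sum)
  also have "\<dots> = (\<Oplus>i\<in>{..n}. ?g i)"
  proof (intro sum_cong)
    fix i assume "i \<in> {..n}"
    then show "\<eta> (?c i * (of_nat i * var 0 ^ (i - 1))) = ?g i" "?g i \<in> carrier A"
      by (simp_all add: ev.eval_mult \<eta>_coeff ev.eval_of_nat \<eta>_y A.add_pow_ldistr A.add_pow_rdistr)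
  qed
  also have "{..n} = insert 0 {1..n}" by auto
  also have "(\<Oplus>i\<in>insert 0 {1..n}. ?g i) = ?g 0 \<oplus> (\<Oplus>i\<in>{1..n}. ?g i)"
    by (rule A.finsum_insert) auto
  finally show ?thesis by simp
qed

end

section \<open>Polynomials over the base algebra\<close>

lemma ring_cong:
  fixes R :: "('a, 'm) ring_scheme" and S :: "('a, 'n) ring_scheme"
  assumes R: "ring R" and carr: "carrier S = carrier R"
    and mult: "\<And>a b. a \<in> carrier R \<Longrightarrow> b \<in> carrier R \<Longrightarrow> a \<otimes>\<^bsub>S\<^esub> b = a \<otimes>\<^bsub>R\<^esub> b"
    and add: "\<And>a b. a \<in> carrier R \<Longrightarrow> b \<in> carrier R \<Longrightarrow> a \<oplus>\<^bsub>S\<^esub> b = a \<oplus>\<^bsub>R\<^esub> b"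
    and one: "\<one>\<^bsub>S\<^esub> = \<one>\<^bsub>R\<^esub>" and zero: "\<zero>\<^bsub>S\<^esub> = \<zero>\<^bsub>R\<^esub>"
  shows "ring S"
proof -
  interpret R: ring R by fact
  show ?thesis
  proof (intro ringI abelian_groupI monoidI)
    fix a assume "a \<in> carrier S"
    then show "\<exists>b\<in>carrier S. b \<oplus>\<^bsub>S\<^esub> a = \<zero>\<^bsub>S\<^esub>"
      by (intro bexI[of _ "\<ominus>\<^bsub>R\<^esub> a"]) (simp_all add: carr add zero R.l_neg)
  qed (simp_all add: carr mult add one zero R.a_ac R.m_assoc R.l_distr R.r_distr)
qed

locale central_polynomial = monogenic_data k K \<alpha> n lam
  for k :: "('k, 'c) ring_scheme" and K :: "('k, 'a, 'd) module_scheme" (structure)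
    and \<alpha> :: "'a \<Rightarrow> 'a" and n :: nat and lam :: "nat \<Rightarrow> 'a" +
  assumes \<alpha>_id: "u \<in> carrier K \<Longrightarrow> \<alpha> u = u"
begin

abbreviation B :: "('k, nat \<Rightarrow> 'a) module"
  where "B \<equiv> ore_ext K \<alpha>"

lemma \<alpha>_pow_id: "u \<in> carrier K \<Longrightarrow> (\<alpha> ^^ i) u = u"
  by (induction i) (simp_all add: \<alpha>_id)

lemma carrier_B: "carrier B = up K"
  and zero_B: "\<zero>\<^bsub>B\<^esub> = (\<lambda>i. \<zero>)"
  and one_B: "\<one>\<^bsub>B\<^esub> = (\<lambda>i. if i = 0 then \<one> else \<zero>)"
  and add_B: "p \<oplus>\<^bsub>B\<^esub> q = (\<lambda>i. p i \<oplus> q i)"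
  and smult_B: "c \<odot>\<^bsub>B\<^esub> p = (\<lambda>i. c \<odot>\<^bsub>K\<^esub> p i)"
  by (simp_all add: ore_ext_def)

lemma coefficient_closed [simp]: "p \<in> carrier B \<Longrightarrow> p i \<in> carrier K"
  by (auto simp: carrier_B)

lemma mult_B:
  "q \<in> carrier B \<Longrightarrow> p \<otimes>\<^bsub>B\<^esub> q = (\<lambda>m. \<Oplus>i\<in>{..m}. p i \<otimes> q (m - i))"
  by (simp add: ore_ext_def \<alpha>_pow_id)

lemma ring_B: "ring B"
proof (rule ring_cong[of "UP K"])
  have "UP_ring K" by (simp add: UP_ring_def M.ring_axioms)
  then show "ring (UP K)" by (rule UP_ring.UP_ring)
  fix p q assume "p \<in> carrier (UP K)" "q \<in> carrier (UP K)"
  then show "p \<otimes>\<^bsub>B\<^esub> q = p \<otimes>\<^bsub>UP K\<^esub> q" "p \<oplus>\<^bsub>B\<^esub> q = p \<oplus>\<^bsub>UP K\<^esub> q"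
    by (simp_all add: UP_def mult_B carrier_B add_B)
qed (simp_all add: UP_def carrier_B one_B zero_B)

sublocale B: ring B
  by (rule ring_B)

lemma eventually_zero: "p \<in> carrier B \<Longrightarrow> \<exists>N. \<forall>i>N. p i = \<zero>"
  unfolding carrier_B up_def bound_def by blast

lemma B_I: "(\<And>i. p i \<in> carrier K) \<Longrightarrow> \<forall>i>N. p i = \<zero> \<Longrightarrow> p \<in> carrier B"
  unfolding carrier_B up_def bound_def by blast

lemma uminus_B: "p \<in> carrier B \<Longrightarrow> \<ominus>\<^bsub>B\<^esub> p = (\<lambda>i. \<ominus> (p i))"
proof -
  assume p: "p \<in> carrier B"
  then obtain N where "\<forall>i>N. p i = \<zero>" using eventually_zero by blast
  then have "(\<lambda>i. \<ominus> (p i)) \<in> carrier B" using p by (intro B_I[of _ N]) auto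
  moreover have "(\<lambda>i. \<ominus> (p i)) \<oplus>\<^bsub>B\<^esub> p = \<zero>\<^bsub>B\<^esub>"
    unfolding add_B zero_B using p by (intro ext) (simp add: M.l_neg)
  ultimately show ?thesis
    using p by (intro B.minus_equality)
qed

lemma minus_B: "p \<in> carrier B \<Longrightarrow> q \<in> carrier B \<Longrightarrow> p \<ominus>\<^bsub>B\<^esub> q = (\<lambda>i. p i \<ominus> q i)"
  by (simp add: B.minus_eq M.minus_eq uminus_B add_B)

lemma module_B: "Module.module k B"
proof (rule moduleI)
  show "cring k" using module_axioms by (simp add: Module.module_def)
  show "abelian_group B" by (rule B.abelian_group_axioms)
  show "c \<odot>\<^bsub>B\<^esub> p \<in> carrier B" if cp: "c \<in> carrier k" "p \<in> carrier B" for c p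
  proof -
    obtain N where "\<forall>i>N. p i = \<zero>" using eventually_zero[OF cp(2)] by blast
    then show ?thesis using cp unfolding smult_B by (intro B_I[of _ N]) auto
  qed
  fix p assume p: "p \<in> carrier B"
  show "\<one>\<^bsub>k\<^esub> \<odot>\<^bsub>B\<^esub> p = p" using p by (simp add: smult_B)
  fix c d assume c: "c \<in> carrier k" and d: "d \<in> carrier k"
  show "(c \<oplus>\<^bsub>k\<^esub> d) \<odot>\<^bsub>B\<^esub> p = c \<odot>\<^bsub>B\<^esub> p \<oplus>\<^bsub>B\<^esub> d \<odot>\<^bsub>B\<^esub> p"
    using c d p by (simp add: smult_B add_B smult_l_distr)
  show "c \<otimes>\<^bsub>k\<^esub> d \<odot>\<^bsub>B\<^esub> p = c \<odot>\<^bsub>B\<^esub> (d \<odot>\<^bsub>B\<^esub> p)"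
    using c d p by (simp add: smult_B smult_assoc1)
  fix q assume q: "q \<in> carrier B"
  show "c \<odot>\<^bsub>B\<^esub> (p \<oplus>\<^bsub>B\<^esub> q) = c \<odot>\<^bsub>B\<^esub> p \<oplus>\<^bsub>B\<^esub> c \<odot>\<^bsub>B\<^esub> q"
    using c p q by (simp add: smult_B add_B smult_r_distr)
qed

sublocale Bm: Module.module k B
  by (rule module_B)

lemma coefficient_finsum:
  "(\<And>j. j \<in> S \<Longrightarrow> g j \<in> carrier B) \<Longrightarrow> (\<Oplus>\<^bsub>B\<^esub>j\<in>S. g j) i = (\<Oplus>j\<in>S. g j i)"
  by (rule additive_finsum[OF B.abelian_monoid_axioms M.abelian_monoid_axioms, where h = "\<lambda>p. p i"])
    (auto simp: zero_B add_B)

definition mono :: "'a \<Rightarrow> nat \<Rightarrow> nat \<Rightarrow> 'a"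
  where "mono u m = (\<lambda>i. if i = m then u else \<zero>)"

lemma mono_closed [simp]: "u \<in> carrier K \<Longrightarrow> mono u m \<in> carrier B"
  by (rule B_I[of _ m]) (auto simp: mono_def)

lemma const_eq: "ore_const K u = mono u 0" and var_eq: "ore_var K = mono \<one> 1"
  by (auto simp: ore_const_def ore_var_def mono_def)

lemma mono_mult:
  assumes u: "u \<in> carrier K" and p: "p \<in> carrier B"
  shows "mono u m \<otimes>\<^bsub>B\<^esub> p = (\<lambda>i. if m \<le> i then u \<otimes> p (i - m) else \<zero>)"
proof
  fix i
  have "(mono u m \<otimes>\<^bsub>B\<^esub> p) i = (\<Oplus>j\<in>{..i}. if m = j then u \<otimes> p (i - j) else \<zero>)"
    unfolding mult_B[OF p] using u p by (intro M.finsum_cong') (auto simp: mono_def)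
  also have "\<dots> = (if m \<le> i then u \<otimes> p (i - m) else \<zero>)"
  proof (cases "m \<le> i")
    case True
    then show ?thesis
      using M.finsum_singleton[of m "{..i}" "\<lambda>j. u \<otimes> p (i - j)"] u p by auto
  next
    case False
    then have "(\<Oplus>j\<in>{..i}. if m = j then u \<otimes> p (i - j) else \<zero>) = (\<Oplus>j\<in>{..i}. \<zero>)"
      by (intro M.finsum_cong') auto
    then show ?thesis using False by simp
  qed
  finally show "(mono u m \<otimes>\<^bsub>B\<^esub> p) i = (if m \<le> i then u \<otimes> p (i - m) else \<zero>)" .
qed

lemma mult_reverse:
  assumes p: "p \<in> carrier B" and q: "q \<in> carrier B"
  shows "(p \<otimes>\<^bsub>B\<^esub> q) m = (\<Oplus>i\<in>{..m}. p (m - i) \<otimes> q i)"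
proof -
  have inj: "inj_on (\<lambda>i. m - i) {..m}" by (auto simp: inj_on_def)
  have img: "(\<lambda>i. m - i) ` {..m} = {..m}"
  proof
    show "{..m} \<subseteq> (\<lambda>i. m - i) ` {..m}"
    proof
      fix i assume "i \<in> {..m}"
      then show "i \<in> (\<lambda>i. m - i) ` {..m}" by (intro image_eqI[of _ _ "m - i"]) auto
    qed
  qed auto
  have "(p \<otimes>\<^bsub>B\<^esub> q) m = (\<Oplus>i\<in>(\<lambda>i. m - i) ` {..m}. p i \<otimes> q (m - i))"
    using mult_B[OF q] img by simp
  also have "\<dots> = (\<Oplus>i\<in>{..m}. p (m - i) \<otimes> q (m - (m - i)))"
    using p q inj by (intro M.finsum_reindex) auto
  also have "\<dots> = (\<Oplus>i\<in>{..m}. p (m - i) \<otimes> q i)"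
    using p q by (intro M.finsum_cong') auto
  finally show ?thesis .
qed

lemma mult_commute:
  assumes "p \<in> carrier B" "q \<in> carrier B" and "\<And>i j. p i \<otimes> q j = q j \<otimes> p i"
  shows "p \<otimes>\<^bsub>B\<^esub> q = q \<otimes>\<^bsub>B\<^esub> p"
proof
  fix m
  show "(p \<otimes>\<^bsub>B\<^esub> q) m = (q \<otimes>\<^bsub>B\<^esub> p) m"
    unfolding mult_reverse[OF assms(1,2)] mult_B[OF assms(1)]
    by (rule M.finsum_cong'[OF refl _ assms(3)]) (use assms(1,2) in auto)
qed

lemma mult_const:
  assumes u: "u \<in> carrier K" and p: "p \<in> carrier B"
  shows "p \<otimes>\<^bsub>B\<^esub> mono u 0 = (\<lambda>i. p i \<otimes> u)"
proof
  fix i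
  have "(p \<otimes>\<^bsub>B\<^esub> mono u 0) i = (\<Oplus>j\<in>{..i}. if 0 = j then p (i - j) \<otimes> u else \<zero>)"
    unfolding mult_reverse[OF p mono_closed[OF u]] using u p
    by (intro M.finsum_cong') (auto simp: mono_def)
  also have "\<dots> = p i \<otimes> u"
    using M.finsum_singleton[of 0 "{..i}" "\<lambda>j. p (i - j) \<otimes> u"] u p by auto
  finally show "(p \<otimes>\<^bsub>B\<^esub> mono u 0) i = p i \<otimes> u" .
qed

lemma var_pow: "ore_var K [^]\<^bsub>B\<^esub> (m::nat) = mono \<one> m"
proof (induction m)
  case 0
  then show ?case by (auto simp: one_B mono_def)
next
  case (Suc m)
  have "ore_var K [^]\<^bsub>B\<^esub> Suc m = mono \<one> m \<otimes>\<^bsub>B\<^esub> mono \<one> 1" using Suc by (simp add: var_eq)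
  also have "\<dots> = mono \<one> (Suc m)"
    unfolding mono_mult[OF M.one_closed mono_closed[OF M.one_closed]] by (auto simp: mono_def fun_eq_iff)
  finally show ?case .
qed

lemma const_var_pow: "u \<in> carrier K \<Longrightarrow> ore_const K u \<otimes>\<^bsub>B\<^esub> (ore_var K [^]\<^bsub>B\<^esub> (m::nat)) = mono u m"
proof -
  assume u: "u \<in> carrier K"
  show ?thesis
    unfolding const_eq var_pow mono_mult[OF u mono_closed[OF M.one_closed]]
    using u by (auto simp: mono_def fun_eq_iff)
qed

abbreviation f :: "nat \<Rightarrow> 'a"
  where "f \<equiv> mono_poly K \<alpha> n lam"

lemma sum_monos:
  assumes "\<And>j. j \<le> m \<Longrightarrow> c j \<in> carrier K"
  shows "(\<Oplus>\<^bsub>B\<^esub>j\<in>{..m}. mono (c j) j) = (\<lambda>i. if i \<le> m then c i else \<zero>)"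
proof
  fix i
  have "(\<Oplus>\<^bsub>B\<^esub>j\<in>{..m}. mono (c j) j) i = (\<Oplus>j\<in>{..m}. if i = j then c j else \<zero>)"
  proof (subst coefficient_finsum)
    show "(\<Oplus>j\<in>{..m}. mono (c j) j i) = (\<Oplus>j\<in>{..m}. if i = j then c j else \<zero>)"
      using assms by (intro M.finsum_cong') (auto simp: mono_def)
  qed (use assms in simp)
  also have "\<dots> = (if i \<le> m then c i else \<zero>)"
  proof (cases "i \<le> m")
    case True
    then show ?thesis using M.finsum_singleton[of i "{..m}" c] assms by auto
  next
    case False
    then have "(\<Oplus>j\<in>{..m}. if i = j then c j else \<zero>) = (\<Oplus>j\<in>{..m}. \<zero>)"
      by (intro M.finsum_cong') auto
    then show ?thesis using False by simp
  qed
  finally show "(\<Oplus>\<^bsub>B\<^esub>j\<in>{..m}. mono (c j) j) i = (if i \<le> m then c i else \<zero>)" .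
qed

lemma f_sum: "f = (\<Oplus>\<^bsub>B\<^esub>j\<in>{..n}. mono (lam (n - j)) j)"
proof -
  have inj: "inj_on (\<lambda>i. n - i) {..n}" by (auto simp: inj_on_def)
  have img: "(\<lambda>i. n - i) ` {..n} = {0..n}"
  proof
    show "{0..n} \<subseteq> (\<lambda>i. n - i) ` {..n}"
    proof
      fix i assume "i \<in> {0..n}"
      then show "i \<in> (\<lambda>i. n - i) ` {..n}" by (intro image_eqI[of _ _ "n - i"]) auto
    qed
  qed auto
  have "f = (\<Oplus>\<^bsub>B\<^esub>i\<in>(\<lambda>i. n - i) ` {..n}. mono (lam i) (n - i))"
    unfolding mono_poly_def img using lam_closed
    by (intro B.finsum_cong') (auto simp: const_var_pow)
  also have "\<dots> = (\<Oplus>\<^bsub>B\<^esub>j\<in>{..n}. mono (lam (n - j)) (n - (n - j)))"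
    using inj lam_closed by (intro B.finsum_reindex) auto
  also have "\<dots> = (\<Oplus>\<^bsub>B\<^esub>j\<in>{..n}. mono (lam (n - j)) j)"
    using lam_closed by (intro B.finsum_cong') auto
  finally show ?thesis .
qed

lemma f_coefficient: "f = (\<lambda>i. if i \<le> n then lam (n - i) else \<zero>)"
  unfolding f_sum by (rule sum_monos) (simp add: lam_closed)

lemma f_closed [simp]: "f \<in> carrier B"
  unfolding f_coefficient by (rule B_I[of _ n]) (auto simp: lam_closed)

lemma lam_central: "i \<le> n \<Longrightarrow> u \<in> carrier K \<Longrightarrow> lam i \<otimes> u = u \<otimes> lam i"
  using lam_twist[of i u] by (cases "i = 0") (auto simp: lam_zero \<alpha>_pow_id)

lemma f_central: "p \<in> carrier B \<Longrightarrow> f \<otimes>\<^bsub>B\<^esub> p = p \<otimes>\<^bsub>B\<^esub> f"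
proof (rule mult_commute)
  fix i j assume "p \<in> carrier B"
  then have "lam (n - i) \<otimes> p j = p j \<otimes> lam (n - i)" by (intro lam_central) auto
  then show "f i \<otimes> p j = p j \<otimes> f i" using \<open>p \<in> carrier B\<close> by (simp add: f_coefficient)
qed simp_all

abbreviation I :: "(nat \<Rightarrow> 'a) set"
  where "I \<equiv> mono_ideal K \<alpha> n lam"

lemma ideal_I: "ideal I B"
  unfolding mono_ideal_def by (rule B.genideal_ideal) simp

sublocale I: ideal I B
  by (rule ideal_I)

text \<open>
  As \<open>f\<close> is central, its left multiples form a two-sided ideal.
\<close>

lemma I_multiples: "I \<subseteq> (\<lambda>q. q \<otimes>\<^bsub>B\<^esub> f) ` carrier B"
  unfolding mono_ideal_def
proof (rule B.genideal_minimal)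
  let ?J = "(\<lambda>q. q \<otimes>\<^bsub>B\<^esub> f) ` carrier B"
  have J: "q \<otimes>\<^bsub>B\<^esub> f \<in> ?J" if "q \<in> carrier B" for q
    using that by (rule imageI)
  have "\<one>\<^bsub>B\<^esub> \<otimes>\<^bsub>B\<^esub> f = f" by simp
  then show "{f} \<subseteq> ?J" using J[of "\<one>\<^bsub>B\<^esub>"] by simp
  show "ideal ?J B"
  proof (rule idealI[OF ring_B])
    show "subgroup ?J (add_monoid B)"
    proof (rule B.add.subgroupI)
      show "?J \<subseteq> carrier B" by (rule image_subsetI) simp
      show "?J \<noteq> {}" using J[of "\<one>\<^bsub>B\<^esub>"] by blast
      fix a assume "a \<in> ?J"
      then obtain q where q: "q \<in> carrier B" "a = q \<otimes>\<^bsub>B\<^esub> f" by (rule imageE)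
      have "\<ominus>\<^bsub>B\<^esub> a = (\<ominus>\<^bsub>B\<^esub> q) \<otimes>\<^bsub>B\<^esub> f" using q by (simp add: B.l_minus)
      then show "\<ominus>\<^bsub>B\<^esub> a \<in> ?J" using J[of "\<ominus>\<^bsub>B\<^esub> q"] q(1) by simp
      fix b assume "b \<in> ?J"
      then obtain r where r: "r \<in> carrier B" "b = r \<otimes>\<^bsub>B\<^esub> f" by (rule imageE)
      have "a \<oplus>\<^bsub>B\<^esub> b = (q \<oplus>\<^bsub>B\<^esub> r) \<otimes>\<^bsub>B\<^esub> f" using q r by (simp add: B.l_distr)
      then show "a \<oplus>\<^bsub>B\<^esub> b \<in> ?J" using J[of "q \<oplus>\<^bsub>B\<^esub> r"] q(1) r(1) by simp
    qed
    fix a p assume a: "a \<in> ?J" and p: "p \<in> carrier B"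
    obtain q where q: "q \<in> carrier B" "a = q \<otimes>\<^bsub>B\<^esub> f" using a by (rule imageE)
    have "p \<otimes>\<^bsub>B\<^esub> a = (p \<otimes>\<^bsub>B\<^esub> q) \<otimes>\<^bsub>B\<^esub> f" "a \<otimes>\<^bsub>B\<^esub> p = (q \<otimes>\<^bsub>B\<^esub> p) \<otimes>\<^bsub>B\<^esub> f"
      unfolding q(2) using p q(1) f_central[OF p] by (simp_all add: B.m_assoc)
    then show "p \<otimes>\<^bsub>B\<^esub> a \<in> ?J" "a \<otimes>\<^bsub>B\<^esub> p \<in> ?J"
      using J[of "p \<otimes>\<^bsub>B\<^esub> q"] J[of "q \<otimes>\<^bsub>B\<^esub> p"] p q(1) by simp_all
  qed
qed

lemma f_in_I: "f \<in> I"
  unfolding mono_ideal_def by (rule B.genideal_self') simp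

text \<open>
  A nonzero multiple of a monic polynomial has at least its degree.
\<close>

lemma low_degree_I:
  assumes p: "p \<in> I" and low: "\<forall>i\<ge>n. p i = \<zero>"
  shows "p = (\<lambda>i. \<zero>)"
proof -
  obtain q where q: "q \<in> carrier B" "p = q \<otimes>\<^bsub>B\<^esub> f"
    using subsetD[OF I_multiples p] by (rule imageE)
  have "q i = \<zero>" for i
  proof (rule ccontr)
    assume i: "q i \<noteq> \<zero>"
    obtain N where N: "\<forall>i>N. q i = \<zero>" using eventually_zero[OF q(1)] by blast
    have "{i. q i \<noteq> \<zero>} \<subseteq> {..N}"
    proof
      fix j assume "j \<in> {i. q i \<noteq> \<zero>}"
      then have "q j \<noteq> \<zero>" by (rule CollectD)
      then have "\<not> j > N" using spec[OF N, of j] by argo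
      then show "j \<in> {..N}" by simp
    qed
    then have fin: "finite {i. q i \<noteq> \<zero>}" by (rule finite_subset) simp
    define d where "d = Max {i. q i \<noteq> \<zero>}"
    have "d \<in> {i. q i \<noteq> \<zero>}" unfolding d_def 
    proof (rule Max_in[OF fin])
      have "i \<in> {i. q i \<noteq> \<zero>}" using i by (rule CollectI)
      then show "{i. q i \<noteq> \<zero>} \<noteq> {}" by (metis empty_iff)
    qed
    then have d: "q d \<noteq> \<zero>" by (rule CollectD)
    have above: "q j = \<zero>" if "j > d" for j
    proof (rule ccontr)
      assume "q j \<noteq> \<zero>"
      then have "j \<le> d" unfolding d_def by (intro Max_ge[OF fin]) simp
      then show False using that by simp
    qed
    have "p (d + n) = (\<Oplus>j\<in>{..d + n}. q j \<otimes> f (d + n - j))"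
      unfolding q(2) mult_B[OF f_closed] ..
    also have "\<dots> = (\<Oplus>j\<in>{..d + n}. if d = j then q j else \<zero>)"
    proof (intro M.finsum_cong')
      fix j assume j: "j \<in> {..d + n}"
      have fj: "f (d + n - j) \<in> carrier K" by simp
      consider "j < d" | "j = d" | "j > d" by linarith
      then show "q j \<otimes> f (d + n - j) = (if d = j then q j else \<zero>)"
      proof cases
        assume "j < d"
        then have "\<not> d + n - j \<le> n" by simp
        then show ?thesis using q(1) \<open>j < d\<close> by (simp add: f_coefficient)
      next
        assume "j = d"
        then show ?thesis using q(1) by (simp add: f_coefficient lam_zero)
      next
        assume "j > d"
        then show ?thesis using above[of j] fj by simp
      qed
    qed (use q(1) in auto)
    also have "\<dots> = q d"
      using q(1) by (intro M.finsum_singleton) auto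
    finally show False using low d by simp
  qed
  then have "q = \<zero>\<^bsub>B\<^esub>" unfolding zero_B by (intro ext)
  then have "p = \<zero>\<^bsub>B\<^esub>" unfolding q(2) by simp
  then show ?thesis unfolding zero_B .
qed

text \<open>
  Induction on a bound for the degree: the term of highest degree is removed by subtracting a multiple of
  \<open>f\<close>.
\<close>

lemma division:
  assumes "p \<in> carrier B"
  shows "\<exists>r\<in>carrier B. (\<forall>i\<ge>n. r i = \<zero>) \<and> p \<ominus>\<^bsub>B\<^esub> r \<in> I"
proof -
  have minus_self: "p \<ominus>\<^bsub>B\<^esub> p = \<zero>\<^bsub>B\<^esub>" if "p \<in> carrier B" for p
    using that by (simp only: B.minus_eq B.r_neg)
  have "\<exists>r\<in>carrier B. (\<forall>i\<ge>n. r i = \<zero>) \<and> p \<ominus>\<^bsub>B\<^esub> r \<in> I" if "p \<in> carrier B" "\<forall>i\<ge>N. p i = \<zero>" for N p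
    using that
  proof (induction N arbitrary: p)
    case 0
    have "p \<ominus>\<^bsub>B\<^esub> p \<in> I" unfolding minus_self[OF 0(1)] by simp
    then show ?case using 0 by blast
  next
    case (Suc N)
    show ?case
    proof (cases "N < n")
      case True
      then show ?thesis using Suc.prems minus_self[of p] by (intro bexI[of _ p]) simp_all
    next
      case False
      let ?m = "mono (p N) (N - n) \<otimes>\<^bsub>B\<^esub> f"
      have m: "?m = (\<lambda>i. if N - n \<le> i then p N \<otimes> f (i - (N - n)) else \<zero>)"
        using Suc.prems by (intro mono_mult) auto
      have mI: "?m \<in> I" using f_in_I Suc.prems by (intro I.I_l_closed) auto
      have mB: "?m \<in> carrier B" using Suc.prems by auto
      have "(p \<ominus>\<^bsub>B\<^esub> ?m) i = \<zero>" if "i \<ge> N" for i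
      proof (cases "i = N")
        case True
        then have "?m i = p N" unfolding m using False Suc.prems by (simp add: f_coefficient lam_zero)
        then show ?thesis using True Suc.prems mB by (simp add: minus_B M.minus_eq M.r_neg)
      next
        case neq: False
        then have i: "N - n \<le> i" "\<not> i - (N - n) \<le> n" using that False by auto
        have "?m i = \<zero>" unfolding m using i Suc.prems(1) by (simp add: f_coefficient)
        moreover have "p i = \<zero>" using Suc.prems(2) that neq by simp
        ultimately have "p i = \<zero>" "?m i = \<zero>" by simp_all
        then show ?thesis using Suc.prems mB by (simp add: minus_B M.minus_eq M.r_neg)
      qed
      then obtain r where r: "r \<in> carrier B" "\<forall>i\<ge>n. r i = \<zero>" "p \<ominus>\<^bsub>B\<^esub> ?m \<ominus>\<^bsub>B\<^esub> r \<in> I"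
        using Suc.IH[of "p \<ominus>\<^bsub>B\<^esub> ?m"] Suc.prems mB by auto
      have "p \<ominus>\<^bsub>B\<^esub> r = (p \<ominus>\<^bsub>B\<^esub> ?m \<ominus>\<^bsub>B\<^esub> r) \<oplus>\<^bsub>B\<^esub> ?m"
      proof -
        have "(x \<oplus>\<^bsub>B\<^esub> y) \<oplus>\<^bsub>B\<^esub> z \<oplus>\<^bsub>B\<^esub> w = x \<oplus>\<^bsub>B\<^esub> z \<oplus>\<^bsub>B\<^esub> (y \<oplus>\<^bsub>B\<^esub> w)"
          if "x \<in> carrier B" "y \<in> carrier B" "z \<in> carrier B" "w \<in> carrier B" for x y z w
          using that by (simp add: B.a_ac)
        then show ?thesis using Suc.prems mB r(1) by (simp add: B.minus_eq B.l_neg)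
      qed
      also have "\<dots> \<in> I" using r(3) mI by (rule I.a_closed)
      finally show ?thesis using r by blast
    qed
  qed
  moreover obtain N where "\<forall>i>N. p i = \<zero>" using eventually_zero[OF assms] by blast
  then have "\<forall>i\<ge>Suc N. p i = \<zero>" by (simp add: Suc_le_eq)
  ultimately show ?thesis using assms by blast
qed

lemma I_submodule: "submodule I k B"
proof (rule Bm.submoduleI')
  show "c \<odot>\<^bsub>B\<^esub> p \<in> I" if cp: "c \<in> carrier k" "p \<in> I" for c p
  proof -
    have p: "p \<in> carrier B" using cp I.a_subset by auto
    have "c \<odot>\<^bsub>B\<^esub> p = mono (c \<odot>\<^bsub>K\<^esub> \<one>) 0 \<otimes>\<^bsub>B\<^esub> p"
      using cp(1) p by (simp add: mono_mult smult_B smult_mult_left)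
    then show ?thesis using cp by (auto intro!: I.I_l_closed)
  qed
qed (use I.a_subset in auto)

sublocale IQ: module_quotient k B I
  by (simp add: module_quotient_def module_quotient_axioms_def module_B I_submodule)

section \<open>The monogenic extension\<close>

abbreviation A :: "('k, (nat \<Rightarrow> 'a) set) module"
  where "A \<equiv> monogenic_ext K \<alpha> n lam"

abbreviation cls :: "(nat \<Rightarrow> 'a) \<Rightarrow> (nat \<Rightarrow> 'a) set"
  where "cls p \<equiv> mono_class K \<alpha> n lam p"

lemma carrier_A: "carrier A = carrier IQ.Q" and zero_A: "\<zero>\<^bsub>A\<^esub> = \<zero>\<^bsub>IQ.Q\<^esub>"
  and add_A: "X \<oplus>\<^bsub>A\<^esub> Y = X \<oplus>\<^bsub>IQ.Q\<^esub> Y" and smult_A: "c \<odot>\<^bsub>A\<^esub> X = c \<odot>\<^bsub>IQ.Q\<^esub> X"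
  by (simp_all add: monogenic_ext_def quot_algebra_def quot_module_def)

lemma ring_A: "ring A"
  by (rule ring_cong[OF I.quotient_is_ring])
    (simp_all add: monogenic_ext_def quot_algebra_def FactRing_def)

lemma cls_closed [simp]: "p \<in> carrier B \<Longrightarrow> cls p \<in> carrier A"
  unfolding mono_class_def carrier_A by (rule IQ.cos_closed)

lemma carrier_AE:
  assumes "X \<in> carrier A" obtains p where "p \<in> carrier B" "X = cls p"
  using assms unfolding mono_class_def carrier_A by (rule IQ.carrier_QE)

lemma cls_add: "p \<in> carrier B \<Longrightarrow> q \<in> carrier B \<Longrightarrow> cls (p \<oplus>\<^bsub>B\<^esub> q) = cls p \<oplus>\<^bsub>A\<^esub> cls q"
  unfolding mono_class_def add_A by (rule IQ.cos_add[symmetric])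

lemma cls_smult: "c \<in> carrier k \<Longrightarrow> p \<in> carrier B \<Longrightarrow> cls (c \<odot>\<^bsub>B\<^esub> p) = c \<odot>\<^bsub>A\<^esub> cls p"
  unfolding mono_class_def smult_A by (rule IQ.cos_smult[symmetric])

lemma cls_zero: "cls \<zero>\<^bsub>B\<^esub> = \<zero>\<^bsub>A\<^esub>"
  unfolding mono_class_def zero_A by (rule IQ.cos_zero)

lemma cls_one: "cls \<one>\<^bsub>B\<^esub> = \<one>\<^bsub>A\<^esub>"
  by (simp add: mono_class_def monogenic_ext_def quot_algebra_def)

lemma cls_mult:
  assumes "p \<in> carrier B" "q \<in> carrier B"
  shows "cls (p \<otimes>\<^bsub>B\<^esub> q) = cls p \<otimes>\<^bsub>A\<^esub> cls q"
proof -
  have "cls p \<otimes>\<^bsub>A\<^esub> cls q = rcoset_mult B I (cls p) (cls q)"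
    by (simp add: monogenic_ext_def quot_algebra_def)
  then show ?thesis unfolding mono_class_def by (simp only: I.rcoset_mult_add[OF assms])
qed

lemma cls_eq_iff: "p \<in> carrier B \<Longrightarrow> q \<in> carrier B \<Longrightarrow> cls p = cls q \<longleftrightarrow> p \<ominus>\<^bsub>B\<^esub> q \<in> I"
  unfolding mono_class_def by (rule IQ.cos_eq_iff)

lemma module_A: "Module.module k A"
proof (rule moduleI)
  show "cring k" by (rule R.is_cring)
  show "abelian_group A" using ring_A by (rule ring.is_abelian_group)
qed (simp_all add: carrier_A add_A smult_A IQ.Q.smult_l_distr IQ.Q.smult_r_distr IQ.Q.smult_assoc1)

lemma smult_eq_mult:
  assumes c: "c \<in> carrier k" and p: "p \<in> carrier B"
  shows "mono (c \<odot>\<^bsub>K\<^esub> \<one>) 0 \<otimes>\<^bsub>B\<^esub> p = c \<odot>\<^bsub>B\<^esub> p" "p \<otimes>\<^bsub>B\<^esub> mono (c \<odot>\<^bsub>K\<^esub> \<one>) 0 = c \<odot>\<^bsub>B\<^esub> p"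
  using assms by (simp_all add: mono_mult mult_const smult_B smult_mult_left smult_mult_right)

lemma algebra_A: "assoc_algebra k A"
proof (rule assoc_algebra.intro[OF module_A ring_A], rule assoc_algebra_axioms.intro)
  fix c X Y assume c: "c \<in> carrier k" and X: "X \<in> carrier A" and Y: "Y \<in> carrier A"
  obtain p where p: "p \<in> carrier B" "X = cls p" using X by (rule carrier_AE)
  obtain q where q: "q \<in> carrier B" "Y = cls q" using Y by (rule carrier_AE)
  let ?e = "mono (c \<odot>\<^bsub>K\<^esub> \<one>) 0"
  have e: "?e \<in> carrier B" using c by simp
  have "(c \<odot>\<^bsub>B\<^esub> p) \<otimes>\<^bsub>B\<^esub> q = ?e \<otimes>\<^bsub>B\<^esub> p \<otimes>\<^bsub>B\<^esub> q" using smult_eq_mult(1)[OF c p(1)] by simp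
  also have "\<dots> = c \<odot>\<^bsub>B\<^esub> (p \<otimes>\<^bsub>B\<^esub> q)" using smult_eq_mult(1)[OF c, of "p \<otimes>\<^bsub>B\<^esub> q"] e p q by (simp add: B.m_assoc)
  finally have l: "(c \<odot>\<^bsub>B\<^esub> p) \<otimes>\<^bsub>B\<^esub> q = c \<odot>\<^bsub>B\<^esub> (p \<otimes>\<^bsub>B\<^esub> q)" .
  have "p \<otimes>\<^bsub>B\<^esub> (c \<odot>\<^bsub>B\<^esub> q) = p \<otimes>\<^bsub>B\<^esub> ?e \<otimes>\<^bsub>B\<^esub> q"
    using smult_eq_mult(1)[OF c q(1)] e p q by (simp add: B.m_assoc)
  also have "\<dots> = c \<odot>\<^bsub>B\<^esub> (p \<otimes>\<^bsub>B\<^esub> q)" using smult_eq_mult(2)[OF c p(1)] l by simp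
  finally have r: "p \<otimes>\<^bsub>B\<^esub> (c \<odot>\<^bsub>B\<^esub> q) = c \<odot>\<^bsub>B\<^esub> (p \<otimes>\<^bsub>B\<^esub> q)" .
  have smult: "c \<odot>\<^bsub>B\<^esub> s \<in> carrier B" if "s \<in> carrier B" for s
    using c that by (rule Bm.smult_closed)
  show "(c \<odot>\<^bsub>A\<^esub> X) \<otimes>\<^bsub>A\<^esub> Y = c \<odot>\<^bsub>A\<^esub> (X \<otimes>\<^bsub>A\<^esub> Y)"
    unfolding p(2) q(2) cls_smult[OF c p(1), symmetric] cls_mult[OF p(1) q(1), symmetric]
      cls_mult[OF smult[OF p(1)] q(1), symmetric] l
    using c p(1) q(1) by (simp add: cls_smult)
  show "X \<otimes>\<^bsub>A\<^esub> (c \<odot>\<^bsub>A\<^esub> Y) = c \<odot>\<^bsub>A\<^esub> (X \<otimes>\<^bsub>A\<^esub> Y)"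
    unfolding p(2) q(2) cls_smult[OF c q(1), symmetric] cls_mult[OF p(1) q(1), symmetric]
      cls_mult[OF p(1) smult[OF q(1)], symmetric] r
    using c p(1) q(1) by (simp add: cls_smult)
qed

sublocale A: assoc_algebra k A
  by (rule algebra_A)

lemma cls_finsum:
  "(\<And>j. j \<in> S \<Longrightarrow> g j \<in> carrier B) \<Longrightarrow> cls (\<Oplus>\<^bsub>B\<^esub>j\<in>S. g j) = (\<Oplus>\<^bsub>A\<^esub>j\<in>S. cls (g j))"
  by (rule additive_finsum[OF B.abelian_monoid_axioms A.abelian_monoid_axioms])
    (simp_all add: cls_zero cls_add)

lemma cls_pow: "p \<in> carrier B \<Longrightarrow> cls (p [^]\<^bsub>B\<^esub> (m::nat)) = cls p [^]\<^bsub>A\<^esub> m"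
  by (induction m) (simp_all add: cls_one cls_mult)

lemma cls_multiple: "p \<in> carrier B \<Longrightarrow> cls ([(m::nat)] \<cdot>\<^bsub>B\<^esub> p) = [m] \<cdot>\<^bsub>A\<^esub> cls p"
  by (induction m) (simp_all add: cls_zero cls_add)

abbreviation \<iota> :: "'a \<Rightarrow> (nat \<Rightarrow> 'a) set"
  where "\<iota> \<equiv> mono_incl K \<alpha> n lam"

abbreviation x :: "(nat \<Rightarrow> 'a) set"
  where "x \<equiv> cls (mono \<one> (Suc 0))"

lemma \<iota>_eq: "\<iota> u = cls (mono u 0)"
  by (simp add: mono_incl_def const_eq)

lemma cls_mono: "u \<in> carrier K \<Longrightarrow> cls (mono u m) = \<iota> u \<otimes>\<^bsub>A\<^esub> x [^]\<^bsub>A\<^esub> m"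
  using const_var_pow[of u m] cls_mult[of "mono u 0" "mono \<one> (Suc 0) [^]\<^bsub>B\<^esub> m"] cls_pow[of "mono \<one> (Suc 0)" m]
  by (simp add: \<iota>_eq const_eq var_eq)

lemma \<iota>_hom: "\<iota> \<in> algebra_hom k K A"
proof -
  have "mono (u \<otimes> v) 0 = mono u 0 \<otimes>\<^bsub>B\<^esub> mono v 0" if "u \<in> carrier K" "v \<in> carrier K" for u v
    unfolding mono_mult[OF that(1) mono_closed[OF that(2)]] using that by (auto simp: mono_def fun_eq_iff)
  moreover have "mono (u \<oplus> v) 0 = mono u 0 \<oplus>\<^bsub>B\<^esub> mono v 0" if "u \<in> carrier K" "v \<in> carrier K" for u v
    unfolding add_B using that by (auto simp: mono_def fun_eq_iff)
  moreover have "mono (c \<odot>\<^bsub>K\<^esub> u) 0 = c \<odot>\<^bsub>B\<^esub> mono u 0" if "c \<in> carrier k" "u \<in> carrier K" for c u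
    unfolding smult_B using that by (auto simp: mono_def fun_eq_iff)
  moreover have "mono \<one> 0 = \<one>\<^bsub>B\<^esub>"
    unfolding one_B by (auto simp: mono_def)
  ultimately show ?thesis
    unfolding algebra_hom_def
    by (intro IntI ring_hom_memI module_homI) (simp_all add: \<iota>_eq cls_mult cls_add cls_smult cls_one)
qed

lemma x_central: "X \<in> carrier A \<Longrightarrow> x \<otimes>\<^bsub>A\<^esub> X = X \<otimes>\<^bsub>A\<^esub> x"
proof (elim carrier_AE)
  fix p assume p: "p \<in> carrier B" "X = cls p"
  have "mono \<one> (Suc 0) \<otimes>\<^bsub>B\<^esub> p = p \<otimes>\<^bsub>B\<^esub> mono \<one> (Suc 0)"
  proof (rule mult_commute)
    show "mono \<one> (Suc 0) i \<otimes> p j = p j \<otimes> mono \<one> (Suc 0) i" for i j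
      using p(1) by (simp add: mono_def)
  qed (use p in simp_all)
  then show ?thesis
    using p(1) cls_mult[of "mono \<one> (Suc 0)" p] cls_mult[of p "mono \<one> (Suc 0)"] unfolding p(2) by simp
qed

lemma equation: "(\<Oplus>\<^bsub>A\<^esub>j\<in>{..n}. \<iota> (lam (n - j)) \<otimes>\<^bsub>A\<^esub> x [^]\<^bsub>A\<^esub> j) = \<zero>\<^bsub>A\<^esub>"
proof -
  have "(\<Oplus>\<^bsub>A\<^esub>j\<in>{..n}. \<iota> (lam (n - j)) \<otimes>\<^bsub>A\<^esub> x [^]\<^bsub>A\<^esub> j) = (\<Oplus>\<^bsub>A\<^esub>j\<in>{..n}. cls (mono (lam (n - j)) j))"
    by (intro A.finsum_cong') (simp_all add: Pi_iff cls_mono[OF lam_closed, symmetric] lam_closed)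
  also have "\<dots> = cls f"
    unfolding f_sum using lam_closed by (intro cls_finsum[symmetric]) auto
  also have "\<dots> = \<zero>\<^bsub>A\<^esub>"
    unfolding mono_class_def zero_A IQ.zero_Q using f_in_I by (simp add: IQ.cos_zero_iff)
  finally show ?thesis .
qed

text \<open>
  The representative of degree below \<open>n\<close>; its coefficients are the coordinates of the class.
\<close>

definition remainder :: "(nat \<Rightarrow> 'a) set \<Rightarrow> nat \<Rightarrow> 'a"
  where "remainder X = (THE r. r \<in> carrier B \<and> (\<forall>i\<ge>n. r i = \<zero>) \<and> X = cls r)"

lemma remainder_eqI:
  assumes r: "r \<in> carrier B" "\<forall>i\<ge>n. r i = \<zero>" "X = cls r"
  shows "remainder X = r"
  unfolding remainder_def
proof (rule the_equality)
  fix s assume s: "s \<in> carrier B \<and> (\<forall>i\<ge>n. s i = \<zero>) \<and> X = cls s"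
  then have "s \<ominus>\<^bsub>B\<^esub> r \<in> I" using r cls_eq_iff[of s r] by simp
  moreover have "\<forall>i\<ge>n. (s \<ominus>\<^bsub>B\<^esub> r) i = \<zero>"
    using s r by (simp add: minus_B M.minus_eq M.r_neg)
  ultimately have "s \<ominus>\<^bsub>B\<^esub> r = \<zero>\<^bsub>B\<^esub>" unfolding zero_B by (rule low_degree_I)
  moreover have "s = (s \<ominus>\<^bsub>B\<^esub> r) \<oplus>\<^bsub>B\<^esub> r"
    using s r(1) by (simp add: B.minus_eq B.a_assoc B.l_neg)
  ultimately show "s = r" using r(1) by simp
qed (use r in simp)

lemma remainder:
  assumes "X \<in> carrier A"
  shows remainder_closed: "remainder X \<in> carrier B" and remainder_low: "\<forall>i\<ge>n. remainder X i = \<zero>"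
    and cls_remainder: "cls (remainder X) = X"
proof -
  obtain p where p: "p \<in> carrier B" "X = cls p" using assms by (rule carrier_AE)
  obtain r where r: "r \<in> carrier B" "\<forall>i\<ge>n. r i = \<zero>" "p \<ominus>\<^bsub>B\<^esub> r \<in> I" using division[OF p(1)] by blast
  have X: "X = cls r" unfolding p(2) using cls_eq_iff[OF p(1) r(1)] r(3) by simp
  have "remainder X = r" using r(1,2) X by (rule remainder_eqI)
  then show "remainder X \<in> carrier B" "\<forall>i\<ge>n. remainder X i = \<zero>" "cls (remainder X) = X"
    using r(1,2) X by simp_all
qed

lemma remainder_add:
  assumes X: "X \<in> carrier A" and Y: "Y \<in> carrier A"
  shows "remainder (X \<oplus>\<^bsub>A\<^esub> Y) = (\<lambda>i. remainder X i \<oplus> remainder Y i)"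
  unfolding add_B[symmetric]
proof (rule remainder_eqI)
  show "\<forall>i\<ge>n. (remainder X \<oplus>\<^bsub>B\<^esub> remainder Y) i = \<zero>"
    using remainder_low[OF X] remainder_low[OF Y] by (simp add: add_B)
  show "X \<oplus>\<^bsub>A\<^esub> Y = cls (remainder X \<oplus>\<^bsub>B\<^esub> remainder Y)"
    using remainder_closed[OF X] remainder_closed[OF Y] by (simp add: cls_add cls_remainder X Y)
qed (use remainder_closed[OF X] remainder_closed[OF Y] in simp)

lemma remainder_mult_const:
  assumes u: "u \<in> carrier K" and X: "X \<in> carrier A"
  shows "remainder (\<iota> u \<otimes>\<^bsub>A\<^esub> X) = (\<lambda>i. u \<otimes> remainder X i)"
    and "remainder (X \<otimes>\<^bsub>A\<^esub> \<iota> u) = (\<lambda>i. remainder X i \<otimes> u)"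
proof -
  note r = remainder_closed[OF X] and low = remainder_low[OF X]
  have l: "(\<lambda>i. u \<otimes> remainder X i) = mono u 0 \<otimes>\<^bsub>B\<^esub> remainder X"
    unfolding mono_mult[OF u r] by simp
  show "remainder (\<iota> u \<otimes>\<^bsub>A\<^esub> X) = (\<lambda>i. u \<otimes> remainder X i)"
  proof (rule remainder_eqI)
    show "\<forall>i\<ge>n. u \<otimes> remainder X i = \<zero>" using low u by simp
    show "\<iota> u \<otimes>\<^bsub>A\<^esub> X = cls (\<lambda>i. u \<otimes> remainder X i)"
      unfolding l using cls_mult[OF mono_closed[OF u] r, of 0] by (simp add: \<iota>_eq cls_remainder[OF X])
  qed (use u r l in simp)
  have d: "(\<lambda>i. remainder X i \<otimes> u) = remainder X \<otimes>\<^bsub>B\<^esub> mono u 0"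
    unfolding mult_const[OF u r] ..
  show "remainder (X \<otimes>\<^bsub>A\<^esub> \<iota> u) = (\<lambda>i. remainder X i \<otimes> u)"
  proof (rule remainder_eqI)
    show "\<forall>i\<ge>n. remainder X i \<otimes> u = \<zero>" using low u by simp
    show "X \<otimes>\<^bsub>A\<^esub> \<iota> u = cls (\<lambda>i. remainder X i \<otimes> u)"
      unfolding d using cls_mult[OF r mono_closed[OF u], of 0] by (simp add: \<iota>_eq cls_remainder[OF X])
  qed (use u r d in simp)
qed

lemma remainder_pow: "i < n \<Longrightarrow> remainder (x [^]\<^bsub>A\<^esub> i) = mono \<one> i"
proof (rule remainder_eqI)
  show "x [^]\<^bsub>A\<^esub> i = cls (mono \<one> i)"
    using cls_pow[of "mono \<one> (Suc 0)" i] var_pow[of i] by (simp add: var_eq)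
qed (simp_all, simp add: mono_def)

lemma remainder_expansion:
  assumes X: "X \<in> carrier A"
  shows "X = (\<Oplus>\<^bsub>A\<^esub>l\<in>{..<n}. \<iota> (remainder X l) \<otimes>\<^bsub>A\<^esub> x [^]\<^bsub>A\<^esub> l)"
proof -
  note r = remainder_closed[OF X] and low = remainder_low[OF X]
  have n: "{..<n} = {..n - 1}" using degree by auto
  have "(\<Oplus>\<^bsub>B\<^esub>j\<in>{..n - 1}. mono (remainder X j) j) = (\<lambda>i. if i \<le> n - 1 then remainder X i else \<zero>)"
    using r by (intro sum_monos) simp
  also have "\<dots> = remainder X"
    using low degree by (auto simp: fun_eq_iff)
  finally have "X = cls (\<Oplus>\<^bsub>B\<^esub>l\<in>{..<n}. mono (remainder X l) l)"
    using cls_remainder[OF X] unfolding n by simp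
  also have "\<dots> = (\<Oplus>\<^bsub>A\<^esub>l\<in>{..<n}. cls (mono (remainder X l) l))"
    using r by (intro cls_finsum) auto
  also have "\<dots> = (\<Oplus>\<^bsub>A\<^esub>l\<in>{..<n}. \<iota> (remainder X l) \<otimes>\<^bsub>A\<^esub> x [^]\<^bsub>A\<^esub> l)"
    using r by (intro A.finsum_cong') (simp_all add: Pi_iff cls_mono[symmetric])
  finally show ?thesis .
qed

lemma central_monogenic_A: "central_monogenic k K A \<iota> x n lam (\<lambda>l X. remainder X l)"
proof (intro central_monogenic.intro central_monogenic_axioms.intro)
  show "assoc_algebra k K" by (rule assoc_algebra_axioms)
  show "assoc_algebra k A" by (rule algebra_A)
  show "X = (\<Oplus>\<^bsub>A\<^esub>l\<in>{..<n}. \<iota> (remainder X l) \<otimes>\<^bsub>A\<^esub> x [^]\<^bsub>A\<^esub> l)" if "X \<in> carrier A" for X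
    using that by (rule remainder_expansion)
  show "x \<otimes>\<^bsub>A\<^esub> X = X \<otimes>\<^bsub>A\<^esub> x" if "X \<in> carrier A" for X
    using that by (rule x_central)
  show "lam i \<otimes> u = u \<otimes> lam i" if "i \<le> n" "u \<in> carrier K" for i u
    using that by (rule lam_central)
  show "remainder (x [^]\<^bsub>A\<^esub> i) l = (if i = l then \<one> else \<zero>)" if "l < n" "i < n" for l i
    unfolding remainder_pow[OF that(2)] by (auto simp: mono_def)
qed (simp_all add: \<iota>_hom degree lam_closed lam_zero equation remainder_closed remainder_add
    remainder_mult_const)

lemma class_of_derivative:
  "cls (mono_poly_deriv K \<alpha> n lam) = (\<Oplus>\<^bsub>A\<^esub>i\<in>{1..n}. [i] \<cdot>\<^bsub>A\<^esub> (\<iota> (lam (n - i)) \<otimes>\<^bsub>A\<^esub> x [^]\<^bsub>A\<^esub> (i - 1)))"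
proof -
  have "mono_poly_deriv K \<alpha> n lam = (\<Oplus>\<^bsub>B\<^esub>i\<in>{1..n}. [i] \<cdot>\<^bsub>B\<^esub> mono (lam (n - i)) (i - 1))"
    unfolding mono_poly_deriv_def using lam_closed
    by (intro B.finsum_cong') (auto simp: const_var_pow)
  then have "cls (mono_poly_deriv K \<alpha> n lam) = (\<Oplus>\<^bsub>A\<^esub>i\<in>{1..n}. cls ([i] \<cdot>\<^bsub>B\<^esub> mono (lam (n - i)) (i - 1)))"
    using lam_closed by (simp add: cls_finsum)
  also have "\<dots> = (\<Oplus>\<^bsub>A\<^esub>i\<in>{1..n}. [i] \<cdot>\<^bsub>A\<^esub> (\<iota> (lam (n - i)) \<otimes>\<^bsub>A\<^esub> x [^]\<^bsub>A\<^esub> (i - 1)))"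
  proof (intro A.finsum_cong')
    fix i assume "i \<in> {1..n}"
    then have "lam (n - i) \<in> carrier K" by (simp add: lam_closed)
    then show "cls ([i] \<cdot>\<^bsub>B\<^esub> mono (lam (n - i)) (i - 1)) = [i] \<cdot>\<^bsub>A\<^esub> (\<iota> (lam (n - i)) \<otimes>\<^bsub>A\<^esub> x [^]\<^bsub>A\<^esub> (i - 1))"
      by (simp only: cls_multiple[OF mono_closed] cls_mono)
  qed (auto simp: \<iota>_eq lam_closed)
  finally show ?thesis .
qed

end

theorem corollary2p10:
  fixes k :: "('k, 'c) ring_scheme" and K :: "('k, 'a, 'd) module_scheme"
    and \<alpha> :: "'a \<Rightarrow> 'a" and n :: nat and lam :: "nat \<Rightarrow> 'a" and m :: nat
  assumes "monogenic_data k K \<alpha> n lam"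
    and "\<forall>l\<in>carrier K. \<alpha> l = l"
  shows
    "let A = monogenic_ext K \<alpha> n lam;
         AA = commutator_submodule k A;
         f' = mono_class K \<alpha> n lam (mono_poly_deriv K \<alpha> n lam)
     in module_isomorphic k (mono_HH k K \<alpha> n lam 0) (quot_module A AA) \<and>
        module_isomorphic k (mono_HH k K \<alpha> n lam (2 * m + 1))
          (quot_module A (AA <+>\<^bsub>A\<^esub> (f' <#\<^bsub>A\<^esub> carrier A))) \<and>
        module_isomorphic k (mono_HH k K \<alpha> n lam (2 * m + 2))
          (quot_module (A\<lparr>carrier := {a \<in> carrier A. f' \<otimes>\<^bsub>A\<^esub> a \<in> AA}\<rparr>) AA)"
proof -
  interpret P: central_polynomial k K \<alpha> n lam
    using assms by (simp add: central_polynomial_def central_polynomial_axioms_def)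
  note A = P.central_monogenic_A
  note f' = trans[OF central_monogenic.fprime_eq[OF A] P.class_of_derivative[symmetric]]
  note AA = central_monogenic.AA_def[OF A]
  have "module_isomorphic k (mono_HH k K \<alpha> n lam 0) (quot_module P.A (commutator_submodule k P.A))"
    using central_monogenic.homology_zero[OF A] unfolding mono_HH_def AA .
  moreover have "odd (2 * m + 1)" by simp
  note central_monogenic.homology_odd[OF A this, unfolded central_monogenic.comm_deriv_def[OF A] AA f',
      folded mono_HH_def]
  moreover have "even (2 * m + 2)" "0 < 2 * m + 2" by simp_all
  note central_monogenic.homology_even[OF A this, unfolded central_monogenic.annihilator_def[OF A] AA f',
      folded mono_HH_def]
  ultimately show ?thesis unfolding Let_def by (intro conjI)
qed

end
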